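(* Assume the standing setup with $Z=\mathbb{Z}/p$, $p$ prime. Let $G$ be a profinite group, $N$ a closed normal subgroup of $G$ contained in $\bar T(G)$, and $\pi\colon G\to G/N$ the projection. Let $\bar\pi\colon G\to G/\bar T(G)$ be the projection, let $\inf\colon H^2(G/\bar T(G))\to H^2(G/N)$ be inflation, and let $\Pi\subseteq H^2(G/\bar T(G))$ be the set of all pullbacks $\bar\rho^*(\alpha_\omega)$ with $\omega\in\Omega$ and $\bar\rho\colon G/\bar T(G)\to\bar{\mathbb{U}}_\omega$ a $\bar\pi$-liftable continuous homomorphism. The following are equivalent: (a) $\pi[T(G)]=T(G/N)$; (b) $\langle\Pi\cap\operatorname{Ker}(\inf)\rangle=\langle\Pi\rangle\cap\operatorname{Ker}(\inf)$, where $\langle\cdot\rangle$ denotes the generated subgroup.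
   Context: Standing setup: all homomorphisms of profinite groups are continuous. For profinite groups $\mathbb{U}$ and $G$, $T^{\mathbb{U}}(G)$ denotes the intersection of the kernels of all continuous homomorphisms $G\to\mathbb{U}$. Fix a finite abelian group $Z$ and a nonempty set $\Omega$ of central extensions of profinite groups $\omega\colon 0\to Z\to\mathbb{U}_\omega\xrightarrow{\lambda_\omega}\bar{\mathbb{U}}_\omega\to1$ such that for every $\omega$: (I) there are finitely many continuous homomorphisms $\gamma_1,\dots,\gamma_n\colon\bar{\mathbb{U}}_\omega\to\mathbb{U}_\omega$ with $\bigcap_i\operatorname{Ker}(\gamma_i)=\{1\}$; (II) $Z$ embeds as a closed subgroup of $\bar{\mathbb{U}}_\omega$. For a profinite group $G$ set $T(G)=\bigcap_{\omega\in\Omega}T^{\mathbb{U}_\omega}(G)$ and $\bar T(G)=\bigcap_{\omega\in\Omega}T^{\bar{\mathbb{U}}_\omega}(G)$. Here $H^i(G)=H^i(G,\mathbb{Z}/p)$ with trivial action. $\alpha_\omega\in H^2(\bar{\mathbb{U}}_\omega)$ is the class of $\omega$, and $\bar\rho^*(\alpha_\omega)$ its pullback along $\bar\rho$. A continuous $\bar\rho\colon G/\bar T(G)\to\bar{\mathbb{U}}_\omega$ is $\bar\pi$-liftable if there is a continuous $\rho\colon G\to\mathbb{U}_\omega$ with $\lambda_\omega\circ\rho=\bar\rho\circ\bar\pi$. *)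

theory Defs
  imports "HOL-Analysis.Analysis" "HOL-Algebra.Algebra"
begin

definition topgroup :: "('a, 'm) monoid_scheme \<Rightarrow> 'a topology \<Rightarrow> bool" where
  "topgroup G \<tau> \<longleftrightarrow> group G \<and> topspace \<tau> = carrier G \<and>
     continuous_map (prod_topology \<tau> \<tau>) \<tau> (\<lambda>(x, y). x \<otimes>\<^bsub>G\<^esub> y) \<and>
     continuous_map \<tau> \<tau> (\<lambda>x. inv\<^bsub>G\<^esub> x)"

definition profinite :: "('a, 'm) monoid_scheme \<Rightarrow> 'a topology \<Rightarrow> bool" where
  "profinite G \<tau> \<longleftrightarrow> topgroup G \<tau> \<and> compact_space \<tau> \<and> Hausdorff_space \<tau> \<and>
     (\<forall>S. connectedin \<tau> S \<longrightarrow> (\<exists>a. S \<subseteq> {a}))"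

definition cont_hom :: "('a, 'm) monoid_scheme \<Rightarrow> 'a topology \<Rightarrow> ('b, 'n) monoid_scheme \<Rightarrow> 'b topology
    \<Rightarrow> ('a \<Rightarrow> 'b) set" where
  "cont_hom G \<tau> H \<sigma> = {\<phi>. \<phi> \<in> hom G H \<and> continuous_map \<tau> \<sigma> \<phi>}"

definition quot_top :: "('a, 'm) monoid_scheme \<Rightarrow> 'a topology \<Rightarrow> 'a set \<Rightarrow> 'a set topology" where
  "quot_top G \<tau> N = topology (\<lambda>U. U \<subseteq> rcosets\<^bsub>G\<^esub> N \<and> openin \<tau> (\<Union>U))"

definition Zp :: "int \<Rightarrow> int monoid" where
  "Zp p = \<lparr>carrier = {0..<p}, mult = (\<lambda>a b. (a + b) mod p), one = 0\<rparr>"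

definition Zp_top :: "int \<Rightarrow> int topology" where
  "Zp_top p = discrete_topology {0..<p}"

definition cochain1 :: "('a, 'm) monoid_scheme \<Rightarrow> 'a topology \<Rightarrow> int \<Rightarrow> ('a \<Rightarrow> int) \<Rightarrow> bool" where
  "cochain1 G \<tau> p c \<longleftrightarrow> (\<forall>x. x \<notin> carrier G \<longrightarrow> c x = 0) \<and> continuous_map \<tau> (Zp_top p) c"

definition cochain2 :: "('a, 'm) monoid_scheme \<Rightarrow> 'a topology \<Rightarrow> int \<Rightarrow> ('a \<Rightarrow> 'a \<Rightarrow> int) \<Rightarrow> bool" where
  "cochain2 G \<tau> p f \<longleftrightarrow> (\<forall>x y. x \<notin> carrier G \<or> y \<notin> carrier G \<longrightarrow> f x y = 0) \<and>
     continuous_map (prod_topology \<tau> \<tau>) (Zp_top p) (\<lambda>(x, y). f x y)"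

definition cocycle2 :: "('a, 'm) monoid_scheme \<Rightarrow> 'a topology \<Rightarrow> int \<Rightarrow> ('a \<Rightarrow> 'a \<Rightarrow> int) \<Rightarrow> bool" where
  "cocycle2 G \<tau> p f \<longleftrightarrow> cochain2 G \<tau> p f \<and>
     (\<forall>g\<in>carrier G. \<forall>h\<in>carrier G. \<forall>k\<in>carrier G.
        (f h k - f (g \<otimes>\<^bsub>G\<^esub> h) k + f g (h \<otimes>\<^bsub>G\<^esub> k) - f g h) mod p = 0)"

definition cobound :: "('a, 'm) monoid_scheme \<Rightarrow> int \<Rightarrow> ('a \<Rightarrow> int) \<Rightarrow> 'a \<Rightarrow> 'a \<Rightarrow> int" where
  "cobound G p c x y = (if x \<in> carrier G \<and> y \<in> carrier G
      then (c y - c (x \<otimes>\<^bsub>G\<^esub> y) + c x) mod p else 0)"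

definition cohom_class :: "('a, 'm) monoid_scheme \<Rightarrow> 'a topology \<Rightarrow> int \<Rightarrow> ('a \<Rightarrow> 'a \<Rightarrow> int)
    \<Rightarrow> ('a \<Rightarrow> 'a \<Rightarrow> int) set" where
  "cohom_class G \<tau> p f = {f'. cocycle2 G \<tau> p f' \<and>
      (\<exists>c. cochain1 G \<tau> p c \<and> f' = (\<lambda>x y. (f x y + cobound G p c x y) mod p))}"

definition H2 :: "('a, 'm) monoid_scheme \<Rightarrow> 'a topology \<Rightarrow> int \<Rightarrow> ('a \<Rightarrow> 'a \<Rightarrow> int) set set" where
  "H2 G \<tau> p = {cohom_class G \<tau> p f | f. cocycle2 G \<tau> p f}"

definition H2grp :: "('a, 'm) monoid_scheme \<Rightarrow> 'a topology \<Rightarrow> int \<Rightarrow> ('a \<Rightarrow> 'a \<Rightarrow> int) set monoid" where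
  "H2grp G \<tau> p = \<lparr>carrier = H2 G \<tau> p,
     mult = (\<lambda>A B. {h. \<exists>f\<in>A. \<exists>g\<in>B. h = (\<lambda>x y. (f x y + g x y) mod p)}),
     one = cohom_class G \<tau> p (\<lambda>x y. 0)\<rparr>"

definition pullback :: "('a, 'm) monoid_scheme \<Rightarrow> 'a topology \<Rightarrow> int \<Rightarrow> ('a \<Rightarrow> 'b)
    \<Rightarrow> ('b \<Rightarrow> 'b \<Rightarrow> int) set \<Rightarrow> ('a \<Rightarrow> 'a \<Rightarrow> int) set" where
  "pullback A \<tau> p \<phi> cls = (\<Union>f\<in>cls. cohom_class A \<tau> p
      (\<lambda>x y. if x \<in> carrier A \<and> y \<in> carrier A then f (\<phi> x) (\<phi> y) else 0))"

record ('u, 'v) cext =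
  ext_U :: "'u monoid"
  ext_UT :: "'u topology"
  ext_Ub :: "'v monoid"
  ext_UbT :: "'v topology"
  ext_iota :: "int \<Rightarrow> 'u"
  ext_lam :: "'u \<Rightarrow> 'v"

definition central_ext :: "int \<Rightarrow> ('u, 'v) cext \<Rightarrow> bool" where
  "central_ext p \<omega> \<longleftrightarrow>
     profinite (ext_U \<omega>) (ext_UT \<omega>) \<and> profinite (ext_Ub \<omega>) (ext_UbT \<omega>) \<and>
     ext_iota \<omega> \<in> cont_hom (Zp p) (Zp_top p) (ext_U \<omega>) (ext_UT \<omega>) \<and>
     inj_on (ext_iota \<omega>) {0..<p} \<and>
     (\<forall>z\<in>{0..<p}. \<forall>u\<in>carrier (ext_U \<omega>).
        ext_iota \<omega> z \<otimes>\<^bsub>ext_U \<omega>\<^esub> u = u \<otimes>\<^bsub>ext_U \<omega>\<^esub> ext_iota \<omega> z) \<and>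
     ext_lam \<omega> \<in> cont_hom (ext_U \<omega>) (ext_UT \<omega>) (ext_Ub \<omega>) (ext_UbT \<omega>) \<and>
     ext_lam \<omega> ` carrier (ext_U \<omega>) = carrier (ext_Ub \<omega>) \<and>
     kernel (ext_U \<omega>) (ext_Ub \<omega>) (ext_lam \<omega>) = ext_iota \<omega> ` {0..<p}"

definition cond_I :: "('u, 'v) cext \<Rightarrow> bool" where
  "cond_I \<omega> \<longleftrightarrow> (\<exists>\<Gamma>. finite \<Gamma> \<and>
     \<Gamma> \<subseteq> cont_hom (ext_Ub \<omega>) (ext_UbT \<omega>) (ext_U \<omega>) (ext_UT \<omega>) \<and>
     carrier (ext_Ub \<omega>) \<inter> (\<Inter>\<gamma>\<in>\<Gamma>. kernel (ext_Ub \<omega>) (ext_U \<omega>) \<gamma>) = {\<one>\<^bsub>ext_Ub \<omega>\<^esub>})"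

definition cond_II :: "int \<Rightarrow> ('u, 'v) cext \<Rightarrow> bool" where
  "cond_II p \<omega> \<longleftrightarrow> (\<exists>e. e \<in> cont_hom (Zp p) (Zp_top p) (ext_Ub \<omega>) (ext_UbT \<omega>) \<and>
     inj_on e {0..<p} \<and> closedin (ext_UbT \<omega>) (e ` {0..<p}))"

definition ext_class :: "int \<Rightarrow> ('u, 'v) cext \<Rightarrow> ('v \<Rightarrow> 'v \<Rightarrow> int) set" where
  "ext_class p \<omega> = {f. \<exists>s. continuous_map (ext_UbT \<omega>) (ext_UT \<omega>) s \<and>
      (\<forall>x\<in>carrier (ext_Ub \<omega>). ext_lam \<omega> (s x) = x) \<and>
      f = (\<lambda>x y. if x \<in> carrier (ext_Ub \<omega>) \<and> y \<in> carrier (ext_Ub \<omega>)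
                 then (THE z. z \<in> {0..<p} \<and> ext_iota \<omega> z =
                        s x \<otimes>\<^bsub>ext_U \<omega>\<^esub> s y \<otimes>\<^bsub>ext_U \<omega>\<^esub> inv\<^bsub>ext_U \<omega>\<^esub> (s (x \<otimes>\<^bsub>ext_Ub \<omega>\<^esub> y)))
                 else 0)}"

definition TU :: "('a, 'm) monoid_scheme \<Rightarrow> 'a topology \<Rightarrow> 'u monoid \<Rightarrow> 'u topology \<Rightarrow> 'a set" where
  "TU G \<tau> U \<sigma> = carrier G \<inter> (\<Inter>\<phi>\<in>cont_hom G \<tau> U \<sigma>. kernel G U \<phi>)"

definition Tgrp :: "('u, 'v) cext set \<Rightarrow> ('a, 'm) monoid_scheme \<Rightarrow> 'a topology \<Rightarrow> 'a set" where
  "Tgrp \<Omega> G \<tau> = carrier G \<inter> (\<Inter>\<omega>\<in>\<Omega>. TU G \<tau> (ext_U \<omega>) (ext_UT \<omega>))"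

definition Tbar :: "('u, 'v) cext set \<Rightarrow> ('a, 'm) monoid_scheme \<Rightarrow> 'a topology \<Rightarrow> 'a set" where
  "Tbar \<Omega> G \<tau> = carrier G \<inter> (\<Inter>\<omega>\<in>\<Omega>. TU G \<tau> (ext_Ub \<omega>) (ext_UbT \<omega>))"

end

theory Submission
  imports Defs "HOL-Number_Theory.Cong"
begin

text \<open>
  Write \<open>M\<close> for \<open>Tbar\<close> of \<open>G\<close>. A class \<open>c\<close> of \<open>H\<^sup>2(G/M)\<close> whose inflation to \<open>G\<close> is the coboundary
  of a continuous cochain \<open>h\<close> on \<open>G\<close> has a character \<open>t \<mapsto> h t - h 1\<close> on \<open>M\<close>. By condition (II) all
  homomorphisms from \<open>G\<close> to \<open>Z/p\<close> vanish on \<open>M\<close>, so the character depends only on \<open>c\<close>; it also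
  determines \<open>c\<close> (it is the inverse of the transgression), and \<open>c\<close> inflates to zero on \<open>G/N\<close> iff
  its character vanishes on \<open>N\<close>. The characters of the members of \<open>Pi\<close> are, up to sign, the restrictions
  to \<open>M\<close> of the homomorphisms from \<open>G\<close> to the groups \<open>U\<close>, so that \<open>T(G)\<close> and, using condition (I), the preimage of
  \<open>T(G/N)\<close> are the common kernels of the characters of \<open>Pi\<close> and of \<open>Pi \<inter> Ker(inf)\<close>. Duality between
  closed subgroups of \<open>M\<close> and groups of characters then turns (a) into (b).
\<close>

section \<open>Topological preliminaries\<close>

text \<open>Statement (b) is not automatic because \<open>Pi\<close> need not be a subgroup: a
  combination of its members can vanish on N although its terms do not. Seen in M, the common kernel
  of <Pi> meet Ker(inf) is N T(G), while that of Pi meet Ker(inf) is the preimage of T(G/N). (b)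
  says that the second set of characters already generates the first, (a) that the two kernels
  coincide. A homomorphism from G to some \<open>U\<close> becomes a character on M because its
  composite with \<open>lam\<close> is a homomorphism to \<open>Ub\<close>, hence trivial on M; so
  it maps M into the central copy of Z/p. Condition (I) places T(G) and the preimage of T(G/N)
  inside M, where characters can see them: composing a homomorphism from G to \<open>Ub\<close> with
  the maps of (I) gives homomorphisms to \<open>U\<close> that are trivial on N. The class of an
  extension is defined through continuous sections of \<open>lam\<close>, so these must be shown to
  exist; otherwise the class would be the empty set. Neither sections nor cocycles are normalised,
  which is why values at the identity are subtracted throughout.\<close>

lemma continuous_map_discrete_iff:
  "continuous_map \<sigma> (discrete_topology S) h \<longleftrightarrow>
     (\<forall>x\<in>topspace \<sigma>. h x \<in> S) \<and> (\<forall>z\<in>S. openin \<sigma> {x \<in> topspace \<sigma>. h x = z})"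
proof (intro iffI conjI ballI)
  assume h: "continuous_map \<sigma> (discrete_topology S) h"
  then show "h x \<in> S" if "x \<in> topspace \<sigma>" for x
    using that by (auto simp: continuous_map_def)
  show "openin \<sigma> {x \<in> topspace \<sigma>. h x = z}" if "z \<in> S" for z
    using openin_continuous_map_preimage[OF h, of "{z}"] that by simp
next
  assume h: "(\<forall>x\<in>topspace \<sigma>. h x \<in> S) \<and> (\<forall>z\<in>S. openin \<sigma> {x \<in> topspace \<sigma>. h x = z})"
  have "{x \<in> topspace \<sigma>. h x \<in> U} = (\<Union>z\<in>U. {x \<in> topspace \<sigma>. h x = z})" for U
    by auto
  then show "continuous_map \<sigma> (discrete_topology S) h"
    using h by (auto simp: continuous_map_def intro!: openin_Union)
qed

text \<open>Supplies the continuity of all pointwise arithmetic on cochains: a fibre of the combined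
  map is a union of intersections of fibres of \<open>h\<close> and \<open>k\<close>.\<close>

lemma continuous_map_discrete_binary:
  assumes h: "continuous_map \<sigma> (discrete_topology A) h"
    and k: "continuous_map \<sigma> (discrete_topology B) k"
    and F: "\<And>a b. a \<in> A \<Longrightarrow> b \<in> B \<Longrightarrow> F a b \<in> C"
  shows "continuous_map \<sigma> (discrete_topology C) (\<lambda>x. F (h x) (k x))"
proof -
  have "{x \<in> topspace \<sigma>. F (h x) (k x) = z} =
      (\<Union>(a, b)\<in>{(a, b). a \<in> A \<and> b \<in> B \<and> F a b = z}.
        {x \<in> topspace \<sigma>. h x = a} \<inter> {x \<in> topspace \<sigma>. k x = b})" for z
    using h k by (auto simp: continuous_map_discrete_iff)
  moreover have "openin \<sigma> (\<Union>(a, b)\<in>{(a, b). a \<in> A \<and> b \<in> B \<and> F a b = z}.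
        {x \<in> topspace \<sigma>. h x = a} \<inter> {x \<in> topspace \<sigma>. k x = b})" for z
    using h k by (intro openin_Union) (auto simp: continuous_map_discrete_iff)
  ultimately show ?thesis
    using h k F by (auto simp: continuous_map_discrete_iff)
qed

text \<open>Components are points here, so \<open>{x}\<close> is a compact component; Wilder's
  theorem splits the space into two open sets, one containing \<open>x\<close> and contained in
  \<open>W\<close>.\<close>

lemma clopen_neighbourhood:
  assumes "compact_space \<sigma>" "Hausdorff_space \<sigma>"
    and td: "\<And>S. connectedin \<sigma> S \<Longrightarrow> \<exists>a. S \<subseteq> {a}"
    and W: "openin \<sigma> W" "x \<in> W"
  obtains V where "openin \<sigma> V" "closedin \<sigma> V" "x \<in> V" "V \<subseteq> W"
proof -
  have x: "x \<in> topspace \<sigma>"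
    using W openin_subset by blast
  obtain a where "connected_component_of_set \<sigma> x \<subseteq> {a}"
    using td connectedin_connected_component_of by metis
  moreover have "x \<in> connected_component_of_set \<sigma> x"
    using x by (simp add: connected_component_of_refl)
  ultimately have C: "connected_component_of_set \<sigma> x = {x}"
    by blast
  have comp: "{x} \<in> connected_components_of \<sigma>"
    using C x connected_component_in_connected_components_of by metis
  obtain U V where UV: "openin \<sigma> U" "openin \<sigma> V" "disjnt U V" "U \<union> V = topspace \<sigma>"
      "{x} \<subseteq> U" "U \<subseteq> W"
    by (rule wilder_locally_compact_component_thm[of \<sigma> "{x}" W])
      (use assms x comp in \<open>auto simp: compact_imp_locally_compact_space\<close>)
  have "U = topspace \<sigma> - V"
    using UV by (auto simp: disjnt_iff)
  then show thesis
    using that[of U] UV by auto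
qed

text \<open>The section is the inverse of the restriction of \<open>f\<close> to a clopen transversal of its fibres,
  obtained by disjointifying a finite clopen cover on whose members \<open>f\<close> is injective.\<close>

lemma continuous_section_exists:
  assumes \<sigma>: "compact_space \<sigma>" "Hausdorff_space \<sigma>" and Y: "Hausdorff_space Y"
    and f: "continuous_map \<sigma> Y f" "open_map \<sigma> Y f" "f ` topspace \<sigma> = topspace Y"
    and loc: "\<And>x. x \<in> topspace \<sigma> \<Longrightarrow>
      \<exists>W. openin \<sigma> W \<and> closedin \<sigma> W \<and> x \<in> W \<and> inj_on f W"
  obtains s where "continuous_map Y \<sigma> s" "\<And>y. y \<in> topspace Y \<Longrightarrow> f (s y) = y"
proof -
  have closed: "closed_map \<sigma> Y f"
    using \<sigma> Y f by (simp add: continuous_imp_closed_map)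
  have step: "\<exists>B. openin \<sigma> B \<and> closedin \<sigma> B \<and> inj_on f B \<and> f ` (\<Union>\<W>) \<subseteq> f ` B"
    if "finite \<W>" "\<forall>W\<in>\<W>. openin \<sigma> W \<and> closedin \<sigma> W \<and> inj_on f W" for \<W>
    using that
  proof (induction \<W> rule: finite_induct)
    case empty
    then show ?case by (intro exI[of _ "{}"]) auto
  next
    case (insert W \<W>)
    then obtain B where B: "openin \<sigma> B" "closedin \<sigma> B" "inj_on f B" "f ` (\<Union>\<W>) \<subseteq> f ` B"
      by auto
    \<comment> \<open>The saturation of \<open>B\<close> under \<open>f\<close>. It is clopen since
      \<open>f\<close> is open by assumption and closed by compactness.\<close>
    define S where "S = {x \<in> topspace \<sigma>. f x \<in> f ` B}"
    have S: "openin \<sigma> S"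
      unfolding S_def using B f(1,2)
      by (auto intro!: openin_continuous_map_preimage[OF f(1)] simp: open_map_def)
    have S': "closedin \<sigma> S"
      unfolding S_def using B f(1) closed
      by (auto intro!: closedin_continuous_map_preimage[OF f(1)] simp: closed_map_def)
    have "W \<subseteq> topspace \<sigma>"
      and W: "openin \<sigma> W" "closedin \<sigma> W" "inj_on f W"
      using insert.prems openin_subset by auto
    \<comment> \<open>Points of \<open>W\<close> whose image is already hit by \<open>B\<close> have
      been discarded, so the images of the two pieces are disjoint.\<close>
    have "inj_on f (B \<union> (W - S))"
      unfolding inj_on_Un
    proof (intro conjI)
      show "f ` (B - (W - S)) \<inter> f ` (W - S - B) = {}"
        using \<open>W \<subseteq> topspace \<sigma>\<close> by (auto simp: S_def intro: rev_image_eqI)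
    qed (use B(3) W(3) in \<open>auto intro: inj_on_subset\<close>)
    moreover have "f ` (\<Union>(insert W \<W>)) \<subseteq> f ` (B \<union> (W - S))"
    proof
      fix y assume "y \<in> f ` (\<Union>(insert W \<W>))"
      then consider x where "x \<in> W" "y = f x" | "y \<in> f ` (\<Union>\<W>)"
        by auto
      then show "y \<in> f ` (B \<union> (W - S))"
      proof cases
        case 1
        show ?thesis
        proof (cases "f x \<in> f ` B")
          case False
          then have "x \<in> W - S"
            using 1 by (simp add: S_def)
          then show ?thesis
            using 1 by simp
        qed (simp add: 1 image_Un)
      next
        case 2
        then show ?thesis
          using B(4) by (simp only: image_Un) blast
      qed
    qed
    moreover have "openin \<sigma> (B \<union> (W - S))" "closedin \<sigma> (B \<union> (W - S))"
      using B(1,2) W(1,2) S S' by (meson openin_Un openin_diff closedin_Un closedin_diff)+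
    ultimately show ?case
      by blast
  qed
  let ?\<W> = "{W. openin \<sigma> W \<and> closedin \<sigma> W \<and> inj_on f W}"
  obtain \<W> where \<W>: "finite \<W>" "\<W> \<subseteq> ?\<W>" "topspace \<sigma> \<subseteq> \<Union>\<W>"
  proof -
    have "\<Union>?\<W> = topspace \<sigma>"
      using loc openin_subset by fastforce
    then have "\<exists>\<F>. finite \<F> \<and> \<F> \<subseteq> ?\<W> \<and> topspace \<sigma> \<subseteq> \<Union>\<F>"
      using \<sigma>(1) unfolding compact_space_alt by (elim allE[of _ ?\<W>]) simp
    then show ?thesis
      using that by blast
  qed
  have "\<exists>B. openin \<sigma> B \<and> closedin \<sigma> B \<and> inj_on f B \<and> f ` (\<Union>\<W>) \<subseteq> f ` B"
    by (rule step) (use \<W> in auto)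
  then obtain B where B: "openin \<sigma> B" "closedin \<sigma> B" "inj_on f B" "f ` (\<Union>\<W>) \<subseteq> f ` B"
    by auto
  have B_sub: "B \<subseteq> topspace \<sigma>"
    using B openin_subset by blast
  have fB: "f ` B = topspace Y"
    using image_mono[OF B_sub, of f] image_mono[OF \<W>(3), of f] B(4) f(3) by simp
  \<comment> \<open>A continuous bijection from the compact set \<open>B\<close> onto the Hausdorff
    space \<open>Y\<close> has a continuous inverse.\<close>
  have "continuous_map (subtopology Y (topspace Y)) (subtopology \<sigma> B) (inv_into B f)"
  proof (rule continuous_inverse_map[where f = f])
    show "compact_space (subtopology \<sigma> B)"
      using B(2) \<sigma>(1) by (simp add: closedin_compact_space compact_space_subtopology)
    show "continuous_map (subtopology \<sigma> B) Y f"
      using f(1) by (rule continuous_map_from_subtopology)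
    show "inv_into B f (f x) = x" if "x \<in> topspace (subtopology \<sigma> B)" for x
      using that B(3) by simp
    show "topspace Y \<subseteq> f ` topspace (subtopology \<sigma> B)"
      by (simp only: topspace_subtopology_subset[OF B_sub] fB order_refl)
  qed (use Y in auto)
  then show thesis
    using that[of "inv_into B f"] fB
    by (metis continuous_map_into_fulltopology f_inv_into_f subtopology_topspace)
qed

section \<open>The quotient topology on cosets\<close>

text \<open>\<open>topology\<close> returns the intended open sets only for a predicate that
  satisfies the axioms. Closure under intersection is the point: the union of
  \<open>S \<inter> T\<close> equals the intersection of the unions because distinct cosets are
  disjoint.\<close>

lemma openin_quot_top:
  assumes "group G" "subgroup N G"
  shows "openin (quot_top G \<tau> N) U \<longleftrightarrow> U \<subseteq> rcosets\<^bsub>G\<^esub> N \<and> openin \<tau> (\<Union>U)"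
proof -
  have disj: "A = B" if "A \<in> rcosets\<^bsub>G\<^esub> N" "B \<in> rcosets\<^bsub>G\<^esub> N" "x \<in> A" "x \<in> B" for A B x
    using group.rcos_disjoint[OF assms] that by (auto simp: pairwise_def disjnt_iff)
  have "\<Union>(S \<inter> T) = \<Union>S \<inter> \<Union>T" if "S \<subseteq> rcosets\<^bsub>G\<^esub> N" "T \<subseteq> rcosets\<^bsub>G\<^esub> N" for S T
    using that disj by blast
  moreover have "\<Union>(\<Union>\<K>) = (\<Union>K\<in>\<K>. \<Union>K)" for \<K> :: "'a set set set"
    by auto
  ultimately have "istopology (\<lambda>U. U \<subseteq> rcosets\<^bsub>G\<^esub> N \<and> openin \<tau> (\<Union>U))"
    unfolding istopology_def by (auto intro: openin_Union)
  then show ?thesis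
    by (simp add: quot_top_def)
qed

text \<open>From here on, continuity of a map on the quotient is tested by composing it with the
  projection.\<close>

lemma quotient_map_quot_top:
  assumes G: "group G" "subgroup N G" and top: "topspace \<tau> = carrier G"
  shows "quotient_map \<tau> (quot_top G \<tau> N) (\<lambda>g. N #>\<^bsub>G\<^esub> g)"
    and "topspace (quot_top G \<tau> N) = rcosets\<^bsub>G\<^esub> N"
proof -
  have self: "g \<in> N #>\<^bsub>G\<^esub> g" if "g \<in> carrier G" for g
    using G that group.rcos_self by metis
  have uniq: "A = N #>\<^bsub>G\<^esub> g" if "A \<in> rcosets\<^bsub>G\<^esub> N" "g \<in> A" for A g
    using that G group.repr_independence by (fastforce simp: RCOSETS_def)
  have sub: "A \<subseteq> carrier G" if "A \<in> rcosets\<^bsub>G\<^esub> N" for A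
    using that G group.rcosets_part_G by blast
  have "openin \<tau> (\<Union>(rcosets\<^bsub>G\<^esub> N))"
    using group.rcosets_part_G[OF G] top openin_topspace by metis
  then show ts: "topspace (quot_top G \<tau> N) = rcosets\<^bsub>G\<^esub> N"
    by (intro equalityI subsetI) (auto simp: topspace_def openin_quot_top[OF G])
  have "{x \<in> carrier G. N #>\<^bsub>G\<^esub> x \<in> U} = \<Union>U" if "U \<subseteq> rcosets\<^bsub>G\<^esub> N" for U
    using that self uniq sub by blast
  then show "quotient_map \<tau> (quot_top G \<tau> N) (\<lambda>g. N #>\<^bsub>G\<^esub> g)"
    unfolding quotient_map_def ts top by (auto simp: openin_quot_top[OF G] RCOSETS_def)
qed

section \<open>Homomorphisms to the integers modulo p\<close>

text \<open>Integer-valued functions up to congruence stand for homomorphisms to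
  \<open>Zp p\<close>, so that linear combinations need no reduction. The domain \<open>A\<close> is
  a parameter because inductions pass to smaller subgroups.\<close>

definition hom_mod :: "('a, 'm) monoid_scheme \<Rightarrow> int \<Rightarrow> 'a set \<Rightarrow> ('a \<Rightarrow> int) \<Rightarrow> bool" where
  "hom_mod G p A \<xi> \<longleftrightarrow> (\<forall>x\<in>A. \<forall>y\<in>A. [\<xi> (x \<otimes>\<^bsub>G\<^esub> y) = \<xi> x + \<xi> y] (mod p))"

lemma hom_modD:
  "hom_mod G p A \<xi> \<Longrightarrow> x \<in> A \<Longrightarrow> y \<in> A \<Longrightarrow> [\<xi> (x \<otimes>\<^bsub>G\<^esub> y) = \<xi> x + \<xi> y] (mod p)"
  by (simp add: hom_mod_def)

lemma hom_mod_subset: "hom_mod G p A \<xi> \<Longrightarrow> B \<subseteq> A \<Longrightarrow> hom_mod G p B \<xi>"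
  by (auto simp: hom_mod_def)

lemma hom_mod_lincomb:
  assumes "\<And>i. i \<in> F \<Longrightarrow> hom_mod G p A (\<xi> i)"
  shows "hom_mod G p A (\<lambda>x. \<Sum>i\<in>F. a i * \<xi> i x)"
proof -
  have "[(\<Sum>i\<in>F. a i * \<xi> i (x \<otimes>\<^bsub>G\<^esub> y)) = (\<Sum>i\<in>F. a i * (\<xi> i x + \<xi> i y))] (mod p)"
    if "x \<in> A" "y \<in> A" for x y
    using that assms by (intro cong_sum cong_mult cong_refl) (auto simp: hom_mod_def)
  then show ?thesis
    by (simp add: hom_mod_def algebra_simps sum.distrib)
qed

lemma hom_mod_diff:
  "hom_mod G p A \<xi> \<Longrightarrow> hom_mod G p A \<psi> \<Longrightarrow> hom_mod G p A (\<lambda>x. \<xi> x - \<psi> x)"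
  unfolding hom_mod_def by (metis add_diff_add cong_diff)

context group
begin

lemma subgroup_nat_pow_closed: "subgroup A G \<Longrightarrow> x \<in> A \<Longrightarrow> x [^] (n::nat) \<in> A"
  by (induction n) (auto intro: subgroup.one_closed subgroup.m_closed)

lemma hom_mod_one:
  assumes "subgroup A G" "hom_mod G p A \<xi>"
  shows "[\<xi> \<one> = 0] (mod p)"
proof -
  have "[\<xi> (\<one> \<otimes> \<one>) = \<xi> \<one> + \<xi> \<one>] (mod p)"
    using assms by (intro hom_modD) (auto intro: subgroup.one_closed)
  then show ?thesis
    by (simp add: cong_iff_dvd_diff)
qed

lemma hom_mod_inv:
  assumes "subgroup A G" "hom_mod G p A \<xi>" "x \<in> A"
  shows "[\<xi> (inv x) = - \<xi> x] (mod p)"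
proof -
  have "x \<in> carrier G" "inv x \<in> A"
    using assms subgroup.mem_carrier subgroup.m_inv_closed by fast+
  then have "[\<xi> \<one> = \<xi> x + \<xi> (inv x)] (mod p)"
    using hom_modD[OF assms(2), of x "inv x"] assms(3) by simp
  from cong_trans[OF cong_sym[OF this] hom_mod_one[OF assms(1,2)]] show ?thesis
    by (simp add: cong_iff_dvd_diff algebra_simps)
qed

lemma hom_mod_pow:
  assumes "subgroup A G" "hom_mod G p A \<xi>" "x \<in> A"
  shows "[\<xi> (x [^] n) = int n * \<xi> x] (mod p)"
proof (induction n)
  case 0
  then show ?case using hom_mod_one[OF assms(1,2)] by simp
next
  case (Suc n)
  have "x [^] n \<in> A"
    using assms(1,3) by (simp add: subgroup_nat_pow_closed)
  then have "[\<xi> (x [^] n \<otimes> x) = \<xi> (x [^] n) + \<xi> x] (mod p)"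
    using assms by (intro hom_modD)
  also have "[\<xi> (x [^] n) + \<xi> x = int n * \<xi> x + \<xi> x] (mod p)"
    using Suc by (intro cong_add cong_refl)
  finally show ?case by (simp add: algebra_simps)
qed

lemma subgroup_hom_mod_kernel:
  assumes "subgroup A G" "hom_mod G p A \<xi>"
  shows "subgroup {x \<in> A. [\<xi> x = 0] (mod p)} G"
proof (rule subgroupI)
  show "{x \<in> A. [\<xi> x = 0] (mod p)} \<subseteq> carrier G"
    using assms(1) subgroup.subset by blast
  show "{x \<in> A. [\<xi> x = 0] (mod p)} \<noteq> {}"
    using hom_mod_one[OF assms] subgroup.one_closed[OF assms(1)] by blast
  show "inv x \<in> {x \<in> A. [\<xi> x = 0] (mod p)}" if "x \<in> {x \<in> A. [\<xi> x = 0] (mod p)}" for x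
    using that subgroup.m_inv_closed[OF assms(1)] cong_trans[OF hom_mod_inv[OF assms, of x], of 0]
      cong_minus_minus_iff[of "\<xi> x" 0 p] by auto
  show "x \<otimes> y \<in> {x \<in> A. [\<xi> x = 0] (mod p)}"
    if "x \<in> {x \<in> A. [\<xi> x = 0] (mod p)}" "y \<in> {x \<in> A. [\<xi> x = 0] (mod p)}" for x y
    using that subgroup.m_closed[OF assms(1)] cong_add[of "\<xi> x" 0 p "\<xi> y" 0]
      cong_trans[OF hom_modD[OF assms(2), of x y], of 0] by auto
qed

text \<open>If \<open>\<xi> x\<close> is a unit, every \<open>y\<close> in \<open>A\<close> can be
  moved into the kernel of \<open>\<xi>\<close> by a power of \<open>x\<close>; there
  \<open>\<psi>\<close> vanishes too, and this expresses \<open>\<psi> y\<close> through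
  \<open>\<xi> y\<close>.\<close>

lemma hom_mod_proportional:
  assumes p: "Factorial_Ring.prime p" and A: "subgroup A G" "hom_mod G p A \<xi>" "hom_mod G p A \<psi>"
    and ker: "\<And>x. x \<in> A \<Longrightarrow> [\<xi> x = 0] (mod p) \<Longrightarrow> [\<psi> x = 0] (mod p)"
  obtains b where "\<And>x. x \<in> A \<Longrightarrow> [\<psi> x = b * \<xi> x] (mod p)"
proof (cases "\<forall>x\<in>A. [\<xi> x = 0] (mod p)")
  case True
  then show thesis
    using that[of 0] ker by auto
next
  case False
  then obtain x where x: "x \<in> A" "\<not> [\<xi> x = 0] (mod p)"
    by blast
  then have "coprime (\<xi> x) p"
    using p by (metis cong_0_iff coprime_commute prime_imp_coprime)
  then obtain u where u: "[\<xi> x * u = 1] (mod p)"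
    using cong_solve_coprime_int by blast
  have "[\<psi> y = (\<psi> x * u) * \<xi> y] (mod p)" if y: "y \<in> A" for y
  proof -
    \<comment> \<open>Solves \<open>n * \<xi> x + \<xi> y = 0\<close> modulo \<open>p\<close>, so
      that \<open>x [^] n \<otimes> y\<close> lies in the kernel of \<open>\<xi>\<close>.\<close>
    define n where "n = nat ((- u * \<xi> y) mod p)"
    have n: "[int n = - u * \<xi> y] (mod p)"
      using prime_gt_0_int[OF p] by (simp add: n_def cong_def)
    have xn: "x [^] n \<in> A"
      using A(1) x by (simp add: subgroup_nat_pow_closed)
    have *: "[\<theta> (x [^] n \<otimes> y) = - u * \<xi> y * \<theta> x + \<theta> y] (mod p)" if "hom_mod G p A \<theta>" for \<theta>
      using cong_trans[OF hom_modD[OF that xn y] cong_add[OF cong_trans[OF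
        hom_mod_pow[OF A(1) that x(1)] cong_mult[OF n cong_refl]] cong_refl]] .
    have "[\<xi> (x [^] n \<otimes> y) = - (\<xi> x * u) * \<xi> y + \<xi> y] (mod p)"
      using *[OF A(2)] by (simp add: algebra_simps)
    also have "[- (\<xi> x * u) * \<xi> y + \<xi> y = - 1 * \<xi> y + \<xi> y] (mod p)"
      using u by (intro cong_add cong_mult cong_refl) (simp add: cong_minus_minus_iff)
    finally have "[\<psi> (x [^] n \<otimes> y) = 0] (mod p)"
      using ker subgroup.m_closed[OF A(1) xn y] by simp
    from cong_trans[OF cong_sym[OF *[OF A(3)]] this] show ?thesis
      by (simp add: cong_iff_dvd_diff algebra_simps)
  qed
  then show thesis
    using that by blast
qed

text \<open>The linear-algebra fact that a functional vanishing on a finite intersection of kernels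
  lies in their span. Restricting to the kernel of \<open>\<xi> d\<close> removes \<open>d\<close>;
  the error on all of \<open>A\<close> vanishes on that kernel and is therefore a multiple of
  \<open>\<xi> d\<close>.\<close>

lemma hom_mod_lincomb_of_kernel_subset:
  assumes p: "Factorial_Ring.prime p" and "finite F" and "subgroup A G"
    and "\<And>i. i \<in> F \<Longrightarrow> hom_mod G p A (\<xi> i)" and "hom_mod G p A \<theta>"
    and "\<And>x. x \<in> A \<Longrightarrow> \<forall>i\<in>F. [\<xi> i x = 0] (mod p) \<Longrightarrow> [\<theta> x = 0] (mod p)"
  shows "\<exists>a. \<forall>x\<in>A. [\<theta> x = (\<Sum>i\<in>F. a i * \<xi> i x)] (mod p)"
  using assms(2-)
proof (induction F arbitrary: A rule: finite_induct)
  case empty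
  then show ?case by simp
next
  case (insert d F)
  let ?K = "{x \<in> A. [\<xi> d x = 0] (mod p)}"
  have "\<exists>a. \<forall>x\<in>?K. [\<theta> x = (\<Sum>i\<in>F. a i * \<xi> i x)] (mod p)"
  proof (rule insert.IH)
    show "subgroup ?K G"
      using insert.prems by (intro subgroup_hom_mod_kernel) auto
    show "hom_mod G p ?K (\<xi> i)" if "i \<in> F" for i
      using insert.prems(2)[of i] that by (auto elim: hom_mod_subset)
    show "hom_mod G p ?K \<theta>"
      using insert.prems(3) by (auto elim: hom_mod_subset)
    show "[\<theta> x = 0] (mod p)" if "x \<in> ?K" "\<forall>i\<in>F. [\<xi> i x = 0] (mod p)" for x
      using insert.prems(4)[of x] that by auto
  qed
  then obtain a where a: "\<forall>x\<in>?K. [\<theta> x = (\<Sum>i\<in>F. a i * \<xi> i x)] (mod p)"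
    by blast
  define \<psi> where "\<psi> = (\<lambda>x. \<theta> x - (\<Sum>i\<in>F. a i * \<xi> i x))"
  have "hom_mod G p A \<psi>"
    unfolding \<psi>_def using insert.prems by (intro hom_mod_diff hom_mod_lincomb) auto
  moreover have "[\<psi> x = 0] (mod p)" if "x \<in> A" "[\<xi> d x = 0] (mod p)" for x
    using a that by (simp add: \<psi>_def cong_iff_dvd_diff)
  ultimately obtain b where b: "\<And>x. x \<in> A \<Longrightarrow> [\<psi> x = b * \<xi> d x] (mod p)"
    using insert.prems by (auto intro: hom_mod_proportional[OF p, of A "\<xi> d" \<psi>])
  have "(\<Sum>i\<in>insert d F. (a(d := b)) i * \<xi> i x) = b * \<xi> d x + (\<Sum>i\<in>F. a i * \<xi> i x)" for x
  proof -
    have "(\<Sum>i\<in>F. (a(d := b)) i * \<xi> i x) = (\<Sum>i\<in>F. a i * \<xi> i x)"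
      using insert.hyps by (intro sum.cong) auto
    then show ?thesis
      using insert.hyps by simp
  qed
  then have "[\<theta> x = (\<Sum>i\<in>insert d F. (a(d := b)) i * \<xi> i x)] (mod p)" if "x \<in> A" for x
    using b[OF that] by (simp add: \<psi>_def cong_iff_dvd_diff algebra_simps)
  then show ?case
    by blast
qed

text \<open>The vectors \<open>(\<xi> i n)\<close> with \<open>n\<close> in \<open>N\<close> form a
  subspace of the space of functions from \<open>F\<close> to the field with \<open>p\<close>
  elements, and the vector of \<open>g\<close> lies outside it. Hence some functional kills the
  subspace but not this vector.\<close>

lemma hom_mod_lincomb_separating:
  assumes p: "Factorial_Ring.prime p" and "finite F" and A: "subgroup A G" and N: "subgroup N G" "N \<subseteq> A"
    and "\<And>i. i \<in> F \<Longrightarrow> hom_mod G p A (\<xi> i)" and "g \<in> A"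
    and "\<And>n. n \<in> N \<Longrightarrow> \<exists>i\<in>F. \<not> [\<xi> i n = \<xi> i g] (mod p)"
  shows "\<exists>a. (\<forall>n\<in>N. [(\<Sum>i\<in>F. a i * \<xi> i n) = 0] (mod p)) \<and>
             \<not> [(\<Sum>i\<in>F. a i * \<xi> i g) = 0] (mod p)"
  using assms(2,6-)
proof (induction F rule: finite_induct)
  case empty
  then show ?case using subgroup.one_closed[OF N(1)] by blast
next
  case (insert d F)
  have upd: "(\<Sum>i\<in>insert d F. (a(d := b)) i * \<xi> i x) = b * \<xi> d x + (\<Sum>i\<in>F. a i * \<xi> i x)"
    for a b x
  proof -
    have "(\<Sum>i\<in>F. (a(d := b)) i * \<xi> i x) = (\<Sum>i\<in>F. a i * \<xi> i x)"
      using insert.hyps by (intro sum.cong) auto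
    then show ?thesis
      using insert.hyps by simp
  qed
  show ?case
  \<comment> \<open>If \<open>N\<close> already misses the vector of \<open>g\<close> on
    \<open>F\<close>, the coefficient of \<open>d\<close> is 0. Otherwise some \<open>m\<close> in
    \<open>N\<close> agrees with \<open>g\<close> on \<open>F\<close> and must differ from it at
    \<open>d\<close>.\<close>
  proof (cases "\<exists>m\<in>N. \<forall>i\<in>F. [\<xi> i m = \<xi> i g] (mod p)")
    case False
    then obtain a where "(\<forall>n\<in>N. [(\<Sum>i\<in>F. a i * \<xi> i n) = 0] (mod p)) \<and>
        \<not> [(\<Sum>i\<in>F. a i * \<xi> i g) = 0] (mod p)"
      using insert by auto
    then show ?thesis
      by (intro exI[of _ "a(d := 0)"]) (unfold upd, simp)
  next
    case True
    then obtain m where m: "m \<in> N" "\<And>i. i \<in> F \<Longrightarrow> [\<xi> i m = \<xi> i g] (mod p)"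
      by blast
    have homN: "hom_mod G p N (\<xi> i)" if "i \<in> insert d F" for i
      using insert.prems(1)[OF that] N(2) hom_mod_subset by blast
    have d: "\<not> [\<xi> d (n \<otimes> m) = \<xi> d g] (mod p)"
      if n: "n \<in> N" "\<forall>i\<in>F. [\<xi> i n = 0] (mod p)" for n
    proof -
      have "[\<xi> i (n \<otimes> m) = \<xi> i g] (mod p)" if "i \<in> F" for i
      proof -
        have "[\<xi> i (n \<otimes> m) = \<xi> i n + \<xi> i m] (mod p)"
          using homN[of i] that n(1) m(1) by (auto intro: hom_modD)
        also have "[\<xi> i n + \<xi> i m = 0 + \<xi> i g] (mod p)"
          using n(2) m(2) that by (intro cong_add) auto
        finally show ?thesis by simp
      qed
      then show ?thesis
        using insert.prems(3)[of "n \<otimes> m"] subgroup.m_closed[OF N(1) n(1) m(1)] by auto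
    qed
    \<comment> \<open>If \<open>\<xi> d n\<close> were a unit, a power of \<open>n\<close> would
      correct the coordinate of \<open>m\<close> at \<open>d\<close> without changing those in
      \<open>F\<close>, and \<open>N\<close> would contain an element that agrees with
      \<open>g\<close> everywhere.\<close>
    have "[\<xi> d n = 0] (mod p)" if n: "n \<in> N" "\<forall>i\<in>F. [\<xi> i n = 0] (mod p)" for n
    proof (rule ccontr)
      assume "\<not> [\<xi> d n = 0] (mod p)"
      then have "coprime (\<xi> d n) p"
        using p by (metis cong_0_iff coprime_commute prime_imp_coprime)
      then obtain u where u: "[\<xi> d n * u = 1] (mod p)"
        using cong_solve_coprime_int by blast
      \<comment> \<open>Solves \<open>k * \<xi> d n + \<xi> d m = \<xi> d g\<close> modulo
        \<open>p\<close>.\<close>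
      define k where "k = nat ((u * (\<xi> d g - \<xi> d m)) mod p)"
      have k: "[int k = u * (\<xi> d g - \<xi> d m)] (mod p)"
        using prime_gt_0_int[OF p] by (simp add: k_def cong_def)
      have nk: "n [^] k \<in> N"
        using N(1) n by (simp add: subgroup_nat_pow_closed)
      have pow: "[\<xi> i (n [^] k) = int k * \<xi> i n] (mod p)" if "i \<in> insert d F" for i
        using hom_mod_pow[OF N(1) homN[OF that] n(1)] .
      have "\<forall>i\<in>F. [\<xi> i (n [^] k) = 0] (mod p)"
        using pow n(2) by (metis cong_mult_self_left cong_scalar_left cong_trans insertCI mult_zero_right)
      then have "\<not> [\<xi> d (n [^] k \<otimes> m) = \<xi> d g] (mod p)"
        using d nk by blast
      moreover have "[\<xi> d (n [^] k \<otimes> m) = \<xi> d (n [^] k) + \<xi> d m] (mod p)"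
        using homN nk m(1) by (auto intro: hom_modD)
      moreover have "[\<xi> d (n [^] k) + \<xi> d m = (\<xi> d n * u) * (\<xi> d g - \<xi> d m) + \<xi> d m] (mod p)"
        using cong_trans[OF pow[of d] cong_mult[OF k cong_refl[of "\<xi> d n"]]]
        by (intro cong_add cong_refl) (simp add: mult_ac)
      moreover have "[(\<xi> d n * u) * (\<xi> d g - \<xi> d m) + \<xi> d m = 1 * (\<xi> d g - \<xi> d m) + \<xi> d m] (mod p)"
        using u by (intro cong_add cong_mult cong_refl)
      ultimately show False
        by (smt (verit) cong_trans mult_1)
    qed
    \<comment> \<open>The functional sought is \<open>\<xi> d\<close> minus this combination. It
      vanishes on \<open>N\<close>, in particular at \<open>m\<close>; as \<open>g\<close> agrees
      with \<open>m\<close> on \<open>F\<close> but not at \<open>d\<close>, it does not vanish at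
      \<open>g\<close>.\<close>
    then obtain a where a: "\<forall>n\<in>N. [\<xi> d n = (\<Sum>i\<in>F. a i * \<xi> i n)] (mod p)"
      using hom_mod_lincomb_of_kernel_subset[OF p insert.hyps(1) N(1), of \<xi> "\<xi> d"] homN by auto
    have neg: "(\<Sum>i\<in>F. (- a i) * \<xi> i x) = - (\<Sum>i\<in>F. a i * \<xi> i x)" for x
      by (simp add: sum_negf)
    have "\<not> [\<xi> d m = \<xi> d g] (mod p)"
      using insert.prems(3)[OF m(1)] m(2) by blast
    moreover have "[(\<Sum>i\<in>F. a i * \<xi> i m) = (\<Sum>i\<in>F. a i * \<xi> i g)] (mod p)"
      using m(2) by (intro cong_sum cong_mult cong_refl)
    ultimately have "\<not> [\<xi> d g = (\<Sum>i\<in>F. a i * \<xi> i g)] (mod p)"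
      using a m(1) by (meson cong_sym cong_trans)
    with a show ?thesis
      by (intro exI[of _ "(\<lambda>i. - a i)(d := 1)"]) (unfold upd neg, simp add: cong_iff_dvd_diff)
  qed
qed

end

section \<open>Second cohomology\<close>

text \<open>The relation behind \<open>cohom_class\<close>, with equality of reduced values replaced
  by congruence. Its arguments are arbitrary integer functions, so they may be added and negated
  freely.\<close>

definition cohomologous :: "('a, 'm) monoid_scheme \<Rightarrow> 'a topology \<Rightarrow> int
    \<Rightarrow> ('a \<Rightarrow> 'a \<Rightarrow> int) \<Rightarrow> ('a \<Rightarrow> 'a \<Rightarrow> int) \<Rightarrow> bool" where
  "cohomologous A \<tau> p f f' \<longleftrightarrow> (\<exists>c. cochain1 A \<tau> p c \<and>
     (\<forall>x\<in>carrier A. \<forall>y\<in>carrier A. [f' x y = f x y + (c y - c (x \<otimes>\<^bsub>A\<^esub> y) + c x)] (mod p)))"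

definition pull_cochain :: "('a, 'm) monoid_scheme \<Rightarrow> ('a \<Rightarrow> 'b) \<Rightarrow> ('b \<Rightarrow> 'b \<Rightarrow> int) \<Rightarrow> 'a \<Rightarrow> 'a \<Rightarrow> int" where
  "pull_cochain A \<phi> f = (\<lambda>x y. if x \<in> carrier A \<and> y \<in> carrier A then f (\<phi> x) (\<phi> y) else 0)"

text \<open>The condition \<open>F 0 0 = 0\<close> preserves the convention that cochains are 0
  outside the carrier.\<close>

lemma cochain1_binary:
  assumes "cochain1 A \<tau> p c" "cochain1 A \<tau> p d"
    and "F 0 0 = 0" "\<And>a b. F a b \<in> {0..<p}"
  shows "cochain1 A \<tau> p (\<lambda>x. F (c x) (d x))"
  using assms continuous_map_discrete_binary[of \<tau> "{0..<p}" c "{0..<p}" d F "{0..<p}"]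
  by (auto simp: cochain1_def Zp_top_def)

lemma cochain2_binary:
  assumes "cochain2 A \<tau> p c" "cochain2 A \<tau> p d"
    and "F 0 0 = 0" "\<And>a b. F a b \<in> {0..<p}"
  shows "cochain2 A \<tau> p (\<lambda>x y. F (c x y) (d x y))"
  using assms continuous_map_discrete_binary[of "prod_topology \<tau> \<tau>" "{0..<p}" "\<lambda>(x, y). c x y"
      "{0..<p}" "\<lambda>(x, y). d x y" F "{0..<p}"]
  by (auto simp: cochain2_def Zp_top_def case_prod_unfold)

locale cochains =
  fixes A :: "('a, 'm) monoid_scheme" (structure) and \<tau> :: "'a topology" and p :: int
  assumes topspace_eq: "topspace \<tau> = carrier A" and p_pos: "0 < p"
begin

abbreviation "cls \<equiv> cohom_class A \<tau> p"
abbreviation "cocycle \<equiv> cocycle2 A \<tau> p"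

lemma cochain1_zero: "cochain1 A \<tau> p (\<lambda>x. 0)"
  using p_pos by (simp add: cochain1_def Zp_top_def continuous_map_const)

lemma cochain2_zero: "cochain2 A \<tau> p (\<lambda>x y. 0)"
  using p_pos by (simp add: cochain2_def Zp_top_def case_prod_unfold continuous_map_const)

lemma cocycle_zero: "cocycle (\<lambda>x y. 0)"
  by (simp add: cocycle2_def cochain2_zero)

lemma cocycle_range: "cocycle f \<Longrightarrow> f x y \<in> {0..<p}"
  using p_pos topspace_eq
  by (cases "x \<in> carrier A \<and> y \<in> carrier A")
    (auto simp: cocycle2_def cochain2_def Zp_top_def continuous_map_discrete_iff)

lemma cocycle_outside: "cocycle f \<Longrightarrow> \<not> (x \<in> carrier A \<and> y \<in> carrier A) \<Longrightarrow> f x y = 0"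
  by (auto simp: cocycle2_def cochain2_def)

lemma cocycle_cong:
  "cocycle f \<longleftrightarrow> cochain2 A \<tau> p f \<and> (\<forall>g\<in>carrier A. \<forall>h\<in>carrier A. \<forall>k\<in>carrier A.
     [f h k + f g (h \<otimes> k) = f (g \<otimes> h) k + f g h] (mod p))"
proof -
  have "(a - b + c - d) mod p = 0 \<longleftrightarrow> [a + c = b + d] (mod p)" for a b c d
    by (simp add: cong_iff_dvd_diff mod_eq_0_iff_dvd algebra_simps)
  then show ?thesis
    by (simp add: cocycle2_def)
qed

lemma cocycle_add:
  assumes "cocycle f" "cocycle g"
  shows "cocycle (\<lambda>x y. (f x y + g x y) mod p)"
  unfolding cocycle_cong
proof (intro conjI ballI)
  show "cochain2 A \<tau> p (\<lambda>x y. (f x y + g x y) mod p)"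
    using assms p_pos cochain2_binary[of A \<tau> p f g "\<lambda>a b. (a + b) mod p"]
    by (auto simp: cocycle2_def)
  fix x y z assume xyz: "x \<in> carrier A" "y \<in> carrier A" "z \<in> carrier A"
  then have "[(f y z + f x (y \<otimes> z)) + (g y z + g x (y \<otimes> z)) =
      (f (x \<otimes> y) z + f x y) + (g (x \<otimes> y) z + g x y)] (mod p)"
    using assms unfolding cocycle_cong by (intro cong_add[of "f y z + f x (y \<otimes> z)"]) blast+
  then show "[(f y z + g y z) mod p + (f x (y \<otimes> z) + g x (y \<otimes> z)) mod p =
      (f (x \<otimes> y) z + g (x \<otimes> y) z) mod p + (f x y + g x y) mod p] (mod p)"
    unfolding cong_def by (simp only: mod_simps) (simp only: add_ac)
qed

lemma cocycle_uminus:
  assumes "cocycle f"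
  shows "cocycle (\<lambda>x y. (- f x y) mod p)"
  unfolding cocycle_cong
proof (intro conjI ballI)
  show "cochain2 A \<tau> p (\<lambda>x y. (- f x y) mod p)"
    using assms p_pos cochain2_binary[of A \<tau> p f f "\<lambda>a b. (- a) mod p"]
    by (auto simp: cocycle2_def)
  fix x y z assume xyz: "x \<in> carrier A" "y \<in> carrier A" "z \<in> carrier A"
  then have "[- (f y z + f x (y \<otimes> z)) = - (f (x \<otimes> y) z + f x y)] (mod p)"
    using assms unfolding cocycle_cong by (intro cong_minus_minus_iff[THEN iffD2]) blast
  then show "[(- f y z) mod p + (- f x (y \<otimes> z)) mod p =
      (- f (x \<otimes> y) z) mod p + (- f x y) mod p] (mod p)"
    by (simp add: cong_def mod_simps algebra_simps)
qed

text \<open>\<open>cochain1\<close> demands the value 0 outside the carrier, so \<open>c\<close> is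
  replaced there by 0. The closure condition in \<open>eq\<close> ensures that this does not change
  the value at \<open>x \<otimes> y\<close>.\<close>

lemma cohomologousI:
  assumes c: "continuous_map \<tau> (Zp_top p) c"
    and eq: "\<And>x y. x \<in> carrier A \<Longrightarrow> y \<in> carrier A \<Longrightarrow> x \<otimes> y \<in> carrier A \<and>
      [f' x y = f x y + (c y - c (x \<otimes> y) + c x)] (mod p)"
  shows "cohomologous A \<tau> p f f'"
proof -
  define d where "d x = (if x \<in> carrier A then c x else 0)" for x
  have "continuous_map \<tau> (Zp_top p) d"
    by (rule continuous_map_eq[OF c]) (simp add: d_def topspace_eq)
  then show ?thesis
    unfolding cohomologous_def cochain1_def using eq by (intro exI[of _ d]) (auto simp: d_def)
qed

lemma cohomologous_refl: "cohomologous A \<tau> p f f"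
  unfolding cohomologous_def using cochain1_zero by force

lemma cohomologous_sym:
  assumes "cohomologous A \<tau> p f g"
  shows "cohomologous A \<tau> p g f"
proof -
  obtain c where c: "cochain1 A \<tau> p c"
    "\<And>x y. x \<in> carrier A \<Longrightarrow> y \<in> carrier A \<Longrightarrow> [g x y = f x y + (c y - c (x \<otimes> y) + c x)] (mod p)"
    using assms by (auto simp: cohomologous_def)
  have "cochain1 A \<tau> p (\<lambda>x. (- c x) mod p)"
    using c(1) p_pos cochain1_binary[of A \<tau> p c c "\<lambda>a b. (- a) mod p"] by auto
  moreover have "[f x y = g x y + ((- c y) mod p - (- c (x \<otimes> y)) mod p + (- c x) mod p)] (mod p)"
    if "x \<in> carrier A" "y \<in> carrier A" for x y
  proof -
    have "[f x y = g x y + (- c y - - c (x \<otimes> y) + - c x)] (mod p)"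
      using cong_sym[OF c(2)[OF that]] by (simp add: cong_iff_dvd_diff algebra_simps)
    also have "[g x y + (- c y - - c (x \<otimes> y) + - c x) =
        g x y + ((- c y) mod p - (- c (x \<otimes> y)) mod p + (- c x) mod p)] (mod p)"
      by (intro cong_add cong_diff cong_refl) (simp_all add: cong_def)
    finally show ?thesis .
  qed
  ultimately show ?thesis
    unfolding cohomologous_def by blast
qed

lemma cohomologous_add:
  assumes "cohomologous A \<tau> p f f'" "cohomologous A \<tau> p g g'"
  shows "cohomologous A \<tau> p (\<lambda>x y. f x y + g x y) (\<lambda>x y. f' x y + g' x y)"
proof -
  obtain c where c: "cochain1 A \<tau> p c"
    "\<And>x y. x \<in> carrier A \<Longrightarrow> y \<in> carrier A \<Longrightarrow> [f' x y = f x y + (c y - c (x \<otimes> y) + c x)] (mod p)"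
    using assms(1) by (auto simp: cohomologous_def)
  obtain d where d: "cochain1 A \<tau> p d"
    "\<And>x y. x \<in> carrier A \<Longrightarrow> y \<in> carrier A \<Longrightarrow> [g' x y = g x y + (d y - d (x \<otimes> y) + d x)] (mod p)"
    using assms(2) by (auto simp: cohomologous_def)
  let ?e = "\<lambda>x. (c x + d x) mod p"
  have "cochain1 A \<tau> p ?e"
    using c(1) d(1) p_pos cochain1_binary[of A \<tau> p c d "\<lambda>a b. (a + b) mod p"] by auto
  moreover have "[f' x y + g' x y = f x y + g x y + (?e y - ?e (x \<otimes> y) + ?e x)] (mod p)"
    if "x \<in> carrier A" "y \<in> carrier A" for x y
  proof -
    have "[f' x y + g' x y = f x y + g x y +
        ((c y + d y) - (c (x \<otimes> y) + d (x \<otimes> y)) + (c x + d x))] (mod p)"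
      using cong_add[OF c(2)[OF that] d(2)[OF that]] by (simp add: algebra_simps)
    also have "[f x y + g x y + ((c y + d y) - (c (x \<otimes> y) + d (x \<otimes> y)) + (c x + d x)) =
        f x y + g x y + (?e y - ?e (x \<otimes> y) + ?e x)] (mod p)"
      by (intro cong_add cong_diff cong_refl) (simp_all add: cong_def)
    finally show ?thesis .
  qed
  ultimately show ?thesis
    unfolding cohomologous_def by blast
qed

lemma cohomologous_cong:
  assumes "cohomologous A \<tau> p f g"
    and "\<And>x y. x \<in> carrier A \<Longrightarrow> y \<in> carrier A \<Longrightarrow> [f x y = f' x y] (mod p)"
    and "\<And>x y. x \<in> carrier A \<Longrightarrow> y \<in> carrier A \<Longrightarrow> [g x y = g' x y] (mod p)"
  shows "cohomologous A \<tau> p f' g'"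
proof -
  obtain c where c: "cochain1 A \<tau> p c"
    "\<And>x y. x \<in> carrier A \<Longrightarrow> y \<in> carrier A \<Longrightarrow> [g x y = f x y + (c y - c (x \<otimes> y) + c x)] (mod p)"
    using assms(1) by (auto simp: cohomologous_def)
  have "[g' x y = f' x y + (c y - c (x \<otimes> y) + c x)] (mod p)"
    if "x \<in> carrier A" "y \<in> carrier A" for x y
    using cong_trans[OF cong_trans[OF cong_sym[OF assms(3)] c(2)] cong_add[OF assms(2) cong_refl]] that
    by blast
  then show ?thesis
    using c(1) unfolding cohomologous_def by blast
qed

lemma cohomologous_trans:
  assumes "cohomologous A \<tau> p f g" "cohomologous A \<tau> p g h"
  shows "cohomologous A \<tau> p f h"
proof -
  \<comment> \<open>Adding this relation to the sum of the two given ones cancels the middle term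
    \<open>g\<close> on both sides.\<close>
  have "cohomologous A \<tau> p (\<lambda>x y. - g x y) (\<lambda>x y. - g x y)"
    by (rule cohomologous_refl)
  from cohomologous_add[OF this cohomologous_add[OF assms]] show ?thesis
    by simp
qed

text \<open>Cocycles take values in \<open>{0..<p}\<close> and are 0 outside the carrier, so
  congruence on the carrier is the same as the literal equality in
  \<open>cohom_class\<close>.\<close>

lemma mem_cls_iff:
  assumes "cocycle f"
  shows "f' \<in> cls f \<longleftrightarrow> cocycle f' \<and> cohomologous A \<tau> p f f'"
proof -
  have "f' = (\<lambda>x y. (f x y + cobound A p c x y) mod p) \<longleftrightarrow>
      (\<forall>x\<in>carrier A. \<forall>y\<in>carrier A. [f' x y = f x y + (c y - c (x \<otimes> y) + c x)] (mod p))"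
    (is "_ \<longleftrightarrow> ?R") if "cocycle f'" for c
  proof
    assume "f' = (\<lambda>x y. (f x y + cobound A p c x y) mod p)"
    then show ?R
      by (auto simp: cobound_def cong_def mod_simps)
  next
    assume R: ?R
    have "f' x y = (f x y + cobound A p c x y) mod p" for x y
    proof (cases "x \<in> carrier A \<and> y \<in> carrier A")
      case True
      then have "f' x y mod p = (f x y + cobound A p c x y) mod p"
        using R by (auto simp: cobound_def cong_def mod_simps)
      then show ?thesis
        using cocycle_range[OF that, of x y] by simp
    next
      case False
      then show ?thesis
        using cocycle_outside[OF that False] cocycle_outside[OF assms False]
        by (auto simp: cobound_def)
    qed
    then show "f' = (\<lambda>x y. (f x y + cobound A p c x y) mod p)"
      by blast
  qed
  then show ?thesis
    unfolding cohom_class_def cohomologous_def by auto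
qed

lemma cls_eq_iff:
  assumes "cocycle f" "cocycle g"
  shows "cls f = cls g \<longleftrightarrow> cohomologous A \<tau> p f g"
proof
  assume "cls f = cls g"
  then show "cohomologous A \<tau> p f g"
    using mem_cls_iff assms cohomologous_refl by blast
next
  assume "cohomologous A \<tau> p f g"
  then show "cls f = cls g"
    using assms by (auto simp: mem_cls_iff) (blast intro: cohomologous_trans cohomologous_sym)+
qed

lemma cls_mult:
  assumes "cocycle f" "cocycle g"
  shows "cls f \<otimes>\<^bsub>H2grp A \<tau> p\<^esub> cls g = cls (\<lambda>x y. (f x y + g x y) mod p)"
proof (rule Set.set_eqI)
  fix h
  note fg = cocycle_add[OF assms]
  show "h \<in> cls f \<otimes>\<^bsub>H2grp A \<tau> p\<^esub> cls g \<longleftrightarrow> h \<in> cls (\<lambda>x y. (f x y + g x y) mod p)"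
  proof
    assume "h \<in> cls f \<otimes>\<^bsub>H2grp A \<tau> p\<^esub> cls g"
    then obtain f1 g1 where *: "f1 \<in> cls f" "g1 \<in> cls g" "h = (\<lambda>x y. (f1 x y + g1 x y) mod p)"
      by (auto simp: H2grp_def)
    then have "cohomologous A \<tau> p (\<lambda>x y. f x y + g x y) (\<lambda>x y. f1 x y + g1 x y)"
      using assms by (intro cohomologous_add) (auto simp: mem_cls_iff)
    then have "cohomologous A \<tau> p (\<lambda>x y. (f x y + g x y) mod p) h"
      unfolding *(3) by (rule cohomologous_cong) (simp_all add: cong_def)
    moreover have "cocycle h"
      using * assms by (auto simp: mem_cls_iff intro: cocycle_add)
    ultimately show "h \<in> cls (\<lambda>x y. (f x y + g x y) mod p)"
      using mem_cls_iff[OF fg] by blast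
  next
    assume "h \<in> cls (\<lambda>x y. (f x y + g x y) mod p)"
    then have h: "cocycle h" "cohomologous A \<tau> p (\<lambda>x y. (f x y + g x y) mod p) h"
      using mem_cls_iff[OF fg] by auto
    \<comment> \<open>The product consists of sums of representatives. To write \<open>h\<close> as
      such a sum, \<open>f\<close> itself represents the first class and \<open>h - f\<close> the
      second.\<close>
    define g1 where "g1 x y = (h x y + (- f x y) mod p) mod p" for x y
    have g1: "cocycle g1"
      unfolding g1_def using h assms by (intro cocycle_add cocycle_uminus)
    have "cohomologous A \<tau> p (\<lambda>x y. (f x y + g x y) mod p + - f x y) (\<lambda>x y. h x y + - f x y)"
      using h cohomologous_refl by (intro cohomologous_add)
    then have "cohomologous A \<tau> p g g1"
      by (rule cohomologous_cong) (simp_all add: cong_def g1_def mod_simps)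
    then have "f \<in> cls f" "g1 \<in> cls g"
      using assms g1 cohomologous_refl[of f] by (simp_all add: mem_cls_iff)
    moreover have "h = (\<lambda>x y. (f x y + g1 x y) mod p)"
    proof (intro ext)
      fix x y
      show "h x y = (f x y + g1 x y) mod p"
        using cocycle_range[OF h(1), of x y] by (simp add: g1_def mod_simps)
    qed
    ultimately show "h \<in> cls f \<otimes>\<^bsub>H2grp A \<tau> p\<^esub> cls g"
      by (simp add: H2grp_def) blast
  qed
qed

lemma carrier_H2grp: "carrier (H2grp A \<tau> p) = {cls f | f. cocycle f}"
  by (simp add: H2grp_def H2_def)

lemma one_H2grp: "\<one>\<^bsub>H2grp A \<tau> p\<^esub> = cls (\<lambda>x y. 0)"
  by (simp add: H2grp_def)

lemma comm_group_H2grp: "comm_group (H2grp A \<tau> p)"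
proof (rule comm_groupI)
  fix a b c
  assume "a \<in> carrier (H2grp A \<tau> p)"
  then obtain f where f: "cocycle f" "a = cls f"
    by (auto simp: carrier_H2grp)
  show "\<one>\<^bsub>H2grp A \<tau> p\<^esub> \<otimes>\<^bsub>H2grp A \<tau> p\<^esub> a = a"
    using f cocycle_range[OF f(1)] by (simp add: one_H2grp cls_mult cocycle_zero)
  have "cls (\<lambda>x y. (- f x y) mod p) \<otimes>\<^bsub>H2grp A \<tau> p\<^esub> a = \<one>\<^bsub>H2grp A \<tau> p\<^esub>"
    using f by (simp add: one_H2grp cls_mult cocycle_uminus mod_simps)
  then show "\<exists>y\<in>carrier (H2grp A \<tau> p). y \<otimes>\<^bsub>H2grp A \<tau> p\<^esub> a = \<one>\<^bsub>H2grp A \<tau> p\<^esub>"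
    using f by (auto simp: carrier_H2grp intro: cocycle_uminus)
  assume "b \<in> carrier (H2grp A \<tau> p)"
  then obtain g where g: "cocycle g" "b = cls g"
    by (auto simp: carrier_H2grp)
  show "a \<otimes>\<^bsub>H2grp A \<tau> p\<^esub> b \<in> carrier (H2grp A \<tau> p)"
    using f g by (auto simp: carrier_H2grp cls_mult intro: cocycle_add)
  show "a \<otimes>\<^bsub>H2grp A \<tau> p\<^esub> b = b \<otimes>\<^bsub>H2grp A \<tau> p\<^esub> a"
    using f g by (simp add: cls_mult add.commute)
  assume "c \<in> carrier (H2grp A \<tau> p)"
  then obtain h where h: "cocycle h" "c = cls h"
    by (auto simp: carrier_H2grp)
  show "a \<otimes>\<^bsub>H2grp A \<tau> p\<^esub> b \<otimes>\<^bsub>H2grp A \<tau> p\<^esub> c = a \<otimes>\<^bsub>H2grp A \<tau> p\<^esub> (b \<otimes>\<^bsub>H2grp A \<tau> p\<^esub> c)"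
    using f g h by (simp add: cls_mult cocycle_add mod_simps add.assoc)
qed (auto simp: one_H2grp carrier_H2grp intro: cocycle_zero)

end

section \<open>Functoriality of the second cohomology\<close>

lemma cocycle2_pull_cochain:
  assumes "topspace \<tau> = carrier A" "topspace \<sigma> = carrier B" "0 < p"
    and \<phi>: "\<phi> \<in> cont_hom A \<tau> B \<sigma>" and f: "cocycle2 B \<sigma> p f"
    and cl: "\<And>x y. x \<in> carrier A \<Longrightarrow> y \<in> carrier A \<Longrightarrow> x \<otimes>\<^bsub>A\<^esub> y \<in> carrier A"
  shows "cocycle2 A \<tau> p (pull_cochain A \<phi> f)"
proof -
  interpret A: cochains A \<tau> p by unfold_locales fact+
  interpret B: cochains B \<sigma> p by unfold_locales fact+
  have hom: "\<phi> \<in> hom A B" and cont: "continuous_map \<tau> \<sigma> \<phi>"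
    using \<phi> by (auto simp: cont_hom_def)
  have "continuous_map (prod_topology \<tau> \<tau>) (prod_topology \<sigma> \<sigma>) (\<lambda>(x, y). (\<phi> x, \<phi> y))"
    using cont by (simp add: continuous_map_prod_top)
  moreover have "continuous_map (prod_topology \<sigma> \<sigma>) (Zp_top p) (\<lambda>(x, y). f x y)"
    using f by (simp add: cocycle2_def cochain2_def)
  ultimately have "continuous_map (prod_topology \<tau> \<tau>) (Zp_top p)
      ((\<lambda>(x, y). f x y) \<circ> (\<lambda>(x, y). (\<phi> x, \<phi> y)))"
    by (rule continuous_map_compose)
  then have "continuous_map (prod_topology \<tau> \<tau>) (Zp_top p) (\<lambda>(x, y). pull_cochain A \<phi> f x y)"
    by (rule continuous_map_eq) (auto simp: assms(1) pull_cochain_def)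
  then have "cochain2 A \<tau> p (pull_cochain A \<phi> f)"
    by (auto simp: cochain2_def pull_cochain_def)
  moreover have "\<phi> x \<in> carrier B" if "x \<in> carrier A" for x
    using hom that by (auto simp: hom_def)
  ultimately show ?thesis
    using f cl by (simp add: A.cocycle_cong B.cocycle_cong pull_cochain_def hom_mult[OF hom])
qed

text \<open>\<open>pullback\<close> is a union over all representatives. A cochain \<open>c\<close>
  linking two representatives pulls back to \<open>c \<circ> \<phi>\<close>, so all members of the
  union are the same class.\<close>

lemma pullback_cohom_class:
  assumes "topspace \<tau> = carrier A" "topspace \<sigma> = carrier B" "0 < p"
    and \<phi>: "\<phi> \<in> cont_hom A \<tau> B \<sigma>" and f: "cocycle2 B \<sigma> p f"
    and cl: "\<And>x y. x \<in> carrier A \<Longrightarrow> y \<in> carrier A \<Longrightarrow> x \<otimes>\<^bsub>A\<^esub> y \<in> carrier A"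
  shows "pullback A \<tau> p \<phi> (cohom_class B \<sigma> p f) = cohom_class A \<tau> p (pull_cochain A \<phi> f)"
proof -
  interpret A: cochains A \<tau> p by unfold_locales fact+
  interpret B: cochains B \<sigma> p by unfold_locales fact+
  note pull = cocycle2_pull_cochain[OF assms(1-3) \<phi> _ cl]
  have hom: "\<phi> \<in> hom A B" and cont: "continuous_map \<tau> \<sigma> \<phi>"
    using \<phi> by (auto simp: cont_hom_def)
  have "A.cls (pull_cochain A \<phi> g) = A.cls (pull_cochain A \<phi> f)" if "g \<in> B.cls f" for g
  proof -
    have g: "B.cocycle g" "cohomologous B \<sigma> p g f"
      using that f by (auto simp: B.mem_cls_iff intro: B.cohomologous_sym)
    then obtain c where c: "cochain1 B \<sigma> p c"
      "\<And>x y. x \<in> carrier B \<Longrightarrow> y \<in> carrier B \<Longrightarrow> [f x y = g x y + (c y - c (x \<otimes>\<^bsub>B\<^esub> y) + c x)] (mod p)"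
      by (auto simp: cohomologous_def)
    have "cohomologous A \<tau> p (pull_cochain A \<phi> g) (pull_cochain A \<phi> f)"
    proof (rule A.cohomologousI)
      show "continuous_map \<tau> (Zp_top p) (c \<circ> \<phi>)"
        using cont c(1) by (auto simp: cochain1_def intro: continuous_map_compose)
      fix x y assume xy: "x \<in> carrier A" "y \<in> carrier A"
      then have "\<phi> x \<in> carrier B" "\<phi> y \<in> carrier B"
        using hom by (auto simp: hom_def)
      with xy show "x \<otimes>\<^bsub>A\<^esub> y \<in> carrier A \<and> [pull_cochain A \<phi> f x y = pull_cochain A \<phi> g x y +
          ((c \<circ> \<phi>) y - (c \<circ> \<phi>) (x \<otimes>\<^bsub>A\<^esub> y) + (c \<circ> \<phi>) x)] (mod p)"
        using cl c(2) by (simp add: pull_cochain_def hom_mult[OF hom])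
    qed
    then show ?thesis
      using A.cls_eq_iff pull g(1) f by blast
  qed
  moreover have "f \<in> B.cls f"
    using f B.mem_cls_iff B.cohomologous_refl by blast
  ultimately show ?thesis
    unfolding pullback_def pull_cochain_def[symmetric] by blast
qed

section \<open>Characters of inflation-trivial classes\<close>

lemma cong_mod_combination: "[b mod p - c mod p + d mod p = b - c + d] (mod p)" for p :: int
  by (intro cong_add cong_diff) (simp_all add: cong_def)

lemma compactin_finite_index:
  assumes "compactin \<tau> C" "\<And>i. i \<in> S \<Longrightarrow> openin \<tau> (U i)" "C \<subseteq> (\<Union>i\<in>S. U i)"
  obtains F where "finite F" "F \<subseteq> S" "C \<subseteq> (\<Union>i\<in>F. U i)"
proof -
  obtain \<F> where "finite \<F>" "\<F> \<subseteq> U ` S" "C \<subseteq> \<Union>\<F>"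
    using compactinD[OF assms(1), of "U ` S"] assms(2,3) by auto
  then show thesis
    using that by (metis finite_subset_image)
qed

text \<open>\<open>kill\<close> says that restriction from H^1(G) to H^1(M) is zero. In the
  five-term exact sequence this makes transgression injective, with image the kernel of inflation
  from G/M to G.\<close>

locale transgression =
  fixes G :: "'g monoid" (structure) and \<tau> :: "'g topology" and p :: int and M :: "'g set"
  assumes top: "topspace \<tau> = carrier G" and prime_p: "Factorial_Ring.prime p" and normal_M: "M \<lhd> G"
    and kill: "\<And>\<xi> t. continuous_map \<tau> (Zp_top p) \<xi> \<Longrightarrow> hom_mod G p (carrier G) \<xi> \<Longrightarrow> t \<in> M \<Longrightarrow> [\<xi> t = 0] (mod p)"
begin

sublocale normal M G by (rule normal_M)

abbreviation "Gb \<equiv> G Mod M"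
abbreviation "\<tau>b \<equiv> quot_top G \<tau> M"
abbreviation "H \<equiv> H2grp Gb \<tau>b p"

lemma subgroup_M: "subgroup M G"
  by (rule subgroup_axioms)

sublocale B: cochains Gb \<tau>b p
  using quotient_map_quot_top(2)[OF is_group subgroup_M top] prime_gt_0_int[OF prime_p]
  by unfold_locales (simp_all add: FactGroup_def)

sublocale H: comm_group H
  by (rule B.comm_group_H2grp)

lemma proj_closed [simp]: "x \<in> carrier G \<Longrightarrow> M #> x \<in> carrier Gb"
  by (simp add: carrier_FactGroup)

lemma proj_mult: "x \<in> carrier G \<Longrightarrow> y \<in> carrier G \<Longrightarrow> (M #> x) <#> (M #> y) = M #> (x \<otimes> y)"
  by (rule rcos_sum)

lemma quotient_map_M: "quotient_map \<tau> \<tau>b (\<lambda>g. M #> g)"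
  by (rule quotient_map_quot_top(1)[OF is_group subgroup_M top])

lemma coset_M: "t \<in> M \<Longrightarrow> M #> t = M"
  using subgroup_M by (simp add: rcos_const)

text \<open>The function \<open>h\<close> trivialises the inflation to G of some cocycle of the
  class \<open>c\<close>. Only the class is recorded, so that different cocycles may accompany
  different \<open>h\<close>.\<close>

definition represents :: "('g set \<Rightarrow> 'g set \<Rightarrow> int) set \<Rightarrow> ('g \<Rightarrow> int) \<Rightarrow> bool" where
  "represents c h \<longleftrightarrow> (\<exists>f. B.cocycle f \<and> c = B.cls f \<and> continuous_map \<tau> (Zp_top p) h \<and>
     (\<forall>x\<in>carrier G. \<forall>y\<in>carrier G. [f (M #> x) (M #> y) = h y - h (x \<otimes> y) + h x] (mod p)))"

lemma representsI:
  assumes "B.cocycle f" "continuous_map \<tau> (Zp_top p) h"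
    and "\<And>x y. x \<in> carrier G \<Longrightarrow> y \<in> carrier G \<Longrightarrow> [f (M #> x) (M #> y) = h y - h (x \<otimes> y) + h x] (mod p)"
  shows "represents (B.cls f) h"
  using assms unfolding represents_def by blast

lemma represents_carrier: "represents c h \<Longrightarrow> c \<in> carrier H"
  by (auto simp: represents_def B.carrier_H2grp)

lemma continuous_map_Zp_binary:
  assumes "continuous_map \<tau> (Zp_top p) h" "continuous_map \<tau> (Zp_top p) k" "\<And>a b. F a b \<in> {0..<p}"
  shows "continuous_map \<tau> (Zp_top p) (\<lambda>x. F (h x) (k x))"
  using continuous_map_discrete_binary[of \<tau> "{0..<p}" h "{0..<p}" k F "{0..<p}"] assms
  by (simp add: Zp_top_def)

lemma represents_one: "represents \<one>\<^bsub>H\<^esub> (\<lambda>x. 0)"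
  unfolding B.one_H2grp
  by (rule representsI) (use B.p_pos in \<open>auto simp: B.cocycle_zero Zp_top_def continuous_map_const\<close>)

lemma represents_mult:
  assumes "represents c h" "represents d k"
  shows "represents (c \<otimes>\<^bsub>H\<^esub> d) (\<lambda>x. (h x + k x) mod p)"
proof -
  obtain f where f: "B.cocycle f" "c = B.cls f" "continuous_map \<tau> (Zp_top p) h"
    "\<And>x y. x \<in> carrier G \<Longrightarrow> y \<in> carrier G \<Longrightarrow> [f (M #> x) (M #> y) = h y - h (x \<otimes> y) + h x] (mod p)"
    using assms(1) unfolding represents_def by blast
  obtain g where g: "B.cocycle g" "d = B.cls g" "continuous_map \<tau> (Zp_top p) k"
    "\<And>x y. x \<in> carrier G \<Longrightarrow> y \<in> carrier G \<Longrightarrow> [g (M #> x) (M #> y) = k y - k (x \<otimes> y) + k x] (mod p)"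
    using assms(2) unfolding represents_def by blast
  have "represents (B.cls (\<lambda>x y. (f x y + g x y) mod p)) (\<lambda>x. (h x + k x) mod p)"
  proof (rule representsI)
    show "B.cocycle (\<lambda>x y. (f x y + g x y) mod p)"
      using f g by (intro B.cocycle_add)
    show "continuous_map \<tau> (Zp_top p) (\<lambda>x. (h x + k x) mod p)"
      using f(3) g(3) B.p_pos continuous_map_Zp_binary[of h k "\<lambda>a b. (a + b) mod p"] by simp
    fix x y assume xy: "x \<in> carrier G" "y \<in> carrier G"
    have "[(f (M #> x) (M #> y) + g (M #> x) (M #> y)) mod p =
        (h y + k y) - (h (x \<otimes> y) + k (x \<otimes> y)) + (h x + k x)] (mod p)"
      using cong_add[OF f(4)[OF xy] g(4)[OF xy]] by (simp add: algebra_simps)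
    from cong_trans[OF this cong_sym[OF cong_mod_combination]] show "[(f (M #> x) (M #> y) + g (M #> x) (M #> y)) mod p =
        (h y + k y) mod p - (h (x \<otimes> y) + k (x \<otimes> y)) mod p + (h x + k x) mod p] (mod p)" .
  qed
  then show ?thesis
    using f(1,2) g(1,2) by (simp add: B.cls_mult)
qed

lemma represents_inv:
  assumes "represents c h"
  shows "represents (inv\<^bsub>H\<^esub> c) (\<lambda>x. (- h x) mod p)"
proof -
  obtain f where f: "B.cocycle f" "c = B.cls f" "continuous_map \<tau> (Zp_top p) h"
    "\<And>x y. x \<in> carrier G \<Longrightarrow> y \<in> carrier G \<Longrightarrow> [f (M #> x) (M #> y) = h y - h (x \<otimes> y) + h x] (mod p)"
    using assms(1) unfolding represents_def by blast
  have neg: "B.cocycle (\<lambda>x y. (- f x y) mod p)"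
    using f(1) by (rule B.cocycle_uminus)
  have "represents (B.cls (\<lambda>x y. (- f x y) mod p)) (\<lambda>x. (- h x) mod p)"
  proof (rule representsI[OF neg])
    show "continuous_map \<tau> (Zp_top p) (\<lambda>x. (- h x) mod p)"
      using f(3) B.p_pos continuous_map_Zp_binary[of h h "\<lambda>a b. (- a) mod p"] by simp
    fix x y assume xy: "x \<in> carrier G" "y \<in> carrier G"
    have "[(- f (M #> x) (M #> y)) mod p = - h y - (- h (x \<otimes> y)) + (- h x)] (mod p)"
      using cong_minus_minus_iff[THEN iffD2, OF f(4)[OF xy]] by (simp add: algebra_simps)
    from cong_trans[OF this cong_sym[OF cong_mod_combination]] show "[(- f (M #> x) (M #> y)) mod p =
        (- h y) mod p - (- h (x \<otimes> y)) mod p + (- h x) mod p] (mod p)" .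
  qed
  moreover have "inv\<^bsub>H\<^esub> c = B.cls (\<lambda>x y. (- f x y) mod p)"
  proof (rule H.inv_equality)
    show "B.cls (\<lambda>x y. (- f x y) mod p) \<otimes>\<^bsub>H\<^esub> c = \<one>\<^bsub>H\<^esub>"
      using f(1,2) neg by (simp add: B.one_H2grp B.cls_mult mod_simps)
  qed (use f(1,2) neg in \<open>auto simp: B.carrier_H2grp\<close>)
  ultimately show ?thesis by simp
qed

text \<open>The elements \<open>t\<close> and \<open>\<one>\<close> have the same image in G/M, so
  the cocycle takes the same value at the pairs \<open>(t, g)\<close> and
  \<open>(\<one>, g)\<close>. Comparing the two coboundary formulas gives the claim.\<close>

lemma represents_translate:
  assumes "represents c h" "t \<in> M" "g \<in> carrier G"
  shows "[h (t \<otimes> g) = h g + (h t - h \<one>)] (mod p)"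
proof -
  obtain f where f:
    "\<And>x y. x \<in> carrier G \<Longrightarrow> y \<in> carrier G \<Longrightarrow> [f (M #> x) (M #> y) = h y - h (x \<otimes> y) + h x] (mod p)"
    using assms(1) unfolding represents_def by blast
  have t: "t \<in> carrier G"
    using assms(2) by (rule mem_carrier)
  have "[f M (M #> g) = h g - h (t \<otimes> g) + h t] (mod p)" "[f M (M #> g) = h g - h g + h \<one>] (mod p)"
    using f[OF t assms(3)] f[OF one_closed assms(3)] assms(3)
    by (simp_all add: coset_M[OF assms(2)] coset_M[OF subgroup.one_closed[OF subgroup_M]])
  from cong_diff[OF cong_refl[of "h g + h t"] cong_trans[OF cong_sym[OF this(1)] this(2)]]
  show ?thesis
    by (simp add: algebra_simps)
qed

text \<open>The cocycles belonging to \<open>h\<close> and \<open>k\<close> differ by the coboundary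
  of some \<open>d\<close> on G/M. Hence \<open>k - h\<close> minus the inflation of
  \<open>d\<close> has zero coboundary, that is, it is a homomorphism on G, and \<open>kill\<close>
  applies to it.\<close>

lemma represents_unique:
  assumes "represents c h" "represents c k" "t \<in> M"
  shows "[h t - h \<one> = k t - k \<one>] (mod p)"
proof -
  obtain f where f: "B.cocycle f" "c = B.cls f" "continuous_map \<tau> (Zp_top p) h"
    "\<And>x y. x \<in> carrier G \<Longrightarrow> y \<in> carrier G \<Longrightarrow> [f (M #> x) (M #> y) = h y - h (x \<otimes> y) + h x] (mod p)"
    using assms(1) unfolding represents_def by blast
  obtain g where g: "B.cocycle g" "c = B.cls g" "continuous_map \<tau> (Zp_top p) k"
    "\<And>x y. x \<in> carrier G \<Longrightarrow> y \<in> carrier G \<Longrightarrow> [g (M #> x) (M #> y) = k y - k (x \<otimes> y) + k x] (mod p)"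
    using assms(2) unfolding represents_def by blast
  have "cohomologous Gb \<tau>b p f g"
    using B.cls_eq_iff[OF f(1) g(1)] f(2) g(2) by simp
  then obtain d where d: "cochain1 Gb \<tau>b p d"
    "\<And>x y. x \<in> carrier Gb \<Longrightarrow> y \<in> carrier Gb \<Longrightarrow>
      [g x y = f x y + (d y - d (x \<otimes>\<^bsub>Gb\<^esub> y) + d x)] (mod p)"
    by (auto simp: cohomologous_def)
  define \<xi> where "\<xi> x = ((k x - h x) mod p - d (M #> x)) mod p" for x
  have "continuous_map \<tau> (Zp_top p) (d \<circ> (\<lambda>g. M #> g))"
    using d(1) quotient_imp_continuous_map[OF quotient_map_M]
    by (auto simp: cochain1_def intro: continuous_map_compose)
  moreover have "continuous_map \<tau> (Zp_top p) (\<lambda>x. (k x - h x) mod p)"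
    using f(3) g(3) B.p_pos continuous_map_Zp_binary[of k h "\<lambda>a b. (a - b) mod p"] by simp
  ultimately have \<xi>: "continuous_map \<tau> (Zp_top p) \<xi>"
    using B.p_pos continuous_map_Zp_binary[of "\<lambda>x. (k x - h x) mod p" "d \<circ> (\<lambda>g. M #> g)" "\<lambda>a b. (a - b) mod p"]
    by (simp add: \<xi>_def[abs_def])
  have \<xi>_cong: "[\<xi> x = k x - h x - d (M #> x)] (mod p)" for x
    by (simp add: \<xi>_def cong_def mod_simps)
  have "hom_mod G p (carrier G) \<xi>"
    unfolding hom_mod_def
  proof (intro ballI)
    fix x y assume xy: "x \<in> carrier G" "y \<in> carrier G"
    have "[k y - k (x \<otimes> y) + k x = h y - h (x \<otimes> y) + h x + (d (M #> y) - d (M #> (x \<otimes> y)) + d (M #> x))] (mod p)"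
      using cong_trans[OF cong_sym[OF g(4)[OF xy]] cong_trans[OF d(2) cong_add[OF f(4)[OF xy] cong_refl]]]
        xy by (simp add: proj_mult)
    from cong_diff[OF cong_refl[of "k x + k y - h (x \<otimes> y) - d (M #> (x \<otimes> y))"] this]
    have "[k (x \<otimes> y) - h (x \<otimes> y) - d (M #> (x \<otimes> y)) =
        (k x - h x - d (M #> x)) + (k y - h y - d (M #> y))] (mod p)"
      by (simp add: algebra_simps)
    from cong_trans[OF cong_trans[OF \<xi>_cong this] cong_sym[OF cong_add[OF \<xi>_cong \<xi>_cong]]]
    show "[\<xi> (x \<otimes> y) = \<xi> x + \<xi> y] (mod p)" .
  qed
  \<comment> \<open>On M the inflation of \<open>d\<close> is the constant \<open>d M\<close>, which
    disappears when the statements for \<open>t\<close> and \<open>\<one>\<close> are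
    subtracted.\<close>
  then have "[k s - h s - d M = 0] (mod p)" if "s \<in> M" for s
    using kill[OF \<xi> _ that] cong_trans[OF cong_sym[OF \<xi>_cong[of s]], of 0] coset_M[OF that] by simp
  from cong_diff[OF this[OF assms(3)] this[OF subgroup.one_closed[OF subgroup_M]]]
  have "[k t - h t - (k \<one> - h \<one>) = 0] (mod p)"
    by (simp add: algebra_simps)
  from cong_diff[OF cong_refl[of "k t - k \<one>"] this] show ?thesis
    by (simp add: algebra_simps)
qed

section \<open>The character of a class\<close>

text \<open>The cocycle takes the value \<open>h \<one>\<close> on the trivial pair; subtracting
  \<open>h \<one>\<close> makes the restriction to M additive. The choice of \<open>h\<close>
  matters only modulo \<open>p\<close>, by \<open>represents_unique\<close>, so all later statements
  are congruences.\<close>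

definition character :: "('g set \<Rightarrow> 'g set \<Rightarrow> int) set \<Rightarrow> 'g \<Rightarrow> int" where
  "character c t = (SOME h. represents c h) t - (SOME h. represents c h) \<one>"

text \<open>The kernel of inflation from G/M to G.\<close>

definition inf_kernel :: "('g set \<Rightarrow> 'g set \<Rightarrow> int) set set" where
  "inf_kernel = {c. \<exists>h. represents c h}"

lemma character_cong:
  assumes "represents c h" "t \<in> M"
  shows "[character c t = h t - h \<one>] (mod p)"
  unfolding character_def
  using represents_unique[OF someI[of "represents c", OF assms(1)] assms] .

lemma inf_kernel_carrier: "inf_kernel \<subseteq> carrier H"
  using represents_carrier by (auto simp: inf_kernel_def)

lemma character_one: "t \<in> M \<Longrightarrow> [character \<one>\<^bsub>H\<^esub> t = 0] (mod p)"
  using character_cong[OF represents_one] by simp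

lemma character_mult:
  assumes "c \<in> inf_kernel" "d \<in> inf_kernel" "t \<in> M"
  shows "c \<otimes>\<^bsub>H\<^esub> d \<in> inf_kernel" "[character (c \<otimes>\<^bsub>H\<^esub> d) t = character c t + character d t] (mod p)"
proof -
  obtain h k where hk: "represents c h" "represents d k"
    using assms by (auto simp: inf_kernel_def)
  note r = represents_mult[OF hk]
  then show "c \<otimes>\<^bsub>H\<^esub> d \<in> inf_kernel"
    by (auto simp: inf_kernel_def)
  have "[character (c \<otimes>\<^bsub>H\<^esub> d) t = (h t - h \<one>) + (k t - k \<one>)] (mod p)"
    using character_cong[OF r assms(3)] by (simp add: cong_def mod_simps algebra_simps)
  moreover have "[character c t + character d t = (h t - h \<one>) + (k t - k \<one>)] (mod p)"
    by (rule cong_add[OF character_cong[OF hk(1) assms(3)] character_cong[OF hk(2) assms(3)]])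
  ultimately show "[character (c \<otimes>\<^bsub>H\<^esub> d) t = character c t + character d t] (mod p)"
    by (metis cong_sym cong_trans)
qed

lemma character_inv:
  assumes "c \<in> inf_kernel" "t \<in> M"
  shows "inv\<^bsub>H\<^esub> c \<in> inf_kernel" "[character (inv\<^bsub>H\<^esub> c) t = - character c t] (mod p)"
proof -
  obtain h where h: "represents c h"
    using assms by (auto simp: inf_kernel_def)
  note r = represents_inv[OF h]
  then show "inv\<^bsub>H\<^esub> c \<in> inf_kernel"
    by (auto simp: inf_kernel_def)
  have "[character (inv\<^bsub>H\<^esub> c) t = - (h t - h \<one>)] (mod p)"
    using character_cong[OF r assms(2)] by (simp add: cong_def mod_simps algebra_simps)
  moreover have "[- character c t = - (h t - h \<one>)] (mod p)"
    using character_cong[OF h assms(2)] by (simp only: cong_minus_minus_iff)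
  ultimately show "[character (inv\<^bsub>H\<^esub> c) t = - character c t] (mod p)"
    by (metis cong_sym cong_trans)
qed

lemma hom_mod_character:
  assumes "c \<in> inf_kernel"
  shows "hom_mod G p M (character c)"
  unfolding hom_mod_def
proof (intro ballI)
  obtain h where h: "represents c h"
    using assms by (auto simp: inf_kernel_def)
  fix s t assume st: "s \<in> M" "t \<in> M"
  have "[character c (s \<otimes> t) = h (s \<otimes> t) - h \<one>] (mod p)"
    using st by (intro character_cong[OF h]) auto
  also have "[h (s \<otimes> t) - h \<one> = h t + (h s - h \<one>) - h \<one>] (mod p)"
    by (rule cong_diff[OF represents_translate[OF h st(1) mem_carrier[OF st(2)]] cong_refl])
  also have "h t + (h s - h \<one>) - h \<one> = (h s - h \<one>) + (h t - h \<one>)"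
    by simp
  also have "[\<dots> = character c s + character c t] (mod p)"
    by (rule cong_sym[OF cong_add[OF character_cong[OF h st(1)] character_cong[OF h st(2)]]])
  finally show "[character c (s \<otimes> t) = character c s + character c t] (mod p)" .
qed

text \<open>Equal characters make \<open>k - h\<close> invariant under translation by M. It
  therefore descends to a continuous cochain on G/M, whose coboundary is the difference of the two
  cocycles.\<close>

lemma character_inj:
  assumes "c \<in> inf_kernel" "d \<in> inf_kernel"
    and eq: "\<And>t. t \<in> M \<Longrightarrow> [character c t = character d t] (mod p)"
  shows "c = d"
proof -
  obtain h k where h: "represents c h" and k: "represents d k"
    using assms by (auto simp: inf_kernel_def)
  obtain f where f: "B.cocycle f" "c = B.cls f" "continuous_map \<tau> (Zp_top p) h"
    "\<And>x y. x \<in> carrier G \<Longrightarrow> y \<in> carrier G \<Longrightarrow> [f (M #> x) (M #> y) = h y - h (x \<otimes> y) + h x] (mod p)"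
    using h unfolding represents_def by blast
  obtain g where g: "B.cocycle g" "d = B.cls g" "continuous_map \<tau> (Zp_top p) k"
    "\<And>x y. x \<in> carrier G \<Longrightarrow> y \<in> carrier G \<Longrightarrow> [g (M #> x) (M #> y) = k y - k (x \<otimes> y) + k x] (mod p)"
    using k unfolding represents_def by blast
  define m where "m x = (k x - h x) mod p" for x
  have m_cont: "continuous_map \<tau> (Zp_top p) m"
    using f(3) g(3) B.p_pos continuous_map_Zp_binary[of k h "\<lambda>a b. (a - b) mod p"]
    by (simp add: m_def[abs_def])
  have m_inv: "m x = m y" if xy: "x \<in> carrier G" "y \<in> carrier G" "M #> x = M #> y" for x y
  proof -
    have "x \<in> M #> y"
      using xy rcos_self[OF _ subgroup_M] by blast
    then obtain t where t: "t \<in> M" "x = t \<otimes> y"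
      by (auto simp: r_coset_def)
    have hk: "[h t - h \<one> = k t - k \<one>] (mod p)"
      using cong_trans[OF cong_sym[OF character_cong[OF h t(1)]]
        cong_trans[OF eq[OF t(1)] character_cong[OF k t(1)]]] .
    have "[k x - h x = k y + (k t - k \<one>) - (h y + (h t - h \<one>))] (mod p)"
      unfolding t(2)
      by (rule cong_diff[OF represents_translate[OF k t(1) xy(2)] represents_translate[OF h t(1) xy(2)]])
    also have "[k y + (k t - k \<one>) - (h y + (h t - h \<one>)) =
        k y + (k t - k \<one>) - (h y + (k t - k \<one>))] (mod p)"
      by (rule cong_diff[OF cong_refl cong_add[OF cong_refl hk]])
    finally show ?thesis
      by (simp add: m_def cong_def)
  qed
  obtain mb where mb: "\<And>x. x \<in> carrier G \<Longrightarrow> m x = mb (M #> x)"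
    using function_factors_left_gen[of "\<lambda>x. x \<in> carrier G" "\<lambda>x. M #> x" m] m_inv by blast
  have "continuous_map \<tau> (Zp_top p) (mb \<circ> (\<lambda>x. M #> x))"
    by (rule continuous_map_eq[OF m_cont]) (simp add: mb top)
  then have "continuous_map \<tau>b (Zp_top p) mb"
    by (rule continuous_compose_quotient_map[OF quotient_map_M])
  then have "cohomologous Gb \<tau>b p f g"
  proof (rule B.cohomologousI)
    fix a b assume "a \<in> carrier Gb" "b \<in> carrier Gb"
    then obtain x y where xy: "x \<in> carrier G" "y \<in> carrier G" "a = M #> x" "b = M #> y"
      by (auto simp: carrier_FactGroup)
    have "[g a b - f a b = (k y - k (x \<otimes> y) + k x) - (h y - h (x \<otimes> y) + h x)] (mod p)"
      unfolding xy(3,4) by (rule cong_diff[OF g(4)[OF xy(1,2)] f(4)[OF xy(1,2)]])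
    also have "(k y - k (x \<otimes> y) + k x) - (h y - h (x \<otimes> y) + h x) =
        (k y - h y) - (k (x \<otimes> y) - h (x \<otimes> y)) + (k x - h x)"
      by simp
    also have "[\<dots> = m y - m (x \<otimes> y) + m x] (mod p)"
      unfolding m_def by (rule cong_sym[OF cong_mod_combination])
    finally have "[g a b - f a b + f a b = m y - m (x \<otimes> y) + m x + f a b] (mod p)"
      by (rule cong_add[OF _ cong_refl])
    then show "a \<otimes>\<^bsub>Gb\<^esub> b \<in> carrier Gb \<and>
        [g a b = f a b + (mb b - mb (a \<otimes>\<^bsub>Gb\<^esub> b) + mb a)] (mod p)"
      using xy by (simp add: proj_mult mb add.commute)
  qed
  then show ?thesis
    using B.cls_eq_iff[OF f(1) g(1)] f(2) g(2) by simp
qed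

text \<open>On M the character is the restriction of \<open>h - h \<one>\<close>, which is
  continuous on all of G; hence the set can be taken clopen in G. The inequality is the form used in
  open covers.\<close>

lemma character_clopen:
  assumes "c \<in> inf_kernel"
  obtains U where "openin \<tau> U" "closedin \<tau> U" "\<And>t. t \<in> M \<Longrightarrow> t \<in> U \<longleftrightarrow> \<not> [character c t = a] (mod p)"
proof -
  obtain h where h: "represents c h"
    using assms by (auto simp: inf_kernel_def)
  then have cont: "continuous_map \<tau> (Zp_top p) h"
    by (auto simp: represents_def)
  let ?V = "{z \<in> {0..<p}. \<not> [z - h \<one> = a] (mod p)}"
  let ?U = "{x \<in> topspace \<tau>. h x \<in> ?V}"
  have "openin \<tau> ?U" "closedin \<tau> ?U"
    by (rule openin_continuous_map_preimage[OF cont] closedin_continuous_map_preimage[OF cont],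
        force simp: Zp_top_def)+
  moreover have "t \<in> ?U \<longleftrightarrow> \<not> [character c t = a] (mod p)" if "t \<in> M" for t
  proof -
    have "t \<in> topspace \<tau>" "h t \<in> {0..<p}"
      using cont mem_carrier[OF that] top by (auto simp: Zp_top_def continuous_map_discrete_iff)
    moreover have "[character c t = a] (mod p) \<longleftrightarrow> [h t - h \<one> = a] (mod p)"
      using character_cong[OF h that] by (metis cong_sym cong_trans)
    ultimately show ?thesis by simp
  qed
  ultimately show thesis
    using that by blast
qed

text \<open>Three subgroups at once: \<open>inf_kernel\<close> for empty \<open>A\<close>, the
  classes with equal character values at two points for constant \<open>r\<close>, and annihilators
  for \<open>r\<close> constantly \<open>\<one>\<close>, where characters vanish.\<close>

lemma subgroup_inf_kernel_where:
  assumes s: "\<And>t. t \<in> A \<Longrightarrow> t \<in> M" "\<And>t. t \<in> A \<Longrightarrow> r t \<in> M"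
  shows "subgroup {c \<in> inf_kernel. \<forall>t\<in>A. [character c t = character c (r t)] (mod p)} H"
proof (rule H.subgroupI)
  let ?S = "{c \<in> inf_kernel. \<forall>t\<in>A. [character c t = character c (r t)] (mod p)}"
  have one: "\<one>\<^bsub>H\<^esub> \<in> inf_kernel"
    using represents_one by (auto simp: inf_kernel_def)
  show "?S \<subseteq> carrier H"
    using inf_kernel_carrier by auto
  have "\<one>\<^bsub>H\<^esub> \<in> ?S"
    using one cong_trans[OF character_one[OF s(1)] cong_sym[OF character_one[OF s(2)]]] by simp
  then show "?S \<noteq> {}"
    by blast
  show "inv\<^bsub>H\<^esub> c \<in> ?S" if "c \<in> ?S" for c
  proof -
    have "[character (inv\<^bsub>H\<^esub> c) t = character (inv\<^bsub>H\<^esub> c) (r t)] (mod p)" if "t \<in> A" for t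
      using \<open>c \<in> ?S\<close> that s[OF that] character_inv(2)[of c t] character_inv(2)[of c "r t"]
        cong_minus_minus_iff[of "character c t" "character c (r t)" p]
      by (auto intro: cong_trans cong_sym)
    then show ?thesis
      using that character_inv(1)[OF _ subgroup.one_closed[OF subgroup_M]] by auto
  qed
  show "c \<otimes>\<^bsub>H\<^esub> d \<in> ?S" if "c \<in> ?S" "d \<in> ?S" for c d
  proof -
    have "[character (c \<otimes>\<^bsub>H\<^esub> d) t = character (c \<otimes>\<^bsub>H\<^esub> d) (r t)] (mod p)" if "t \<in> A" for t
      using \<open>c \<in> ?S\<close> \<open>d \<in> ?S\<close> that s[OF that] character_mult(2)[of c d t] character_mult(2)[of c d "r t"]
        cong_add[of "character c t" "character c (r t)" p "character d t" "character d (r t)"]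
      by (auto intro: cong_trans cong_sym)
    then show ?thesis
      using that character_mult(1)[OF _ _ subgroup.one_closed[OF subgroup_M]] by auto
  qed
qed

lemma subgroup_inf_kernel: "subgroup inf_kernel H"
  using subgroup_inf_kernel_where[of "{}"] by simp

lemma generate_character_eq:
  assumes "S \<subseteq> inf_kernel" "t \<in> M" "u \<in> M"
    and "\<And>c. c \<in> S \<Longrightarrow> [character c t = character c u] (mod p)" and "c \<in> generate H S"
  shows "[character c t = character c u] (mod p)"
proof -
  have "generate H S \<subseteq> {c \<in> inf_kernel. \<forall>t\<in>{t}. [character c t = character c u] (mod p)}"
  proof (rule H.generate_subgroup_incl)
    show "subgroup {c \<in> inf_kernel. \<forall>t\<in>{t}. [character c t = character c u] (mod p)} H"
      using subgroup_inf_kernel_where[of "{t}" "\<lambda>_. u"] assms(2,3) by simp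
  qed (use assms(1,4) in auto)
  then show ?thesis
    using assms(5) by auto
qed

lemma character_pow:
  assumes "c \<in> inf_kernel" "t \<in> M"
  shows "[character (c [^]\<^bsub>H\<^esub> (n::nat)) t = int n * character c t] (mod p)"
proof (induction n)
  case 0
  then show ?case using character_one[OF assms(2)] by simp
next
  case (Suc n)
  have "c [^]\<^bsub>H\<^esub> n \<in> inf_kernel"
    using H.subgroup_nat_pow_closed[OF subgroup_inf_kernel assms(1)] .
  then have "[character (c [^]\<^bsub>H\<^esub> n \<otimes>\<^bsub>H\<^esub> c) t = character (c [^]\<^bsub>H\<^esub> n) t + character c t] (mod p)"
    using assms by (intro character_mult)
  also have "[character (c [^]\<^bsub>H\<^esub> n) t + character c t = int n * character c t + character c t] (mod p)"
    using Suc by (intro cong_add cong_refl)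
  finally show ?case
    by (simp add: algebra_simps)
qed

lemma generate_lincomb:
  assumes "S \<subseteq> inf_kernel" "finite F" "F \<subseteq> S"
  shows "\<exists>c\<in>generate H S. \<forall>t\<in>M. [character c t = (\<Sum>i\<in>F. a i * character i t)] (mod p)"
  using assms(2,3)
proof (induction F rule: finite_induct)
  case empty
  then show ?case
    using character_one by (intro bexI[OF _ generate.one]) simp
next
  case (insert d F)
  then obtain c where c: "c \<in> generate H S"
    "\<And>t. t \<in> M \<Longrightarrow> [character c t = (\<Sum>i\<in>F. a i * character i t)] (mod p)"
    by auto
  \<comment> \<open>The integer coefficient is replaced by its residue, so that a power with a
    natural exponent realises it inside the generated subgroup.\<close>
  define n where "n = nat (a d mod p)"
  have n: "[int n = a d] (mod p)"
    using B.p_pos by (simp add: n_def cong_def)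
  have S: "S \<subseteq> carrier H"
    using assms(1) inf_kernel_carrier by blast
  have sub: "generate H S \<subseteq> inf_kernel"
    using assms(1) by (intro H.generate_subgroup_incl subgroup_inf_kernel)
  have d: "d \<in> inf_kernel" "d [^]\<^bsub>H\<^esub> n \<in> generate H S"
    using insert.prems assms(1) H.subgroup_nat_pow_closed[OF H.generate_is_subgroup[OF S]]
    by (auto intro: generate.incl)
  show ?case
  proof (intro bexI ballI)
    show "d [^]\<^bsub>H\<^esub> n \<otimes>\<^bsub>H\<^esub> c \<in> generate H S"
      using c(1) d(2) by (rule generate.eng[rotated])
    fix t assume t: "t \<in> M"
    have "[character (d [^]\<^bsub>H\<^esub> n \<otimes>\<^bsub>H\<^esub> c) t = character (d [^]\<^bsub>H\<^esub> n) t + character c t] (mod p)"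
      using c d sub t by (intro character_mult) auto
    also have "[character (d [^]\<^bsub>H\<^esub> n) t + character c t =
        a d * character d t + (\<Sum>i\<in>F. a i * character i t)] (mod p)"
      using cong_trans[OF character_pow[OF d(1) t] cong_mult[OF n cong_refl]] c(2)[OF t]
      by (rule cong_add)
    finally show "[character (d [^]\<^bsub>H\<^esub> n \<otimes>\<^bsub>H\<^esub> c) t = (\<Sum>i\<in>insert d F. a i * character i t)] (mod p)"
      using insert.hyps by simp
  qed
qed

section \<open>Annihilators and duality\<close>

lemma character_at_one: "c \<in> inf_kernel \<Longrightarrow> [character c \<one> = 0] (mod p)"
  using hom_mod_one[OF subgroup_M hom_mod_character] .

text \<open>Shown in \<open>inflation_kernel_eq_annihilator\<close> to be the kernel of inflation
  from G/M to G/N.\<close>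

definition annihilator :: "'g set \<Rightarrow> ('g set \<Rightarrow> 'g set \<Rightarrow> int) set set" where
  "annihilator N = {c \<in> inf_kernel. \<forall>n\<in>N. [character c n = 0] (mod p)}"

lemma subgroup_annihilator:
  assumes "N \<subseteq> M"
  shows "subgroup (annihilator N) H"
proof -
  have "annihilator N = {c \<in> inf_kernel. \<forall>n\<in>N. [character c n = character c \<one>] (mod p)}"
    unfolding annihilator_def
    using character_at_one by (blast intro: cong_trans cong_sym)
  then show ?thesis
    using subgroup_inf_kernel_where[of N "\<lambda>_. \<one>"] assms subgroup.one_closed[OF subgroup_M] by auto
qed

lemma generate_subset_inf_kernel: "S \<subseteq> inf_kernel \<Longrightarrow> generate H S \<subseteq> inf_kernel"
  by (intro H.generate_subgroup_incl subgroup_inf_kernel)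

text \<open>The sets where a character differs from its target value are open and cover the compact
  set \<open>C\<close>. The target depends on \<open>c\<close> to allow both 0 and the values of all
  characters at a fixed point.\<close>

lemma finite_separating_family:
  assumes C: "compactin \<tau> C" "C \<subseteq> M" and S: "S \<subseteq> inf_kernel"
    and ex: "\<And>t. t \<in> C \<Longrightarrow> \<exists>c\<in>S. \<not> [character c t = a c] (mod p)"
  obtains F where "finite F" "F \<subseteq> S" "\<And>t. t \<in> C \<Longrightarrow> \<exists>c\<in>F. \<not> [character c t = a c] (mod p)"
proof -
  have "\<exists>U. openin \<tau> U \<and> (\<forall>t\<in>M. t \<in> U \<longleftrightarrow> \<not> [character c t = a c] (mod p))" if "c \<in> S" for c
    using character_clopen[of c "a c"] that S by (metis subsetD)
  then obtain U where U: "\<And>c. c \<in> S \<Longrightarrow> openin \<tau> (U c)"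
    "\<And>c t. c \<in> S \<Longrightarrow> t \<in> M \<Longrightarrow> t \<in> U c \<longleftrightarrow> \<not> [character c t = a c] (mod p)"
    by metis
  have "C \<subseteq> (\<Union>c\<in>S. U c)"
    using ex U(2) C(2) by blast
  then obtain F where F: "finite F" "F \<subseteq> S" "C \<subseteq> (\<Union>c\<in>F. U c)"
    using compactin_finite_index[OF C(1), of S U] U(1) by metis
  have "\<exists>c\<in>F. \<not> [character c t = a c] (mod p)" if t: "t \<in> C" for t
  proof -
    obtain c where "c \<in> F" "t \<in> U c"
      using t F(3) by blast
    moreover have "c \<in> S" "t \<in> M"
      using \<open>c \<in> F\<close> F(2) t C(2) by auto
    ultimately show ?thesis
      using U(2) by blast
  qed
  with F(1,2) show thesis
    by (rule that)
qed

text \<open>Pontryagin duality for the elementary abelian quotients of \<open>M\<close>, reduced by compactness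
  to linear algebra over the prime field.\<close>

theorem generate_Int_annihilator_iff:
  assumes comp: "compact_space \<tau>" and M: "closedin \<tau> M"
    and N: "subgroup N G" "N \<subseteq> M" "closedin \<tau> N" and S: "S \<subseteq> inf_kernel"
  shows "generate H (S \<inter> annihilator N) = generate H S \<inter> annihilator N \<longleftrightarrow>
    (\<forall>t\<in>M. (\<forall>c\<in>S \<inter> annihilator N. [character c t = 0] (mod p)) \<longrightarrow>
      (\<exists>n\<in>N. \<forall>c\<in>S. [character c n = character c t] (mod p)))" (is "?L \<longleftrightarrow> ?R")
proof
  assume L: ?L
  show ?R
  proof (intro ballI impI, rule ccontr)
    fix t assume t: "t \<in> M" "\<forall>c\<in>S \<inter> annihilator N. [character c t = 0] (mod p)"
      and "\<not> (\<exists>n\<in>N. \<forall>c\<in>S. [character c n = character c t] (mod p))"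
    then have ex: "\<exists>c\<in>S. \<not> [character c n = character c t] (mod p)" if "n \<in> N" for n
      using that by blast
    have "compactin \<tau> N"
      using comp N(3) by (rule closedin_compact_space)
    from finite_separating_family[OF this N(2) S ex]
    obtain F where F: "finite F" "F \<subseteq> S"
      "\<And>n. n \<in> N \<Longrightarrow> \<exists>c\<in>F. \<not> [character c n = character c t] (mod p)"
      by metis
    \<comment> \<open>If no element of \<open>N\<close> matches \<open>t\<close>, this combination
      is a member of the group generated by \<open>S\<close> that annihilates \<open>N\<close> but
      not \<open>t\<close>. By \<open>L\<close> it is generated by
      \<open>S \<inter> annihilator N\<close>, all of whose members vanish at \<open>t\<close>: a
      contradiction.\<close>
    have "\<exists>a. (\<forall>n\<in>N. [(\<Sum>c\<in>F. a c * character c n) = 0] (mod p)) \<and>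
        \<not> [(\<Sum>c\<in>F. a c * character c t) = 0] (mod p)"
      using F S t(1)
      by (intro hom_mod_lincomb_separating[OF prime_p F(1) subgroup_M N(1,2)] hom_mod_character) auto
    then obtain a where a: "\<And>n. n \<in> N \<Longrightarrow> [(\<Sum>c\<in>F. a c * character c n) = 0] (mod p)"
        "\<not> [(\<Sum>c\<in>F. a c * character c t) = 0] (mod p)"
      by blast
    obtain c where c: "c \<in> generate H S"
      "\<And>s. s \<in> M \<Longrightarrow> [character c s = (\<Sum>i\<in>F. a i * character i s)] (mod p)"
      using generate_lincomb[OF S F(1,2), of a] by blast
    have "c \<in> annihilator N"
      unfolding annihilator_def
      using c(1) generate_subset_inf_kernel[OF S] cong_trans[OF c(2) a(1)] N(2) by blast
    with c(1) L have gen: "c \<in> generate H (S \<inter> annihilator N)"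
      by blast
    have one: "\<one> \<in> M"
      by (rule subgroup.one_closed[OF subgroup_M])
    have "[character c t = character c \<one>] (mod p)"
    proof (rule generate_character_eq[OF _ t(1) one _ gen])
      show "S \<inter> annihilator N \<subseteq> inf_kernel"
        using S by blast
      show "[character d t = character d \<one>] (mod p)" if "d \<in> S \<inter> annihilator N" for d
        using t(2) that S cong_trans[OF _ cong_sym[OF character_at_one]] by blast
    qed
    then have "[character c t = 0] (mod p)"
      using character_at_one generate_subset_inf_kernel[OF S] c(1) by (blast intro: cong_trans)
    then show False
      using a(2) c(2)[OF t(1)] by (blast intro: cong_trans cong_sym)
  qed
next
  assume R: ?R
  have ann: "S \<inter> annihilator N \<subseteq> inf_kernel"
    using S by blast
  show ?L
  proof (intro equalityI subsetI)
    fix c assume "c \<in> generate H (S \<inter> annihilator N)"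
    moreover have "generate H (S \<inter> annihilator N) \<subseteq> generate H S"
      by (rule H.mono_generate) blast
    moreover have "generate H (S \<inter> annihilator N) \<subseteq> annihilator N"
      by (rule H.generate_subgroup_incl[OF _ subgroup_annihilator[OF N(2)]]) blast
    ultimately show "c \<in> generate H S \<inter> annihilator N"
      by blast
  next
    fix c assume c: "c \<in> generate H S \<inter> annihilator N"
    then have c_inf: "c \<in> inf_kernel"
      by (auto simp: annihilator_def)
    have ker: "[character c t = 0] (mod p)"
      if t: "t \<in> M" "\<forall>d\<in>S \<inter> annihilator N. [character d t = 0] (mod p)" for t
    proof -
      \<comment> \<open>Agreement of \<open>n\<close> and \<open>t\<close> on \<open>S\<close>
        extends to the generated group, hence to \<open>c\<close>, and \<open>c\<close> vanishes on
        \<open>N\<close>.\<close>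
      obtain n where n: "n \<in> N" "\<And>d. d \<in> S \<Longrightarrow> [character d n = character d t] (mod p)"
        using R t by blast
      have "[character c t = character c n] (mod p)"
        by (rule generate_character_eq[OF S t(1) subsetD[OF N(2) n(1)] cong_sym[OF n(2)]]) (use c in auto)
      moreover have "[character c n = 0] (mod p)"
        using c n(1) by (auto simp: annihilator_def)
      ultimately show ?thesis
        by (rule cong_trans)
    qed
    \<comment> \<open>The part of M where \<open>c\<close> is nonzero is compact, and each of its
      points is detected by \<open>S \<inter> annihilator N\<close>. Finitely many members suffice,
      and their common kernel lies in that of \<open>c\<close>.\<close>
    obtain U where U: "openin \<tau> U" "closedin \<tau> U"
      "\<And>t. t \<in> M \<Longrightarrow> t \<in> U \<longleftrightarrow> \<not> [character c t = 0] (mod p)"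
      using character_clopen[OF c_inf] by metis
    have "compactin \<tau> (M \<inter> U)"
      using comp M U(2) by (intro closedin_compact_space closedin_Int)
    moreover have "\<exists>d\<in>S \<inter> annihilator N. \<not> [character d t = 0] (mod p)" if "t \<in> M \<inter> U" for t
      using that ker U(3) by blast
    ultimately obtain F where F: "finite F" "F \<subseteq> S \<inter> annihilator N"
      "\<And>t. t \<in> M \<inter> U \<Longrightarrow> \<exists>d\<in>F. \<not> [character d t = 0] (mod p)"
      using finite_separating_family[of "M \<inter> U" "S \<inter> annihilator N" "\<lambda>_. 0"] ann by (metis inf_le1)
    have "\<exists>a. \<forall>t\<in>M. [character c t = (\<Sum>d\<in>F. a d * character d t)] (mod p)"
    proof (rule hom_mod_lincomb_of_kernel_subset[OF prime_p F(1) subgroup_M])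
      show "hom_mod G p M (character d)" if "d \<in> F" for d
        using that F(2) ann by (intro hom_mod_character) auto
      show "hom_mod G p M (character c)"
        by (rule hom_mod_character[OF c_inf])
      show "[character c t = 0] (mod p)" if "t \<in> M" "\<forall>d\<in>F. [character d t = 0] (mod p)" for t
        using that F(3) U(3) by blast
    qed
    then obtain a where a: "\<And>t. t \<in> M \<Longrightarrow> [character c t = (\<Sum>d\<in>F. a d * character d t)] (mod p)"
      by blast
    obtain c' where c': "c' \<in> generate H (S \<inter> annihilator N)"
      "\<And>t. t \<in> M \<Longrightarrow> [character c' t = (\<Sum>d\<in>F. a d * character d t)] (mod p)"
      using generate_lincomb[OF ann F(1,2), of a] by blast
    \<comment> \<open>The linear algebra gives an identity of characters only; injectivity of the
      character turns it into an identity of classes.\<close>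
    have "c = c'"
      using c_inf subsetD[OF generate_subset_inf_kernel[OF ann] c'(1)] cong_trans[OF a cong_sym[OF c'(2)]]
      by (rule character_inj)
    then show "c \<in> generate H (S \<inter> annihilator N)"
      using c'(1) by simp
  qed
qed

section \<open>Inflation to G/N\<close>

lemma set_mult_coset:
  assumes "subgroup N G" "N \<subseteq> M" "g \<in> carrier G"
  shows "M <#> (N #> g) = M #> g"
proof -
  have "M <#> N = M"
  proof (intro equalityI subsetI)
    fix x assume "x \<in> M"
    then have "x = x \<otimes> \<one>" "\<one> \<in> N"
      using mem_carrier subgroup.one_closed[OF assms(1)] by auto
    then show "x \<in> M <#> N"
      using \<open>x \<in> M\<close> unfolding set_mult_def by blast
  qed (use assms(2) in \<open>auto simp: set_mult_def\<close>)
  then show ?thesis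
    using setmult_rcos_assoc[of M N g] assms subgroup.subset[OF assms(1)] subset by simp
qed

lemma cont_hom_quotient_quotient:
  assumes N: "N \<lhd> G" "N \<subseteq> M"
  shows "(\<lambda>C. M <#> C) \<in> cont_hom (G Mod N) (quot_top G \<tau> N) Gb \<tau>b"
proof -
  interpret N: normal N G by (rule N(1))
  have sub: "subgroup N G"
    by (rule N.subgroup_axioms)
  have "(\<lambda>C. M <#> C) \<in> hom (G Mod N) Gb"
  proof (rule homI)
    fix C D assume "C \<in> carrier (G Mod N)" "D \<in> carrier (G Mod N)"
    then obtain x y where "x \<in> carrier G" "y \<in> carrier G" "C = N #> x" "D = N #> y"
      by (auto simp: carrier_FactGroup)
    then show "M <#> (C \<otimes>\<^bsub>G Mod N\<^esub> D) = (M <#> C) \<otimes>\<^bsub>Gb\<^esub> (M <#> D)"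
      by (simp add: N.rcos_sum proj_mult set_mult_coset[OF sub N(2)])
  qed (auto simp: carrier_FactGroup set_mult_coset[OF sub N(2)])
  moreover have "continuous_map \<tau> \<tau>b ((\<lambda>C. M <#> C) \<circ> (\<lambda>g. N #> g))"
    by (rule continuous_map_eq[OF quotient_imp_continuous_map[OF quotient_map_M]])
      (simp add: top set_mult_coset[OF sub N(2)])
  then have "continuous_map (quot_top G \<tau> N) \<tau>b (\<lambda>C. M <#> C)"
    by (rule continuous_compose_quotient_map[OF quotient_map_quot_top(1)[OF is_group sub top]])
  ultimately show ?thesis
    by (simp add: cont_hom_def)
qed

text \<open>A cochain on G/N that trivialises the inflated cocycle composes with the projection to
  an \<open>h\<close> constant on N, so the character vanishes there. Conversely, a vanishing
  character makes \<open>h\<close> invariant under N, and \<open>h\<close> descends to G/N.\<close>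

lemma inflation_kernel_eq_annihilator:
  assumes N: "N \<lhd> G" "N \<subseteq> M"
  shows "{c \<in> carrier H. pullback (G Mod N) (quot_top G \<tau> N) p (\<lambda>C. M <#> C) c =
      \<one>\<^bsub>H2grp (G Mod N) (quot_top G \<tau> N) p\<^esub>} = annihilator N"
proof -
  interpret N: normal N G by (rule N(1))
  have sub: "subgroup N G"
    by (rule N.subgroup_axioms)
  have ts: "topspace (quot_top G \<tau> N) = carrier (G Mod N)"
    using quotient_map_quot_top(2)[OF is_group sub top] by (simp add: FactGroup_def)
  interpret Q: cochains "G Mod N" "quot_top G \<tau> N" p
    by unfold_locales (rule ts, rule B.p_pos)
  interpret QG: group "G Mod N"
    by (rule N.factorgroup_is_group)
  note qN = quotient_map_quot_top(1)[OF is_group sub top]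
  note \<phi> = cont_hom_quotient_quotient[OF N]
  let ?pull = "pull_cochain (G Mod N) (\<lambda>C. M <#> C)"
  have memN: "N #> x \<in> carrier (G Mod N)" if "x \<in> carrier G" for x
    using that by (simp add: carrier_FactGroup)
  have pull_eq: "?pull f (N #> x) (N #> y) = f (M #> x) (M #> y)"
    if "x \<in> carrier G" "y \<in> carrier G" for f x y
    using that by (simp add: pull_cochain_def memN set_mult_coset[OF sub N(2)])
  have main: "pullback (G Mod N) (quot_top G \<tau> N) p (\<lambda>C. M <#> C) (B.cls f) =
      \<one>\<^bsub>H2grp (G Mod N) (quot_top G \<tau> N) p\<^esub> \<longleftrightarrow> B.cls f \<in> annihilator N" if f: "B.cocycle f" for f
  proof -
    have "pullback (G Mod N) (quot_top G \<tau> N) p (\<lambda>C. M <#> C) (B.cls f) = Q.cls (?pull f)"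
      by (rule pullback_cohom_class[OF ts B.topspace_eq B.p_pos \<phi> f]) (rule QG.m_closed)
    moreover have "Q.cocycle (?pull f)"
      by (rule cocycle2_pull_cochain[OF ts B.topspace_eq B.p_pos \<phi> f]) (rule QG.m_closed)
    ultimately have "pullback (G Mod N) (quot_top G \<tau> N) p (\<lambda>C. M <#> C) (B.cls f) =
        \<one>\<^bsub>H2grp (G Mod N) (quot_top G \<tau> N) p\<^esub> \<longleftrightarrow>
        cohomologous (G Mod N) (quot_top G \<tau> N) p (\<lambda>x y. 0) (?pull f)"
      using Q.cls_eq_iff[OF Q.cocycle_zero] by (auto simp: Q.one_H2grp)
    also have "\<dots> \<longleftrightarrow> B.cls f \<in> annihilator N"
    proof
      assume "cohomologous (G Mod N) (quot_top G \<tau> N) p (\<lambda>x y. 0) (?pull f)"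
      then obtain d where d: "cochain1 (G Mod N) (quot_top G \<tau> N) p d"
        "\<And>C D. C \<in> carrier (G Mod N) \<Longrightarrow> D \<in> carrier (G Mod N) \<Longrightarrow>
          [?pull f C D = 0 + (d D - d (C \<otimes>\<^bsub>G Mod N\<^esub> D) + d C)] (mod p)"
        by (auto simp: cohomologous_def)
      have r: "represents (B.cls f) (d \<circ> (\<lambda>g. N #> g))"
      proof (rule representsI[OF f])
        show "continuous_map \<tau> (Zp_top p) (d \<circ> (\<lambda>g. N #> g))"
          using d(1) quotient_imp_continuous_map[OF qN]
          by (auto simp: cochain1_def intro: continuous_map_compose)
        show "[f (M #> x) (M #> y) = (d \<circ> (\<lambda>g. N #> g)) y - (d \<circ> (\<lambda>g. N #> g)) (x \<otimes> y) +
            (d \<circ> (\<lambda>g. N #> g)) x] (mod p)" if "x \<in> carrier G" "y \<in> carrier G" for x y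
          using d(2)[OF memN[OF that(1)] memN[OF that(2)]] that by (simp add: pull_eq N.rcos_sum)
      qed
      have "[character (B.cls f) n = 0] (mod p)" if n: "n \<in> N" for n
      proof -
        have "N #> n = N #> \<one>"
          using n sub by (simp add: N.rcos_const coset_mult_one N.subset)
        then show ?thesis
          using character_cong[OF r, of n] n N(2) by auto
      qed
      then show "B.cls f \<in> annihilator N"
        using r by (auto simp: annihilator_def inf_kernel_def)
    next
      assume ann: "B.cls f \<in> annihilator N"
      then obtain h where r: "represents (B.cls f) h"
        by (auto simp: annihilator_def inf_kernel_def)
      \<comment> \<open>The cocycle trivialised by \<open>h\<close> may differ from
        \<open>f\<close>; since both have the same class, so do their pullbacks to G/N.\<close>
      then obtain f' where f': "B.cocycle f'" "B.cls f = B.cls f'" "continuous_map \<tau> (Zp_top p) h"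
        "\<And>x y. x \<in> carrier G \<Longrightarrow> y \<in> carrier G \<Longrightarrow> [f' (M #> x) (M #> y) = h y - h (x \<otimes> y) + h x] (mod p)"
        unfolding represents_def by blast
      have h_inv: "h x = h y" if xy: "x \<in> carrier G" "y \<in> carrier G" "N #> x = N #> y" for x y
      proof -
        have "x \<in> N #> y"
          using xy rcos_self[OF _ sub] by blast
        then obtain n where n: "n \<in> N" "x = n \<otimes> y"
          by (auto simp: r_coset_def)
        have nM: "n \<in> M"
          using n(1) N(2) by blast
        have "[h x = h y + (h n - h \<one>)] (mod p)"
          unfolding n(2) by (rule represents_translate[OF r nM xy(2)])
        also have "[h y + (h n - h \<one>) = h y + character (B.cls f) n] (mod p)"
          by (rule cong_add[OF cong_refl cong_sym[OF character_cong[OF r nM]]])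
        also have "[h y + character (B.cls f) n = h y + 0] (mod p)"
          using ann n(1) by (intro cong_add cong_refl) (auto simp: annihilator_def)
        finally have "[h x = h y] (mod p)"
          by simp
        moreover have "h x \<in> {0..<p}" "h y \<in> {0..<p}"
          using f'(3) xy top by (auto simp: Zp_top_def continuous_map_discrete_iff)
        ultimately show ?thesis
          by (simp add: cong_def)
      qed
      obtain d where d: "\<And>x. x \<in> carrier G \<Longrightarrow> h x = d (N #> x)"
        using function_factors_left_gen[of "\<lambda>x. x \<in> carrier G" "\<lambda>x. N #> x" h] h_inv by blast
      have "continuous_map \<tau> (Zp_top p) (d \<circ> (\<lambda>x. N #> x))"
        by (rule continuous_map_eq[OF f'(3)]) (simp add: d top)
      then have "continuous_map (quot_top G \<tau> N) (Zp_top p) d"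
        by (rule continuous_compose_quotient_map[OF qN])
      then have "cohomologous (G Mod N) (quot_top G \<tau> N) p (\<lambda>x y. 0) (?pull f')"
      proof (rule Q.cohomologousI)
        fix C D assume "C \<in> carrier (G Mod N)" "D \<in> carrier (G Mod N)"
        then obtain x y where xy: "x \<in> carrier G" "y \<in> carrier G" "C = N #> x" "D = N #> y"
          by (auto simp: carrier_FactGroup)
        then show "C \<otimes>\<^bsub>G Mod N\<^esub> D \<in> carrier (G Mod N) \<and>
            [?pull f' C D = 0 + (d D - d (C \<otimes>\<^bsub>G Mod N\<^esub> D) + d C)] (mod p)"
          using f'(4)[OF xy(1,2)] by (simp add: pull_eq N.rcos_sum memN d)
      qed
      moreover have "Q.cls (?pull f') = Q.cls (?pull f)"
        using pullback_cohom_class[OF ts B.topspace_eq B.p_pos \<phi> f QG.m_closed]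
          pullback_cohom_class[OF ts B.topspace_eq B.p_pos \<phi> f'(1) QG.m_closed] f'(2) by simp
      moreover have "Q.cocycle (?pull f')"
        by (rule cocycle2_pull_cochain[OF ts B.topspace_eq B.p_pos \<phi> f'(1)]) (rule QG.m_closed)
      ultimately show "cohomologous (G Mod N) (quot_top G \<tau> N) p (\<lambda>x y. 0) (?pull f)"
        using Q.cls_eq_iff \<open>Q.cocycle (?pull f)\<close> Q.cohomologous_trans by blast
    qed
    finally show ?thesis .
  qed
  show ?thesis
  proof (intro equalityI subsetI)
    fix c assume "c \<in> annihilator N"
    moreover from this obtain f where "B.cocycle f" "c = B.cls f"
      using inf_kernel_carrier by (auto simp: annihilator_def B.carrier_H2grp)
    ultimately show "c \<in> {c \<in> carrier H. pullback (G Mod N) (quot_top G \<tau> N) p (\<lambda>C. M <#> C) c =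
        \<one>\<^bsub>H2grp (G Mod N) (quot_top G \<tau> N) p\<^esub>}"
      using main by (auto simp: B.carrier_H2grp)
  qed (use main in \<open>auto simp: B.carrier_H2grp\<close>)
qed

end

section \<open>Central extensions\<close>

locale central_extension =
  fixes p :: int and \<omega> :: "('u, 'v) cext"
  assumes central_ext: "central_ext p \<omega>" and p_pos: "0 < p"
begin

abbreviation "U \<equiv> ext_U \<omega>"
abbreviation "UT \<equiv> ext_UT \<omega>"
abbreviation "Ub \<equiv> ext_Ub \<omega>"
abbreviation "UbT \<equiv> ext_UbT \<omega>"
abbreviation "lam \<equiv> ext_lam \<omega>"

lemma profinite_U: "profinite U UT" and profinite_Ub: "profinite Ub UbT"
  using central_ext by (auto simp: central_ext_def)

sublocale U: group U
  using profinite_U by (simp add: profinite_def topgroup_def)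

sublocale Ub: group Ub
  using profinite_Ub by (simp add: profinite_def topgroup_def)

lemma topspace_U: "topspace UT = carrier U" and topspace_Ub: "topspace UbT = carrier Ub"
  and Hausdorff_U: "Hausdorff_space UT" and Hausdorff_Ub: "Hausdorff_space UbT"
  and compact_U: "compact_space UT"
  using profinite_U profinite_Ub by (auto simp: profinite_def topgroup_def)

lemma lam_hom: "lam \<in> hom U Ub" and lam_cont: "continuous_map UT UbT lam"
  and lam_surj: "lam ` carrier U = carrier Ub"
  using central_ext by (auto simp: central_ext_def cont_hom_def)

sublocale lam: group_hom U Ub lam
  using lam_hom by unfold_locales (auto simp: group_hom_axioms_def)

text \<open>Extending the embedding periodically to all integers makes it additive without range
  conditions.\<close>

definition iota :: "int \<Rightarrow> 'u" where
  "iota a = ext_iota \<omega> (a mod p)"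

lemma mod_in [simp]: "a mod p \<in> {0..<p}"
  using p_pos by simp

lemma iota_closed [simp]: "iota a \<in> carrier U"
  using central_ext mod_in[of a]
  by (auto simp: central_ext_def cont_hom_def hom_def Zp_def iota_def simp del: mod_in)

lemma iota_add: "iota (a + b) = iota a \<otimes>\<^bsub>U\<^esub> iota b"
proof -
  have "ext_iota \<omega> \<in> hom (Zp p) U"
    using central_ext by (auto simp: central_ext_def cont_hom_def)
  from hom_mult[OF this, of "a mod p" "b mod p"] show ?thesis
    using p_pos by (simp add: Zp_def iota_def mod_simps)
qed

lemma iota_zero [simp]: "iota 0 = \<one>\<^bsub>U\<^esub>"
  using iota_add[of 0 0] U.l_cancel_one'[OF iota_closed iota_closed] by simp

lemma iota_eq_iff: "iota a = iota b \<longleftrightarrow> [a = b] (mod p)"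
  using central_ext mod_in[of a] mod_in[of b]
  by (auto simp: central_ext_def iota_def cong_def inj_on_eq_iff simp del: mod_in)

lemma iota_commute: "u \<in> carrier U \<Longrightarrow> iota a \<otimes>\<^bsub>U\<^esub> u = u \<otimes>\<^bsub>U\<^esub> iota a"
  using central_ext mod_in[of a] by (auto simp: central_ext_def iota_def simp del: mod_in)

lemma kernel_lam: "kernel U Ub lam = range iota"
proof -
  have "range iota = ext_iota \<omega> ` {0..<p}"
  proof (intro equalityI subsetI)
    fix u assume "u \<in> ext_iota \<omega> ` {0..<p}"
    then obtain z where "z \<in> {0..<p}" "u = ext_iota \<omega> z"
      by blast
    then have "u = iota z"
      by (simp add: iota_def)
    then show "u \<in> range iota"
      by blast
  qed (auto simp: iota_def p_pos)
  then show ?thesis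
    using central_ext by (simp add: central_ext_def)
qed

lemma lam_iota [simp]: "lam (iota a) = \<one>\<^bsub>Ub\<^esub>"
  using kernel_lam by (auto simp: kernel_def)

text \<open>The expression that \<open>ext_class\<close> uses to read off an element of Z; on the
  kernel of \<open>lam\<close> it inverts \<open>iota\<close>.\<close>

definition log_iota :: "'u \<Rightarrow> int" where
  "log_iota u = (THE z. z \<in> {0..<p} \<and> ext_iota \<omega> z = u)"

lemma log_iota_iota: "log_iota (iota a) = a mod p"
  unfolding log_iota_def
proof (rule the_equality)
  show "a mod p \<in> {0..<p} \<and> ext_iota \<omega> (a mod p) = iota a"
    by (simp add: iota_def p_pos)
  fix z assume "z \<in> {0..<p} \<and> ext_iota \<omega> z = iota a"
  then have "iota z = iota a" "z mod p = z"
    by (auto simp: iota_def)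
  then show "z = a mod p"
    by (simp add: iota_eq_iff cong_def)
qed

lemma iota_log_iota: "u \<in> kernel U Ub lam \<Longrightarrow> iota (log_iota u) = u"
  unfolding kernel_lam using log_iota_iota by (auto simp: iota_eq_iff cong_def)

text \<open>The kernel of \<open>lam\<close> is a finite subset of a Hausdorff space. The fibre over
  \<open>z\<close> is the preimage of the complement of its other elements, a finite and hence
  closed set.\<close>

lemma continuous_log_iota:
  assumes k: "continuous_map \<sigma> UT k" "\<And>x. x \<in> topspace \<sigma> \<Longrightarrow> k x \<in> kernel U Ub lam"
  shows "continuous_map \<sigma> (Zp_top p) (\<lambda>x. log_iota (k x))"
  unfolding Zp_top_def continuous_map_discrete_iff
proof (intro conjI ballI)
  show "log_iota (k x) \<in> {0..<p}" if x: "x \<in> topspace \<sigma>" for x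
    using k(2)[OF x] log_iota_iota p_pos by (auto simp: kernel_lam)
  fix z assume z: "z \<in> {0..<p}"
  let ?F = "iota ` ({0..<p} - {z})"
  have "closedin UT ?F"
    by (intro compactin_imp_closedin[OF Hausdorff_U] finite_imp_compactin) (auto simp: topspace_U)
  then have "openin UT (topspace UT - ?F)"
    by blast
  moreover have "{x \<in> topspace \<sigma>. log_iota (k x) = z} = {x \<in> topspace \<sigma>. k x \<in> topspace UT - ?F}"
  proof (rule Collect_cong, rule conj_cong[OF refl])
    fix x assume x: "x \<in> topspace \<sigma>"
    obtain a where "k x = iota a"
      using k(2)[OF x] kernel_lam by auto
    moreover have "iota (a mod p) = iota a"
      by (simp add: iota_def)
    ultimately have a: "k x = iota (a mod p)" "log_iota (k x) = a mod p"
      by (simp_all add: log_iota_iota)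
    have "k x \<in> ?F \<longleftrightarrow> a mod p \<noteq> z"
    proof
      assume "k x \<in> ?F"
      then obtain b where "b \<in> {0..<p} - {z}" "k x = iota b"
        by blast
      then have "b \<in> {0..<p}" "b \<noteq> z" "iota (a mod p) = iota b"
        using a(1) by simp_all
      then show "a mod p \<noteq> z"
        by (auto simp: iota_eq_iff cong_def)
    next
      assume "a mod p \<noteq> z"
      then show "k x \<in> ?F"
        unfolding a(1) by (intro imageI) (simp add: p_pos)
    qed
    then show "log_iota (k x) = z \<longleftrightarrow> k x \<in> topspace UT - ?F"
      using a by (auto simp: topspace_U)
  qed
  ultimately show "openin \<sigma> {x \<in> topspace \<sigma>. log_iota (k x) = z}"
    using openin_continuous_map_preimage[OF k(1), of "topspace UT - ?F"] by (simp only:)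
qed

lemma continuous_mult:
  assumes "continuous_map \<sigma> UT h" "continuous_map \<sigma> UT k"
  shows "continuous_map \<sigma> UT (\<lambda>x. h x \<otimes>\<^bsub>U\<^esub> k x)"
proof -
  have m: "continuous_map (prod_topology UT UT) UT (\<lambda>(x, y). x \<otimes>\<^bsub>U\<^esub> y)"
    using profinite_U by (simp add: profinite_def topgroup_def)
  have "continuous_map \<sigma> (prod_topology UT UT) (\<lambda>x. (h x, k x))"
    using assms by (simp add: continuous_map_pairedI)
  from continuous_map_compose[OF this m] show ?thesis
    by (simp add: o_def)
qed

lemma continuous_inv:
  assumes "continuous_map \<sigma> UT h"
  shows "continuous_map \<sigma> UT (\<lambda>x. inv\<^bsub>U\<^esub> (h x))"
proof -
  have "continuous_map UT UT (\<lambda>x. inv\<^bsub>U\<^esub> x)"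
    using profinite_U by (simp add: profinite_def topgroup_def)
  from continuous_map_compose[OF assms this] show ?thesis
    by (simp add: o_def)
qed

lemma kernel_of_lam_eq:
  assumes "u \<in> carrier U" "v \<in> carrier U" "lam u = lam v"
  shows "u \<otimes>\<^bsub>U\<^esub> inv\<^bsub>U\<^esub> v \<in> kernel U Ub lam"
  using assms by (simp add: kernel_def)

section \<open>Continuous sections of the extension\<close>

lemma open_map_lam: "open_map UT UbT lam"
  unfolding open_map_def
proof (intro allI impI)
  fix W assume W: "openin UT W"
  have sub: "W \<subseteq> carrier U"
    using openin_subset[OF W] topspace_U by simp
  have "{u \<in> topspace UT. lam u \<in> lam ` W} = (\<Union>a. {u \<in> topspace UT. iota a \<otimes>\<^bsub>U\<^esub> u \<in> W})"
  proof (intro equalityI subsetI)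
    fix u assume "u \<in> {u \<in> topspace UT. lam u \<in> lam ` W}"
    then obtain w where w: "u \<in> carrier U" "w \<in> W" "lam w = lam u"
      by (auto simp: topspace_U)
    then have "w \<otimes>\<^bsub>U\<^esub> inv\<^bsub>U\<^esub> u \<in> range iota"
      using kernel_of_lam_eq[of w u] sub by (auto simp: kernel_lam)
    then obtain a where "iota a = w \<otimes>\<^bsub>U\<^esub> inv\<^bsub>U\<^esub> u"
      by auto
    then have "iota a \<otimes>\<^bsub>U\<^esub> u = w"
      using w sub by (simp add: U.m_assoc subsetD)
    then show "u \<in> (\<Union>a. {u \<in> topspace UT. iota a \<otimes>\<^bsub>U\<^esub> u \<in> W})"
      using w by (auto simp: topspace_U)
  next
    fix u assume "u \<in> (\<Union>a. {u \<in> topspace UT. iota a \<otimes>\<^bsub>U\<^esub> u \<in> W})"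
    then obtain a where u: "u \<in> carrier U" "iota a \<otimes>\<^bsub>U\<^esub> u \<in> W"
      by (auto simp: topspace_U)
    then have "lam (iota a \<otimes>\<^bsub>U\<^esub> u) = lam u"
      by simp
    then show "u \<in> {u \<in> topspace UT. lam u \<in> lam ` W}"
      using u by (metis (mono_tags, lifting) image_eqI mem_Collect_eq topspace_U)
  qed
  moreover have "openin UT {u \<in> topspace UT. iota a \<otimes>\<^bsub>U\<^esub> u \<in> W}" for a
    by (rule openin_continuous_map_preimage[OF continuous_mult W])
      (simp_all add: topspace_U continuous_map_const)
  ultimately have "openin UT {u \<in> topspace UT. lam u \<in> lam ` W}"
    by auto
  moreover have "quotient_map UT UbT lam"
    using lam_cont compact_U Hausdorff_Ub lam_surj
    by (intro continuous_imp_quotient_map) (simp_all add: topspace_U topspace_Ub)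
  moreover have "lam ` W \<subseteq> topspace UbT"
    using sub lam_surj topspace_Ub by blast
  ultimately show "openin UbT (lam ` W)"
    by (simp add: quotient_map_def)
qed

text \<open>Only local injectivity on clopen sets has to be checked: since the kernel is finite,
  near any \<open>u\<close> no two distinct elements differ by a kernel element.\<close>

lemma continuous_section:
  obtains s where "continuous_map UbT UT s" "\<And>x. x \<in> carrier Ub \<Longrightarrow> lam (s x) = x"
proof (rule continuous_section_exists[OF compact_U Hausdorff_U Hausdorff_Ub lam_cont open_map_lam])
  show "lam ` topspace UT = topspace UbT"
    by (simp add: topspace_U topspace_Ub lam_surj)
  fix u assume "u \<in> topspace UT"
  then have u: "u \<in> carrier U"
    by (simp add: topspace_U)
  \<comment> \<open>The nontrivial elements of the kernel; the range starts at 1 to leave out the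
    identity.\<close>
  let ?F = "iota ` {1..<p}"
  have "closedin UT ?F"
    by (intro compactin_imp_closedin[OF Hausdorff_U] finite_imp_compactin) (auto simp: topspace_U)
  then have F: "openin UT (topspace UT - ?F)"
    by blast
  have one: "\<one>\<^bsub>U\<^esub> \<notin> ?F"
  proof
    assume "\<one>\<^bsub>U\<^esub> \<in> ?F"
    then obtain a where a: "a \<in> {1..<p}" "\<one>\<^bsub>U\<^esub> = iota a"
      by blast
    then have "[0 = a] (mod p)"
      using iota_eq_iff[of 0 a] by simp
    then show False
      using a(1) by (auto simp: cong_def)
  qed
  have "continuous_map (prod_topology UT UT) UT (\<lambda>z. fst z \<otimes>\<^bsub>U\<^esub> inv\<^bsub>U\<^esub> (snd z))"
    by (intro continuous_mult continuous_inv continuous_map_fst continuous_map_snd)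
  from openin_continuous_map_preimage[OF this F]
  have "openin (prod_topology UT UT)
      {z \<in> topspace (prod_topology UT UT). fst z \<otimes>\<^bsub>U\<^esub> inv\<^bsub>U\<^esub> (snd z) \<in> topspace UT - ?F}"
    (is "openin _ ?P") .
  moreover have "(u, u) \<in> ?P"
    using u one by (simp add: topspace_U)
  ultimately obtain V W where VW: "openin UT V" "openin UT W" "u \<in> V" "u \<in> W" "V \<times> W \<subseteq> ?P"
    unfolding openin_prod_topology_alt by meson
  then have "openin UT (V \<inter> W)" "u \<in> V \<inter> W"
    by auto
  then obtain C where C: "openin UT C" "closedin UT C" "u \<in> C" "C \<subseteq> V \<inter> W"
    using clopen_neighbourhood[OF compact_U Hausdorff_U] profinite_U
    unfolding profinite_def by metis
  have "inj_on lam C"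
  proof (rule inj_onI)
    fix x y assume xy: "x \<in> C" "y \<in> C" "lam x = lam y"
    then have car: "x \<in> carrier U" "y \<in> carrier U"
      using openin_subset[OF C(1)] by (auto simp: topspace_U)
    have "(x, y) \<in> ?P"
      using xy C(4) VW(5) by blast
    then have nF: "x \<otimes>\<^bsub>U\<^esub> inv\<^bsub>U\<^esub> y \<notin> ?F"
      by simp
    obtain a where "x \<otimes>\<^bsub>U\<^esub> inv\<^bsub>U\<^esub> y = iota a"
      using kernel_of_lam_eq[OF car xy(3)] by (auto simp: kernel_lam)
    then have a: "x \<otimes>\<^bsub>U\<^esub> inv\<^bsub>U\<^esub> y = iota (a mod p)"
      by (simp add: iota_def)
    have "a mod p = 0"
    proof (rule ccontr)
      assume "a mod p \<noteq> 0"
      moreover have "0 \<le> a mod p" "a mod p < p"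
        using p_pos by simp_all
      ultimately have "a mod p \<in> {1..<p}"
        by simp
      then show False
        using nF a by simp
    qed
    then have "x \<otimes>\<^bsub>U\<^esub> inv\<^bsub>U\<^esub> y = \<one>\<^bsub>U\<^esub>"
      using a by simp
    then show "x = y"
      using car U.inv_equality[of x "inv\<^bsub>U\<^esub> y"] by simp
  qed
  then show "\<exists>W. openin UT W \<and> closedin UT W \<and> u \<in> W \<and> inj_on lam W"
    using C by blast
qed (use that topspace_Ub in auto)

section \<open>Factor sets of sections\<close>

definition ext_cocycle :: "('v \<Rightarrow> 'u) \<Rightarrow> 'v \<Rightarrow> 'v \<Rightarrow> int" where
  "ext_cocycle s = (\<lambda>x y. if x \<in> carrier Ub \<and> y \<in> carrier Ub
     then log_iota (s x \<otimes>\<^bsub>U\<^esub> s y \<otimes>\<^bsub>U\<^esub> inv\<^bsub>U\<^esub> (s (x \<otimes>\<^bsub>Ub\<^esub> y))) else 0)"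

lemma ext_class_eq:
  "ext_class p \<omega> = {ext_cocycle s | s. continuous_map UbT UT s \<and> (\<forall>x\<in>carrier Ub. lam (s x) = x)}"
  unfolding ext_class_def ext_cocycle_def log_iota_def by auto

end

locale central_extension_section = central_extension +
  fixes s
  assumes s_cont: "continuous_map UbT UT s" and s_section: "\<And>x. x \<in> carrier Ub \<Longrightarrow> lam (s x) = x"
begin

lemma s_closed [simp]: "x \<in> carrier Ub \<Longrightarrow> s x \<in> carrier U"
  using s_cont by (auto simp: continuous_map_def topspace_U topspace_Ub)

text \<open>The Z-coordinate of \<open>u\<close> in the set-theoretic splitting of \<open>U\<close>
  as Z times \<open>Ub\<close> given by \<open>s\<close>.\<close>

definition defect :: "'a \<Rightarrow> int" where
  "defect u = log_iota (u \<otimes>\<^bsub>U\<^esub> inv\<^bsub>U\<^esub> (s (lam u)))"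

lemma defect_eq: "u \<in> carrier U \<Longrightarrow> u = iota (defect u) \<otimes>\<^bsub>U\<^esub> s (lam u)"
  unfolding defect_def
  by (subst iota_log_iota) (auto intro!: kernel_of_lam_eq simp: s_section U.m_assoc)

lemma continuous_defect: "continuous_map UT (Zp_top p) defect"
  unfolding defect_def[abs_def]
proof (rule continuous_log_iota)
  show "continuous_map UT UT (\<lambda>u. u \<otimes>\<^bsub>U\<^esub> inv\<^bsub>U\<^esub> (s (lam u)))"
    using continuous_map_compose[OF lam_cont s_cont]
    by (intro continuous_mult continuous_inv) (simp_all add: o_def)
qed (auto intro!: kernel_of_lam_eq simp: s_section topspace_U)

text \<open>Pulled back to \<open>U\<close>, the extension becomes trivial: the factor set is the
  coboundary of minus \<open>defect\<close>. The proof computes the product of \<open>u\<close> and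
  \<open>v\<close> in coordinates in two ways, using that Z is central.\<close>

lemma ext_cocycle_lam:
  assumes u: "u \<in> carrier U" and v: "v \<in> carrier U"
  shows "[ext_cocycle s (lam u) (lam v) = defect (u \<otimes>\<^bsub>U\<^esub> v) - defect u - defect v] (mod p)"
proof -
  let ?a = "defect u" and ?b = "defect v" and ?c = "defect (u \<otimes>\<^bsub>U\<^esub> v)"
  let ?s = "s (lam u)" and ?t = "s (lam v)" and ?w = "s (lam u \<otimes>\<^bsub>Ub\<^esub> lam v)"
  have car: "?s \<in> carrier U" "?t \<in> carrier U" "?w \<in> carrier U"
    using u v by simp_all
  have "iota ?c \<otimes>\<^bsub>U\<^esub> ?w = u \<otimes>\<^bsub>U\<^esub> v"
    using defect_eq[of "u \<otimes>\<^bsub>U\<^esub> v"] u v by simp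
  also have "\<dots> = (iota ?a \<otimes>\<^bsub>U\<^esub> ?s) \<otimes>\<^bsub>U\<^esub> (iota ?b \<otimes>\<^bsub>U\<^esub> ?t)"
    by (simp only: defect_eq[OF u, symmetric] defect_eq[OF v, symmetric])
  also have "\<dots> = iota ?a \<otimes>\<^bsub>U\<^esub> (?s \<otimes>\<^bsub>U\<^esub> iota ?b) \<otimes>\<^bsub>U\<^esub> ?t"
    using car by (simp add: U.m_assoc)
  also have "\<dots> = iota (?a + ?b) \<otimes>\<^bsub>U\<^esub> (?s \<otimes>\<^bsub>U\<^esub> ?t)"
    using car by (simp add: iota_commute[OF car(1), of ?b, symmetric] iota_add U.m_assoc)
  finally have eq: "iota ?c \<otimes>\<^bsub>U\<^esub> ?w = iota (?a + ?b) \<otimes>\<^bsub>U\<^esub> (?s \<otimes>\<^bsub>U\<^esub> ?t)" .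
  have "?s \<otimes>\<^bsub>U\<^esub> ?t = iota (- (?a + ?b)) \<otimes>\<^bsub>U\<^esub> (iota (?a + ?b) \<otimes>\<^bsub>U\<^esub> (?s \<otimes>\<^bsub>U\<^esub> ?t))"
    using car by (simp add: U.m_assoc[symmetric] iota_add[symmetric])
  also have "\<dots> = iota (- (?a + ?b) + ?c) \<otimes>\<^bsub>U\<^esub> ?w"
    using car by (simp add: eq[symmetric] U.m_assoc[symmetric] iota_add[symmetric])
  also have "- (?a + ?b) + ?c = ?c - ?a - ?b"
    by simp
  finally have "?s \<otimes>\<^bsub>U\<^esub> ?t \<otimes>\<^bsub>U\<^esub> inv\<^bsub>U\<^esub> ?w = iota (?c - ?a - ?b)"
    using car by (simp add: U.m_assoc)
  then show ?thesis
    using u v by (simp add: ext_cocycle_def log_iota_iota)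
qed

text \<open>After pulling back along the surjection \<open>lam\<close> the factor set is a
  coboundary by \<open>ext_cocycle_lam\<close>, so the cocycle identity reduces to cancellation in
  \<open>U\<close>.\<close>

lemma cocycle2_ext_cocycle: "cocycle2 Ub UbT p (ext_cocycle s)"
proof -
  interpret C: cochains Ub UbT p
    by unfold_locales (rule topspace_Ub, rule p_pos)
  have mult: "continuous_map (prod_topology UbT UbT) UbT (\<lambda>(x, y). x \<otimes>\<^bsub>Ub\<^esub> y)"
    using profinite_Ub by (simp add: profinite_def topgroup_def)
  have "continuous_map (prod_topology UbT UbT) (Zp_top p)
      (\<lambda>z. log_iota (s (fst z) \<otimes>\<^bsub>U\<^esub> s (snd z) \<otimes>\<^bsub>U\<^esub> inv\<^bsub>U\<^esub> (s (fst z \<otimes>\<^bsub>Ub\<^esub> snd z))))"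
  proof (rule continuous_log_iota)
    show "continuous_map (prod_topology UbT UbT) UT
        (\<lambda>z. s (fst z) \<otimes>\<^bsub>U\<^esub> s (snd z) \<otimes>\<^bsub>U\<^esub> inv\<^bsub>U\<^esub> (s (fst z \<otimes>\<^bsub>Ub\<^esub> snd z)))"
      using continuous_map_compose[OF continuous_map_fst s_cont]
        continuous_map_compose[OF continuous_map_snd s_cont] continuous_map_compose[OF mult s_cont]
      by (intro continuous_mult continuous_inv) (simp_all add: o_def case_prod_unfold)
    fix z assume "z \<in> topspace (prod_topology UbT UbT)"
    then have "fst z \<in> carrier Ub" "snd z \<in> carrier Ub"
      by (auto simp: topspace_Ub)
    then show "s (fst z) \<otimes>\<^bsub>U\<^esub> s (snd z) \<otimes>\<^bsub>U\<^esub> inv\<^bsub>U\<^esub> (s (fst z \<otimes>\<^bsub>Ub\<^esub> snd z)) \<in> kernel U Ub lam"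
      by (intro kernel_of_lam_eq) (simp_all add: s_section)
  qed
  then have "continuous_map (prod_topology UbT UbT) (Zp_top p) (\<lambda>(x, y). ext_cocycle s x y)"
    by (rule continuous_map_eq) (auto simp: ext_cocycle_def topspace_Ub)
  then have "cochain2 Ub UbT p (ext_cocycle s)"
    by (auto simp: cochain2_def ext_cocycle_def)
  moreover have "[ext_cocycle s y z + ext_cocycle s x (y \<otimes>\<^bsub>Ub\<^esub> z) =
      ext_cocycle s (x \<otimes>\<^bsub>Ub\<^esub> y) z + ext_cocycle s x y] (mod p)"
    if xyz: "x \<in> carrier Ub" "y \<in> carrier Ub" "z \<in> carrier Ub" for x y z
  proof -
    have "x \<in> lam ` carrier U" "y \<in> lam ` carrier U" "z \<in> lam ` carrier U"
      using xyz lam_surj by simp_all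
    then obtain u v w where uvw: "u \<in> carrier U" "v \<in> carrier U" "w \<in> carrier U"
      "x = lam u" "y = lam v" "z = lam w"
      by blast
    let ?d = defect
    have lhs: "[ext_cocycle s y z + ext_cocycle s x (y \<otimes>\<^bsub>Ub\<^esub> z) = (?d (v \<otimes>\<^bsub>U\<^esub> w) - ?d v - ?d w) +
        (?d (u \<otimes>\<^bsub>U\<^esub> (v \<otimes>\<^bsub>U\<^esub> w)) - ?d u - ?d (v \<otimes>\<^bsub>U\<^esub> w))] (mod p)"
      using cong_add[OF ext_cocycle_lam[OF uvw(2,3)] ext_cocycle_lam[OF uvw(1) U.m_closed[OF uvw(2,3)]]]
        uvw by simp
    have rhs: "[ext_cocycle s (x \<otimes>\<^bsub>Ub\<^esub> y) z + ext_cocycle s x y =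
        (?d (u \<otimes>\<^bsub>U\<^esub> (v \<otimes>\<^bsub>U\<^esub> w)) - ?d (u \<otimes>\<^bsub>U\<^esub> v) - ?d w) + (?d (u \<otimes>\<^bsub>U\<^esub> v) - ?d u - ?d v)] (mod p)"
      using cong_add[OF ext_cocycle_lam[OF U.m_closed[OF uvw(1,2)] uvw(3)] ext_cocycle_lam[OF uvw(1,2)]]
        uvw by (simp add: U.m_assoc)
    have "(?d (v \<otimes>\<^bsub>U\<^esub> w) - ?d v - ?d w) + (?d (u \<otimes>\<^bsub>U\<^esub> (v \<otimes>\<^bsub>U\<^esub> w)) - ?d u - ?d (v \<otimes>\<^bsub>U\<^esub> w)) =
        (?d (u \<otimes>\<^bsub>U\<^esub> (v \<otimes>\<^bsub>U\<^esub> w)) - ?d (u \<otimes>\<^bsub>U\<^esub> v) - ?d w) + (?d (u \<otimes>\<^bsub>U\<^esub> v) - ?d u - ?d v)"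
      by simp
    from cong_trans[OF lhs[unfolded this] cong_sym[OF rhs]] show ?thesis .
  qed
  ultimately show ?thesis
    by (simp add: C.cocycle_cong)
qed

text \<open>On the kernel \<open>defect\<close> is \<open>log_iota\<close> shifted by a constant
  that comes from \<open>s\<close> not being normalised at the identity.\<close>

lemma defect_kernel:
  assumes "u \<in> kernel U Ub lam"
  shows "[defect u - defect \<one>\<^bsub>U\<^esub> = log_iota u] (mod p)"
proof -
  have u: "u \<in> carrier U" "lam u = \<one>\<^bsub>Ub\<^esub>"
    using assms by (auto simp: kernel_def)
  have car: "s \<one>\<^bsub>Ub\<^esub> \<in> carrier U"
    by simp
  have "iota (defect u) \<otimes>\<^bsub>U\<^esub> s \<one>\<^bsub>Ub\<^esub> = u"
    using defect_eq[OF u(1)] u(2) by simp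
  also have "\<dots> = iota (log_iota u) \<otimes>\<^bsub>U\<^esub> (iota (defect \<one>\<^bsub>U\<^esub>) \<otimes>\<^bsub>U\<^esub> s \<one>\<^bsub>Ub\<^esub>)"
    using defect_eq[OF U.one_closed] iota_log_iota[OF assms] u(1) by simp
  also have "\<dots> = iota (log_iota u + defect \<one>\<^bsub>U\<^esub>) \<otimes>\<^bsub>U\<^esub> s \<one>\<^bsub>Ub\<^esub>"
    using car by (simp add: iota_add U.m_assoc)
  finally have "[defect u = log_iota u + defect \<one>\<^bsub>U\<^esub>] (mod p)"
    using car by (simp add: iota_eq_iff)
  from cong_diff[OF this cong_refl[of "defect \<one>\<^bsub>U\<^esub>"]] show ?thesis
    by simp
qed

end

section \<open>Extension classes pulled back along liftable homomorphisms\<close>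

context transgression
begin

text \<open>\<open>ext_cocycle_lam\<close> read along \<open>\<rho>\<close>; the sign in front of
  \<open>defect\<close> is the source of the sign in the characters.\<close>

lemma represents_ext_cocycle:
  assumes "central_extension_section p \<omega> s"
    and \<rho>: "\<rho> \<in> cont_hom G \<tau> (ext_U \<omega>) (ext_UT \<omega>)"
    and \<rho>b: "\<rho>b \<in> cont_hom Gb \<tau>b (ext_Ub \<omega>) (ext_UbT \<omega>)"
    and lift: "\<And>g. g \<in> carrier G \<Longrightarrow> ext_lam \<omega> (\<rho> g) = \<rho>b (M #> g)"
  shows "represents (B.cls (pull_cochain Gb \<rho>b (central_extension.ext_cocycle p \<omega> s)))
           (\<lambda>g. (- central_extension_section.defect p \<omega> s (\<rho> g)) mod p)"
proof -
  interpret E: central_extension_section p \<omega> s by fact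
  have \<rho>_hom: "\<rho> \<in> hom G E.U" and \<rho>_cont: "continuous_map \<tau> E.UT \<rho>"
    using \<rho> by (auto simp: cont_hom_def)
  have \<rho>_closed: "\<rho> g \<in> carrier E.U" if "g \<in> carrier G" for g
    using \<rho>_hom that by (auto simp: hom_def)
  interpret Gb: group Gb by (rule factorgroup_is_group)
  have d: "continuous_map \<tau> (Zp_top p) (\<lambda>g. E.defect (\<rho> g))"
    using continuous_map_compose[OF \<rho>_cont E.continuous_defect] by (simp add: o_def)
  show ?thesis
  proof (rule representsI)
    show "B.cocycle (pull_cochain Gb \<rho>b (E.ext_cocycle s))"
      by (rule cocycle2_pull_cochain[OF B.topspace_eq E.topspace_Ub B.p_pos \<rho>b E.cocycle2_ext_cocycle])
        (rule Gb.m_closed)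
    show "continuous_map \<tau> (Zp_top p) (\<lambda>g. (- E.defect (\<rho> g)) mod p)"
      using continuous_map_Zp_binary[OF d d, of "\<lambda>a b. (- a) mod p"] B.p_pos by simp
    fix x y assume xy: "x \<in> carrier G" "y \<in> carrier G"
    have "pull_cochain Gb \<rho>b (E.ext_cocycle s) (M #> x) (M #> y) = E.ext_cocycle s (E.lam (\<rho> x)) (E.lam (\<rho> y))"
      using xy by (simp add: pull_cochain_def lift)
    also have "[\<dots> = E.defect (\<rho> x \<otimes>\<^bsub>E.U\<^esub> \<rho> y) - E.defect (\<rho> x) - E.defect (\<rho> y)] (mod p)"
      using xy by (intro E.ext_cocycle_lam \<rho>_closed)
    also have "E.defect (\<rho> x \<otimes>\<^bsub>E.U\<^esub> \<rho> y) - E.defect (\<rho> x) - E.defect (\<rho> y) =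
        - E.defect (\<rho> y) - (- E.defect (\<rho> (x \<otimes> y))) + (- E.defect (\<rho> x))"
      using xy by (simp add: hom_mult[OF \<rho>_hom])
    also have "[\<dots> = (- E.defect (\<rho> y)) mod p - (- E.defect (\<rho> (x \<otimes> y))) mod p +
        (- E.defect (\<rho> x)) mod p] (mod p)"
      by (rule cong_sym[OF cong_mod_combination])
    finally show "[pull_cochain Gb \<rho>b (E.ext_cocycle s) (M #> x) (M #> y) =
        (- E.defect (\<rho> y)) mod p - (- E.defect (\<rho> (x \<otimes> y))) mod p + (- E.defect (\<rho> x)) mod p] (mod p)" .
  qed
qed

text \<open>Different sections give the same class because the character of each of the resulting classes
  is minus the restriction of \<open>\<rho>\<close> to \<open>M\<close>, and the character determines the class.\<close>

lemma pullback_ext_class: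
  assumes ext: "central_ext p \<omega>"
    and \<rho>: "\<rho> \<in> cont_hom G \<tau> (ext_U \<omega>) (ext_UT \<omega>)"
    and \<rho>b: "\<rho>b \<in> cont_hom Gb \<tau>b (ext_Ub \<omega>) (ext_UbT \<omega>)"
    and lift: "\<And>g. g \<in> carrier G \<Longrightarrow> ext_lam \<omega> (\<rho> g) = \<rho>b (M #> g)"
  shows "pullback Gb \<tau>b p \<rho>b (ext_class p \<omega>) \<in> inf_kernel"
    and "t \<in> M \<Longrightarrow> [character (pullback Gb \<tau>b p \<rho>b (ext_class p \<omega>)) t = 0] (mod p) \<longleftrightarrow>
      \<rho> t = \<one>\<^bsub>ext_U \<omega>\<^esub>"
proof -
  interpret E: central_extension p \<omega>
    by unfold_locales (rule ext, rule B.p_pos)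
  interpret Gb: group Gb by (rule factorgroup_is_group)
  have \<rho>_hom: "\<rho> \<in> hom G E.U"
    using \<rho> by (auto simp: cont_hom_def)
  have \<rho>_closed: "\<rho> g \<in> carrier E.U" if "g \<in> carrier G" for g
    using \<rho>_hom that by (auto simp: hom_def)
  have \<rho>_one: "\<rho> \<one> = \<one>\<^bsub>E.U\<^esub>"
    using hom_one[OF \<rho>_hom is_group E.U.is_group] .
  \<comment> \<open>As \<open>\<rho>b\<close> is a homomorphism on G/M, its composite with the
    projection is trivial on M, so the lift \<open>\<rho>\<close> takes M into the central copy of
    Z/p.\<close>
  have ker: "\<rho> t \<in> kernel E.U E.Ub E.lam" if t: "t \<in> M" for t
  proof -
    have "\<rho>b M = \<one>\<^bsub>E.Ub\<^esub>"
      using hom_one[OF _ Gb.is_group E.Ub.is_group, of \<rho>b] \<rho>b by (simp add: cont_hom_def)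
    then show ?thesis
      using t lift[of t] coset_M[OF t] mem_carrier[OF t] by (simp add: kernel_def \<rho>_closed)
  qed
  let ?c = "\<lambda>s. B.cls (pull_cochain Gb \<rho>b (E.ext_cocycle s))"
  have char: "?c s \<in> inf_kernel" "t \<in> M \<Longrightarrow> [character (?c s) t = - E.log_iota (\<rho> t)] (mod p)"
    if s: "continuous_map E.UbT E.UT s" "\<forall>x\<in>carrier E.Ub. E.lam (s x) = x" for s t
  proof -
    interpret S: central_extension_section p \<omega> s
      using s by unfold_locales auto
    have r: "represents (?c s) (\<lambda>g. (- S.defect (\<rho> g)) mod p)"
      by (rule represents_ext_cocycle[OF S.central_extension_section_axioms \<rho> \<rho>b lift])
    then show "?c s \<in> inf_kernel"
      by (auto simp: inf_kernel_def)
    assume t: "t \<in> M"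
    have "[character (?c s) t = (- S.defect (\<rho> t)) mod p - (- S.defect (\<rho> \<one>)) mod p] (mod p)"
      by (rule character_cong[OF r t])
    also have "[(- S.defect (\<rho> t)) mod p - (- S.defect (\<rho> \<one>)) mod p =
        - S.defect (\<rho> t) - - S.defect (\<rho> \<one>)] (mod p)"
      by (intro cong_diff) (simp_all add: cong_def)
    also have "- S.defect (\<rho> t) - - S.defect (\<rho> \<one>) = - (S.defect (\<rho> t) - S.defect \<one>\<^bsub>E.U\<^esub>)"
      by (simp add: \<rho>_one)
    also have "[\<dots> = - E.log_iota (\<rho> t)] (mod p)"
      using S.defect_kernel[OF ker[OF t]] by (simp only: cong_minus_minus_iff)
    finally show "[character (?c s) t = - E.log_iota (\<rho> t)] (mod p)" .
  qed
  obtain s where s: "continuous_map E.UbT E.UT s" "\<forall>x\<in>carrier E.Ub. E.lam (s x) = x"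
    using E.continuous_section by metis
  have same: "?c s' = ?c s" if "continuous_map E.UbT E.UT s'" "\<forall>x\<in>carrier E.Ub. E.lam (s' x) = x" for s'
    using char(1)[OF that] char(1)[OF s] cong_trans[OF char(2)[OF that] cong_sym[OF char(2)[OF s]]]
    by (rule character_inj)
  have pb: "pullback Gb \<tau>b p \<rho>b (ext_class p \<omega>) = ?c s"
  proof -
    have "pullback Gb \<tau>b p \<rho>b (ext_class p \<omega>) = (\<Union>f\<in>ext_class p \<omega>. B.cls (pull_cochain Gb \<rho>b f))"
      by (simp add: pullback_def pull_cochain_def)
    also have "\<dots> = ?c s"
    proof (intro equalityI subsetI)
      fix x assume "x \<in> ?c s"
      moreover have "E.ext_cocycle s \<in> ext_class p \<omega>"
        using s unfolding E.ext_class_eq by blast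
      ultimately show "x \<in> (\<Union>f\<in>ext_class p \<omega>. B.cls (pull_cochain Gb \<rho>b f))"
        by blast
    next
      fix x assume "x \<in> (\<Union>f\<in>ext_class p \<omega>. B.cls (pull_cochain Gb \<rho>b f))"
      then obtain s' where s': "continuous_map E.UbT E.UT s'" "\<forall>x\<in>carrier E.Ub. E.lam (s' x) = x"
        "x \<in> ?c s'"
        unfolding E.ext_class_eq by blast
      then show "x \<in> ?c s"
        using same[OF s'(1,2)] by simp
    qed
    finally show ?thesis .
  qed
  show "pullback Gb \<tau>b p \<rho>b (ext_class p \<omega>) \<in> inf_kernel"
    unfolding pb by (rule char(1)[OF s])
  assume t: "t \<in> M"
  have "[character (?c s) t = 0] (mod p) \<longleftrightarrow> [- E.log_iota (\<rho> t) = - 0] (mod p)"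
    using cong_trans[OF cong_sym[OF char(2)[OF s t]], of 0] cong_trans[OF char(2)[OF s t], of 0]
    by auto
  also have "\<dots> \<longleftrightarrow> E.iota (E.log_iota (\<rho> t)) = E.iota 0"
    by (simp only: cong_minus_minus_iff E.iota_eq_iff)
  also have "\<dots> \<longleftrightarrow> \<rho> t = \<one>\<^bsub>E.U\<^esub>"
    by (simp add: E.iota_log_iota[OF ker[OF t]])
  finally show "[character (pullback Gb \<tau>b p \<rho>b (ext_class p \<omega>)) t = 0] (mod p) \<longleftrightarrow>
      \<rho> t = \<one>\<^bsub>ext_U \<omega>\<^esub>"
    unfolding pb .
qed

end

section \<open>The groups T and Tbar\<close>

lemma mem_Tbar_iff:
  "t \<in> Tbar \<Omega> G \<tau> \<longleftrightarrow> t \<in> carrier G \<and>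
     (\<forall>\<omega>\<in>\<Omega>. \<forall>\<phi>\<in>cont_hom G \<tau> (ext_Ub \<omega>) (ext_UbT \<omega>). \<phi> t = \<one>\<^bsub>ext_Ub \<omega>\<^esub>)"
  by (auto simp: Tbar_def TU_def kernel_def)

lemma mem_Tgrp_iff:
  "t \<in> Tgrp \<Omega> G \<tau> \<longleftrightarrow> t \<in> carrier G \<and>
     (\<forall>\<omega>\<in>\<Omega>. \<forall>\<phi>\<in>cont_hom G \<tau> (ext_U \<omega>) (ext_UT \<omega>). \<phi> t = \<one>\<^bsub>ext_U \<omega>\<^esub>)"
  by (auto simp: Tgrp_def TU_def kernel_def)

lemma cont_hom_compose:
  assumes "\<phi> \<in> cont_hom G \<tau> H \<sigma>" "\<psi> \<in> cont_hom H \<sigma> K \<kappa>"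
  shows "(\<lambda>x. \<psi> (\<phi> x)) \<in> cont_hom G \<tau> K \<kappa>"
  using assms continuous_map_compose[of \<tau> \<sigma> \<phi> \<kappa> \<psi>]
  by (auto simp: cont_hom_def hom_def o_def Pi_iff)

lemma cont_hom_quotient_factor:
  assumes "group G" "N \<lhd> G" "topspace \<tau> = carrier G" "group K"
    and \<phi>: "\<phi> \<in> cont_hom G \<tau> K \<kappa>" and ker: "\<And>n. n \<in> N \<Longrightarrow> \<phi> n = \<one>\<^bsub>K\<^esub>"
  obtains \<psi> where "\<psi> \<in> cont_hom (G Mod N) (quot_top G \<tau> N) K \<kappa>"
    "\<And>g. g \<in> carrier G \<Longrightarrow> \<psi> (N #>\<^bsub>G\<^esub> g) = \<phi> g"
proof -
  interpret normal N G by fact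
  interpret K: group K by fact
  have hom: "\<phi> \<in> hom G K" and cont: "continuous_map \<tau> \<kappa> \<phi>"
    using \<phi> by (auto simp: cont_hom_def)
  have sub: "subgroup N G"
    by (rule subgroup_axioms)
  have "\<phi> x = \<phi> y" if xy: "x \<in> carrier G" "y \<in> carrier G" "N #>\<^bsub>G\<^esub> x = N #>\<^bsub>G\<^esub> y" for x y
  proof -
    have "x \<in> N #>\<^bsub>G\<^esub> y"
      using xy rcos_self[OF _ sub] by blast
    then obtain n where n: "n \<in> N" "x = n \<otimes>\<^bsub>G\<^esub> y"
      by (auto simp: r_coset_def)
    then have "\<phi> x = \<phi> n \<otimes>\<^bsub>K\<^esub> \<phi> y"
      using hom_mult[OF hom] mem_carrier xy by simp
    moreover have "\<phi> y \<in> carrier K"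
      using hom xy(2) by (auto simp: hom_def)
    ultimately show ?thesis
      using ker[OF n(1)] by simp
  qed
  with FactGroup_universal[OF hom assms(2)] obtain \<psi> where \<psi>: "\<psi> \<in> hom (G Mod N) K"
    "\<And>g. g \<in> carrier G \<Longrightarrow> \<psi> (N #>\<^bsub>G\<^esub> g) = \<phi> g"
    by metis
  have "continuous_map \<tau> \<kappa> (\<psi> \<circ> (\<lambda>g. N #>\<^bsub>G\<^esub> g))"
    by (rule continuous_map_eq[OF cont]) (simp add: \<psi>(2) assms(3))
  then have "continuous_map (quot_top G \<tau> N) \<kappa> \<psi>"
    by (rule continuous_compose_quotient_map[OF quotient_map_quot_top(1)[OF assms(1) sub assms(3)]])
  with \<psi> show thesis
    using that by (simp add: cont_hom_def)
qed

lemma cont_hom_proj: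
  assumes "group G" "N \<lhd> G" "topspace \<tau> = carrier G"
  shows "(\<lambda>g. N #>\<^bsub>G\<^esub> g) \<in> cont_hom G \<tau> (G Mod N) (quot_top G \<tau> N)"
  using normal.r_coset_hom_Mod[OF assms(2)]
    quotient_imp_continuous_map[OF quotient_map_quot_top(1)[OF assms(1)
      normal_imp_subgroup[OF assms(2)] assms(3)]]
  by (simp add: cont_hom_def)

text \<open>Continuous homomorphisms on G/N correspond to those on G that are trivial on N, so
  membership can be tested on G.\<close>

lemma coset_mem_Tgrp_quotient_iff:
  assumes "group G" "N \<lhd> G" "topspace \<tau> = carrier G" "\<And>\<omega>. \<omega> \<in> \<Omega> \<Longrightarrow> group (ext_U \<omega>)"
    and g: "g \<in> carrier G"
  shows "N #>\<^bsub>G\<^esub> g \<in> Tgrp \<Omega> (G Mod N) (quot_top G \<tau> N) \<longleftrightarrow>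
    (\<forall>\<omega>\<in>\<Omega>. \<forall>\<rho>\<in>cont_hom G \<tau> (ext_U \<omega>) (ext_UT \<omega>).
      (\<forall>n\<in>N. \<rho> n = \<one>\<^bsub>ext_U \<omega>\<^esub>) \<longrightarrow> \<rho> g = \<one>\<^bsub>ext_U \<omega>\<^esub>)" (is "?L \<longleftrightarrow> ?R")
proof
  assume L: ?L
  show ?R
  proof (intro ballI impI)
    fix \<omega> \<rho> assume \<rho>: "\<omega> \<in> \<Omega>" "\<rho> \<in> cont_hom G \<tau> (ext_U \<omega>) (ext_UT \<omega>)"
      "\<forall>n\<in>N. \<rho> n = \<one>\<^bsub>ext_U \<omega>\<^esub>"
    obtain \<psi> where "\<psi> \<in> cont_hom (G Mod N) (quot_top G \<tau> N) (ext_U \<omega>) (ext_UT \<omega>)"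
      "\<And>g. g \<in> carrier G \<Longrightarrow> \<psi> (N #>\<^bsub>G\<^esub> g) = \<rho> g"
      by (rule cont_hom_quotient_factor[OF assms(1-3) assms(4)[OF \<rho>(1)] \<rho>(2)]) (use \<rho>(3) in auto)
    then show "\<rho> g = \<one>\<^bsub>ext_U \<omega>\<^esub>"
      using L g \<rho>(1) unfolding mem_Tgrp_iff by metis
  qed
next
  assume R: ?R
  have "\<psi> (N #>\<^bsub>G\<^esub> g) = \<one>\<^bsub>ext_U \<omega>\<^esub>"
    if \<psi>: "\<omega> \<in> \<Omega>" "\<psi> \<in> cont_hom (G Mod N) (quot_top G \<tau> N) (ext_U \<omega>) (ext_UT \<omega>)" for \<omega> \<psi>
  proof -
    interpret normal N G by fact
    have "\<psi> (N #>\<^bsub>G\<^esub> n) = \<one>\<^bsub>ext_U \<omega>\<^esub>" if "n \<in> N" for n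
      using hom_one[OF _ factorgroup_is_group assms(4)[OF \<psi>(1)], of \<psi>] \<psi>(2)
        rcos_const[OF is_group that] by (simp add: cont_hom_def)
    then show ?thesis
      using R[rule_format, OF \<psi>(1) cont_hom_compose[OF cont_hom_proj[OF assms(1-3)] \<psi>(2)]] by simp
  qed
  then show ?L
    using g by (auto simp: mem_Tgrp_iff carrier_FactGroup)
qed

text \<open>For a homomorphism \<open>\<phi>\<close> to \<open>Ub\<close>, every composite with a
  map of (I) is trivial on \<open>N\<close>, since \<open>\<phi>\<close> is; the assumption then
  kills it at \<open>g\<close>. As the maps of (I) have trivial common kernel,
  \<open>\<phi> g\<close> is the identity.\<close>

lemma cond_I_mem_Tbar:
  assumes I: "\<And>\<omega>. \<omega> \<in> \<Omega> \<Longrightarrow> cond_I \<omega>" and N: "N \<subseteq> Tbar \<Omega> G \<tau>"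
    and one: "\<And>\<omega> \<gamma>. \<omega> \<in> \<Omega> \<Longrightarrow> \<gamma> \<in> cont_hom (ext_Ub \<omega>) (ext_UbT \<omega>) (ext_U \<omega>) (ext_UT \<omega>) \<Longrightarrow>
      \<gamma> \<one>\<^bsub>ext_Ub \<omega>\<^esub> = \<one>\<^bsub>ext_U \<omega>\<^esub>"
    and g: "g \<in> carrier G"
      "\<And>\<omega> \<rho>. \<omega> \<in> \<Omega> \<Longrightarrow> \<rho> \<in> cont_hom G \<tau> (ext_U \<omega>) (ext_UT \<omega>) \<Longrightarrow>
        \<forall>n\<in>N. \<rho> n = \<one>\<^bsub>ext_U \<omega>\<^esub> \<Longrightarrow> \<rho> g = \<one>\<^bsub>ext_U \<omega>\<^esub>"
  shows "g \<in> Tbar \<Omega> G \<tau>"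
  unfolding mem_Tbar_iff
proof (intro conjI ballI)
  fix \<omega> \<phi> assume \<phi>: "\<omega> \<in> \<Omega>" "\<phi> \<in> cont_hom G \<tau> (ext_Ub \<omega>) (ext_UbT \<omega>)"
  obtain \<Gamma> where \<Gamma>: "\<Gamma> \<subseteq> cont_hom (ext_Ub \<omega>) (ext_UbT \<omega>) (ext_U \<omega>) (ext_UT \<omega>)"
    "carrier (ext_Ub \<omega>) \<inter> (\<Inter>\<gamma>\<in>\<Gamma>. kernel (ext_Ub \<omega>) (ext_U \<omega>) \<gamma>) = {\<one>\<^bsub>ext_Ub \<omega>\<^esub>}"
    using I[OF \<phi>(1)] by (auto simp: cond_I_def)
  have car: "\<phi> g \<in> carrier (ext_Ub \<omega>)"
    using \<phi>(2) g(1) by (auto simp: cont_hom_def hom_def)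
  have "\<gamma> (\<phi> g) = \<one>\<^bsub>ext_U \<omega>\<^esub>" if \<gamma>: "\<gamma> \<in> \<Gamma>" for \<gamma>
  proof -
    have \<gamma>': "\<gamma> \<in> cont_hom (ext_Ub \<omega>) (ext_UbT \<omega>) (ext_U \<omega>) (ext_UT \<omega>)"
      using \<gamma> \<Gamma>(1) by blast
    have "\<gamma> (\<phi> n) = \<one>\<^bsub>ext_U \<omega>\<^esub>" if "n \<in> N" for n
    proof -
      have "\<phi> n = \<one>\<^bsub>ext_Ub \<omega>\<^esub>"
        using N that \<phi> by (auto simp: mem_Tbar_iff dest!: subsetD)
      then show ?thesis
        using one[OF \<phi>(1) \<gamma>'] by simp
    qed
    then show ?thesis
      using g(2)[OF \<phi>(1) cont_hom_compose[OF \<phi>(2) \<gamma>']] by simp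
  qed
  then have "\<phi> g \<in> carrier (ext_Ub \<omega>) \<inter> (\<Inter>\<gamma>\<in>\<Gamma>. kernel (ext_Ub \<omega>) (ext_U \<omega>) \<gamma>)"
    using car by (simp add: kernel_def)
  then show "\<phi> g = \<one>\<^bsub>ext_Ub \<omega>\<^esub>"
    using \<Gamma>(2) by simp
qed (rule g(1))

lemma normal_Tbar:
  assumes "group G" "\<And>\<omega>. \<omega> \<in> \<Omega> \<Longrightarrow> group (ext_Ub \<omega>)"
  shows "Tbar \<Omega> G \<tau> \<lhd> G"
proof -
  interpret G: group G by fact
  have gh: "group_hom G (ext_Ub \<omega>) \<phi>"
    if "\<omega> \<in> \<Omega>" "\<phi> \<in> cont_hom G \<tau> (ext_Ub \<omega>) (ext_UbT \<omega>)" for \<omega> \<phi>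
    using that assms by (auto simp: group_hom_def group_hom_axioms_def cont_hom_def)
  have hom: "\<phi> \<one>\<^bsub>G\<^esub> = \<one>\<^bsub>ext_Ub \<omega>\<^esub>"
    "x \<in> carrier G \<Longrightarrow> \<phi> x \<in> carrier (ext_Ub \<omega>)"
    "x \<in> carrier G \<Longrightarrow> y \<in> carrier G \<Longrightarrow> \<phi> (x \<otimes>\<^bsub>G\<^esub> y) = \<phi> x \<otimes>\<^bsub>ext_Ub \<omega>\<^esub> \<phi> y"
    "x \<in> carrier G \<Longrightarrow> \<phi> (inv\<^bsub>G\<^esub> x) = inv\<^bsub>ext_Ub \<omega>\<^esub> (\<phi> x)"
    if "\<omega> \<in> \<Omega>" "\<phi> \<in> cont_hom G \<tau> (ext_Ub \<omega>) (ext_UbT \<omega>)" for \<omega> \<phi> x y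
    using group_hom.hom_one[OF gh[OF that]] group_hom.hom_closed[OF gh[OF that]]
      group_hom.hom_mult[OF gh[OF that]] group_hom.hom_inv[OF gh[OF that]] by auto
  have carr: "x \<in> carrier G" if "x \<in> Tbar \<Omega> G \<tau>" for x
    using that by (simp add: mem_Tbar_iff)
  have triv: "\<phi> x = \<one>\<^bsub>ext_Ub \<omega>\<^esub>"
    if "\<omega> \<in> \<Omega>" "\<phi> \<in> cont_hom G \<tau> (ext_Ub \<omega>) (ext_UbT \<omega>)" "x \<in> Tbar \<Omega> G \<tau>" for \<omega> \<phi> x
    using that by (simp add: mem_Tbar_iff)
  have "subgroup (Tbar \<Omega> G \<tau>) G"
  proof (rule G.subgroupI)
    show "Tbar \<Omega> G \<tau> \<subseteq> carrier G"
      by (auto simp: mem_Tbar_iff)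
    have "\<one>\<^bsub>G\<^esub> \<in> Tbar \<Omega> G \<tau>"
      by (simp add: mem_Tbar_iff hom(1))
    then show "Tbar \<Omega> G \<tau> \<noteq> {}"
      by blast
    show "inv\<^bsub>G\<^esub> a \<in> Tbar \<Omega> G \<tau>" if a: "a \<in> Tbar \<Omega> G \<tau>" for a
      unfolding mem_Tbar_iff
    proof (intro conjI ballI)
      fix \<omega> \<phi> assume *: "\<omega> \<in> \<Omega>" "\<phi> \<in> cont_hom G \<tau> (ext_Ub \<omega>) (ext_UbT \<omega>)"
      interpret K: group "ext_Ub \<omega>" using * by (intro assms)
      show "\<phi> (inv\<^bsub>G\<^esub> a) = \<one>\<^bsub>ext_Ub \<omega>\<^esub>"
        using hom(4)[OF * carr[OF a]] triv[OF * a] by simp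
    qed (use carr[OF a] in simp)
    show "a \<otimes>\<^bsub>G\<^esub> b \<in> Tbar \<Omega> G \<tau>" if ab: "a \<in> Tbar \<Omega> G \<tau>" "b \<in> Tbar \<Omega> G \<tau>" for a b
      unfolding mem_Tbar_iff
    proof (intro conjI ballI)
      fix \<omega> \<phi> assume *: "\<omega> \<in> \<Omega>" "\<phi> \<in> cont_hom G \<tau> (ext_Ub \<omega>) (ext_UbT \<omega>)"
      interpret K: group "ext_Ub \<omega>" using * by (intro assms)
      show "\<phi> (a \<otimes>\<^bsub>G\<^esub> b) = \<one>\<^bsub>ext_Ub \<omega>\<^esub>"
        using hom(3)[OF * carr[OF ab(1)] carr[OF ab(2)]] triv[OF * ab(1)] triv[OF * ab(2)] by simp
    qed (use carr[OF ab(1)] carr[OF ab(2)] in simp)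
  qed
  then show ?thesis
  proof (rule G.normal_invI)
    fix x h assume x: "x \<in> carrier G" and h: "h \<in> Tbar \<Omega> G \<tau>"
    show "x \<otimes>\<^bsub>G\<^esub> h \<otimes>\<^bsub>G\<^esub> inv\<^bsub>G\<^esub> x \<in> Tbar \<Omega> G \<tau>"
      unfolding mem_Tbar_iff
    proof (intro conjI ballI)
      fix \<omega> \<phi> assume *: "\<omega> \<in> \<Omega>" "\<phi> \<in> cont_hom G \<tau> (ext_Ub \<omega>) (ext_UbT \<omega>)"
      interpret K: group "ext_Ub \<omega>" using * by (intro assms)
      show "\<phi> (x \<otimes>\<^bsub>G\<^esub> h \<otimes>\<^bsub>G\<^esub> inv\<^bsub>G\<^esub> x) = \<one>\<^bsub>ext_Ub \<omega>\<^esub>"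
        using x carr[OF h] hom(2)[OF * x] by (simp add: hom(3,4)[OF *] triv[OF * h])
    qed (use x carr[OF h] in simp)
  qed
qed

lemma closedin_Tbar:
  assumes top: "topspace \<tau> = carrier G"
    and \<Omega>: "\<And>\<omega>. \<omega> \<in> \<Omega> \<Longrightarrow> profinite (ext_Ub \<omega>) (ext_UbT \<omega>)"
  shows "closedin \<tau> (Tbar \<Omega> G \<tau>)"
proof -
  let ?V = "\<lambda>\<omega> \<phi>. {x \<in> topspace \<tau>. \<phi> x \<in> topspace (ext_UbT \<omega>) - {\<one>\<^bsub>ext_Ub \<omega>\<^esub>}}"
  let ?W = "\<Union>\<omega>\<in>\<Omega>. \<Union>\<phi>\<in>cont_hom G \<tau> (ext_Ub \<omega>) (ext_UbT \<omega>). ?V \<omega> \<phi>"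
  have op: "openin \<tau> (?V \<omega> \<phi>)"
    if "\<omega> \<in> \<Omega>" "\<phi> \<in> cont_hom G \<tau> (ext_Ub \<omega>) (ext_UbT \<omega>)" for \<omega> \<phi>
  proof (rule openin_continuous_map_preimage)
    show "continuous_map \<tau> (ext_UbT \<omega>) \<phi>"
      using that by (simp add: cont_hom_def)
    have "closedin (ext_UbT \<omega>) {\<one>\<^bsub>ext_Ub \<omega>\<^esub>}"
      using \<Omega>[OF that(1)] unfolding profinite_def topgroup_def
      by (intro compactin_imp_closedin) (auto intro: finite_imp_compactin monoid.one_closed group.is_monoid)
    then show "openin (ext_UbT \<omega>) (topspace (ext_UbT \<omega>) - {\<one>\<^bsub>ext_Ub \<omega>\<^esub>})"
      by blast
  qed
  have "openin \<tau> ?W"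
    using op by (intro openin_Union) auto
  then have "closedin \<tau> (topspace \<tau> - ?W)"
    by (rule closedin_diff[OF closedin_topspace])
  moreover have "topspace \<tau> - ?W = Tbar \<Omega> G \<tau>"
  proof -
    have "\<phi> x \<in> topspace (ext_UbT \<omega>)"
      if "\<phi> \<in> cont_hom G \<tau> (ext_Ub \<omega>) (ext_UbT \<omega>)" "x \<in> carrier G" for \<phi> x \<omega>
      using that top by (auto simp: cont_hom_def continuous_map_def)
    then show ?thesis
      by (auto simp: mem_Tbar_iff top) blast
  qed
  ultimately show ?thesis
    by (simp only:)
qed

text \<open>Composing \<open>\<xi>\<close> with the embedding of Z/p from (II) gives a homomorphism
  to \<open>Ub\<close>, which is trivial on \<open>Tbar\<close> by definition; injectivity of the
  embedding carries this back to \<open>\<xi>\<close>.\<close>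

lemma cond_II_kill:
  assumes II: "cond_II p \<omega>" and grp: "group (ext_Ub \<omega>)" and p: "0 < p"
    and top: "topspace \<tau> = carrier G" and \<omega>: "\<omega> \<in> \<Omega>" and t: "t \<in> Tbar \<Omega> G \<tau>"
    and \<xi>: "continuous_map \<tau> (Zp_top p) \<xi>" "hom_mod G p (carrier G) \<xi>" and cl: "group G"
  shows "[\<xi> t = 0] (mod p)"
proof -
  interpret Ub: group "ext_Ub \<omega>" by fact
  interpret G: group G by fact
  obtain e where e: "e \<in> hom (Zp p) (ext_Ub \<omega>)" "continuous_map (Zp_top p) (ext_UbT \<omega>) e" "inj_on e {0..<p}"
    using II by (auto simp: cond_II_def cont_hom_def)
  have range: "\<xi> x \<in> {0..<p}" if "x \<in> carrier G" for x
    using \<xi>(1) that top by (auto simp: Zp_top_def continuous_map_discrete_iff)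
  have e_closed: "e a \<in> carrier (ext_Ub \<omega>)" if "a \<in> {0..<p}" for a
    using e(1) that by (auto simp: hom_def Zp_def)
  have e_mult: "e ((a + b) mod p) = e a \<otimes>\<^bsub>ext_Ub \<omega>\<^esub> e b" if "a \<in> {0..<p}" "b \<in> {0..<p}" for a b
    using hom_mult[OF e(1), of a b] that by (simp add: Zp_def)
  have "(\<lambda>x. e (\<xi> x)) \<in> cont_hom G \<tau> (ext_Ub \<omega>) (ext_UbT \<omega>)"
    unfolding cont_hom_def
  proof (intro CollectI conjI homI)
    show "continuous_map \<tau> (ext_UbT \<omega>) (\<lambda>x. e (\<xi> x))"
      using continuous_map_compose[OF \<xi>(1) e(2)] by (simp add: o_def)
    show "e (\<xi> x) \<in> carrier (ext_Ub \<omega>)" if "x \<in> carrier G" for x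
      using range[OF that] by (rule e_closed)
    show "e (\<xi> (x \<otimes>\<^bsub>G\<^esub> y)) = e (\<xi> x) \<otimes>\<^bsub>ext_Ub \<omega>\<^esub> e (\<xi> y)"
      if xy: "x \<in> carrier G" "y \<in> carrier G" for x y
    proof -
      have "\<xi> (x \<otimes>\<^bsub>G\<^esub> y) = (\<xi> x + \<xi> y) mod p"
        using hom_modD[OF \<xi>(2) xy] range[OF G.m_closed[OF xy]] by (simp add: cong_def)
      then show ?thesis
        using e_mult range xy by simp
    qed
  qed
  then have "e (\<xi> t) = \<one>\<^bsub>ext_Ub \<omega>\<^esub>"
    using t \<omega> by (auto simp: mem_Tbar_iff)
  moreover have "e 0 = \<one>\<^bsub>ext_Ub \<omega>\<^esub>"
    using e_mult[of 0 0] p e_closed[of 0] Ub.l_cancel_one'[of "e 0" "e 0"] by simp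
  ultimately have "\<xi> t = 0"
    using inj_onD[OF e(3), of "\<xi> t" 0] range[of t] t p by (auto simp: mem_Tbar_iff)
  then show ?thesis
    by simp
qed

section \<open>Translation of (a) into characters\<close>

theorem theorem7p5:
  fixes p :: int
    and \<Omega> :: "('u, 'v) cext set"
    and G :: "'g monoid" and \<tau> :: "'g topology"
    and N :: "'g set"
  assumes "Factorial_Ring.prime p"
    and "\<Omega> \<noteq> {}"
    and "\<forall>\<omega>\<in>\<Omega>. central_ext p \<omega> \<and> cond_I \<omega> \<and> cond_II p \<omega>"
    and "profinite G \<tau>"
    and "N \<lhd> G" and "closedin \<tau> N"
    and "N \<subseteq> Tbar \<Omega> G \<tau>"
  shows
    "(\<lambda>g. N #>\<^bsub>G\<^esub> g) ` Tgrp \<Omega> G \<tau> = Tgrp \<Omega> (G Mod N) (quot_top G \<tau> N)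
     \<longleftrightarrow>
     (let Tb = Tbar \<Omega> G \<tau>;
          Gb = G Mod Tb;
          \<tau>b = quot_top G \<tau> Tb;
          H = H2grp Gb \<tau>b p;
          Pi = {pullback Gb \<tau>b p \<rho>b (ext_class p \<omega>) | \<omega> \<rho>b.
                  \<omega> \<in> \<Omega> \<and> \<rho>b \<in> cont_hom Gb \<tau>b (ext_Ub \<omega>) (ext_UbT \<omega>) \<and>
                  (\<exists>\<rho>\<in>cont_hom G \<tau> (ext_U \<omega>) (ext_UT \<omega>).
                     \<forall>g\<in>carrier G. ext_lam \<omega> (\<rho> g) = \<rho>b (Tb #>\<^bsub>G\<^esub> g))};
          KerInf = {c \<in> carrier H.
                  pullback (G Mod N) (quot_top G \<tau> N) p (\<lambda>C. Tb <#>\<^bsub>G\<^esub> C) c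
                    = \<one>\<^bsub>H2grp (G Mod N) (quot_top G \<tau> N) p\<^esub>}
      in generate H (Pi \<inter> KerInf) = generate H Pi \<inter> KerInf)"
proof -
  define M where "M = Tbar \<Omega> G \<tau>"
  define P where "P = {pullback (G Mod M) (quot_top G \<tau> M) p \<rho>b (ext_class p \<omega>) | \<omega> \<rho>b.
      \<omega> \<in> \<Omega> \<and> \<rho>b \<in> cont_hom (G Mod M) (quot_top G \<tau> M) (ext_Ub \<omega>) (ext_UbT \<omega>) \<and>
      (\<exists>\<rho>\<in>cont_hom G \<tau> (ext_U \<omega>) (ext_UT \<omega>). \<forall>g\<in>carrier G. ext_lam \<omega> (\<rho> g) = \<rho>b (M #>\<^bsub>G\<^esub> g))}"
  have p_pos: "0 < p"
    using assms(1) by (rule prime_gt_0_int)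
  have ext: "central_ext p \<omega>" "cond_I \<omega>" "cond_II p \<omega>" if "\<omega> \<in> \<Omega>" for \<omega>
    using assms(3) that by auto
  have E: "central_extension p \<omega>" if "\<omega> \<in> \<Omega>" for \<omega>
    using ext(1)[OF that] p_pos by unfold_locales
  have prof: "profinite (ext_U \<omega>) (ext_UT \<omega>)" "profinite (ext_Ub \<omega>) (ext_UbT \<omega>)" if "\<omega> \<in> \<Omega>" for \<omega>
    using central_extension.profinite_U[OF E[OF that]] central_extension.profinite_Ub[OF E[OF that]] .
  have grp: "group (ext_U \<omega>)" "group (ext_Ub \<omega>)" if "\<omega> \<in> \<Omega>" for \<omega>
    using prof[OF that] by (auto simp: profinite_def topgroup_def)
  have G: "group G" and top: "topspace \<tau> = carrier G" and comp: "compact_space \<tau>"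
    using assms(4) by (auto simp: profinite_def topgroup_def)
  have M_normal: "M \<lhd> G"
    unfolding M_def by (rule normal_Tbar[OF G grp(2)])
  have M_closed: "closedin \<tau> M"
    unfolding M_def by (rule closedin_Tbar[OF top prof(2)])
  have NM: "N \<subseteq> M"
    using assms(7) by (simp add: M_def)
  \<comment> \<open>One extension supplies, through (II), the assumption \<open>kill\<close> on
    homomorphisms to Z/p.\<close>
  obtain \<omega>0 where \<omega>0: "\<omega>0 \<in> \<Omega>"
    using assms(2) by blast
  interpret T: transgression G \<tau> p M
  proof (rule transgression.intro; (rule top assms(1) M_normal)?)
    fix \<xi> t assume "continuous_map \<tau> (Zp_top p) \<xi>" "hom_mod G p (carrier G) \<xi>" "t \<in> M"
    then show "[\<xi> t = 0] (mod p)"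
      using cond_II_kill[OF ext(3)[OF \<omega>0] grp(2)[OF \<omega>0] p_pos top \<omega>0] G by (auto simp: M_def)
  qed
  have N_sub: "subgroup N G"
    using assms(5) by (rule normal_imp_subgroup)
  have kerinf: "{c \<in> carrier T.H. pullback (G Mod N) (quot_top G \<tau> N) p (\<lambda>C. M <#>\<^bsub>G\<^esub> C) c =
      \<one>\<^bsub>H2grp (G Mod N) (quot_top G \<tau> N) p\<^esub>} = T.annihilator N"
    by (rule T.inflation_kernel_eq_annihilator[OF assms(5) NM])
  \<comment> \<open>Together with \<open>P_class\<close> this shows that the members of
    \<open>P\<close> and the homomorphisms from G to the groups \<open>U\<close> have the same
    kernels inside M.\<close>
  have P_hom: "\<exists>\<omega>\<in>\<Omega>. \<exists>\<rho>\<in>cont_hom G \<tau> (ext_U \<omega>) (ext_UT \<omega>).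
      c \<in> T.inf_kernel \<and> (\<forall>t\<in>M. [T.character c t = 0] (mod p) \<longleftrightarrow> \<rho> t = \<one>\<^bsub>ext_U \<omega>\<^esub>)" if "c \<in> P" for c
  proof -
    obtain \<omega> \<rho>b \<rho> where *: "c = pullback (G Mod M) (quot_top G \<tau> M) p \<rho>b (ext_class p \<omega>)" "\<omega> \<in> \<Omega>"
      "\<rho>b \<in> cont_hom (G Mod M) (quot_top G \<tau> M) (ext_Ub \<omega>) (ext_UbT \<omega>)"
      "\<rho> \<in> cont_hom G \<tau> (ext_U \<omega>) (ext_UT \<omega>)" "\<And>g. g \<in> carrier G \<Longrightarrow> ext_lam \<omega> (\<rho> g) = \<rho>b (M #>\<^bsub>G\<^esub> g)"
      using \<open>c \<in> P\<close> unfolding P_def by blast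
    show ?thesis
      using T.pullback_ext_class[OF ext(1)[OF *(2)] *(4,3,5)] *(1,2,4) by blast
  qed
  \<comment> \<open>The composite of \<open>\<rho>\<close> with \<open>ext_lam \<omega>\<close> is
    trivial on M by the definition of \<open>Tbar\<close>, so it factors through G/M as a liftable
    \<open>\<rho>b\<close>.\<close>
  have P_class: "\<exists>c\<in>P. \<forall>t\<in>M. [T.character c t = 0] (mod p) \<longleftrightarrow> \<rho> t = \<one>\<^bsub>ext_U \<omega>\<^esub>"
    if \<omega>: "\<omega> \<in> \<Omega>" and \<rho>: "\<rho> \<in> cont_hom G \<tau> (ext_U \<omega>) (ext_UT \<omega>)" for \<omega> \<rho>
  proof -
    have lam: "ext_lam \<omega> \<in> cont_hom (ext_U \<omega>) (ext_UT \<omega>) (ext_Ub \<omega>) (ext_UbT \<omega>)"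
      using ext(1)[OF \<omega>] by (simp add: central_ext_def)
    note comp = cont_hom_compose[OF \<rho> lam]
    obtain \<rho>b where \<rho>b: "\<rho>b \<in> cont_hom (G Mod M) (quot_top G \<tau> M) (ext_Ub \<omega>) (ext_UbT \<omega>)"
      "\<And>g. g \<in> carrier G \<Longrightarrow> \<rho>b (M #>\<^bsub>G\<^esub> g) = ext_lam \<omega> (\<rho> g)"
      by (rule cont_hom_quotient_factor[OF G M_normal top grp(2)[OF \<omega>] comp])
        (use comp \<omega> in \<open>auto simp: M_def mem_Tbar_iff\<close>)
    have "pullback (G Mod M) (quot_top G \<tau> M) p \<rho>b (ext_class p \<omega>) \<in> P"
      unfolding P_def mem_Collect_eq using \<omega> \<rho> \<rho>b
      by (intro exI[of _ \<omega>] exI[of _ \<rho>b] conjI refl bexI[of _ \<rho>]) simp_all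
    then show ?thesis
      using T.pullback_ext_class(2)[OF ext(1)[OF \<omega>] \<rho> \<rho>b(1) \<rho>b(2)[symmetric]] by blast
  qed
  have P_inf: "P \<subseteq> T.inf_kernel"
    using P_hom by blast
  have one: "\<gamma> \<one>\<^bsub>ext_Ub \<omega>\<^esub> = \<one>\<^bsub>ext_U \<omega>\<^esub>"
    if "\<omega> \<in> \<Omega>" "\<gamma> \<in> cont_hom (ext_Ub \<omega>) (ext_UbT \<omega>) (ext_U \<omega>) (ext_UT \<omega>)" for \<omega> \<gamma>
    using hom_one[OF _ grp(2)[OF that(1)] grp(1)[OF that(1)]] that(2) by (simp add: cont_hom_def)
  \<comment> \<open>The hypothesis holds for elements of T(G) and for elements whose coset lies in
    T(G/N), so both kinds belong to M.\<close>
  have TbarI: "g \<in> M" if "g \<in> carrier G"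
    "\<And>\<omega> \<rho>. \<omega> \<in> \<Omega> \<Longrightarrow> \<rho> \<in> cont_hom G \<tau> (ext_U \<omega>) (ext_UT \<omega>) \<Longrightarrow>
        \<forall>n\<in>N. \<rho> n = \<one>\<^bsub>ext_U \<omega>\<^esub> \<Longrightarrow> \<rho> g = \<one>\<^bsub>ext_U \<omega>\<^esub>" for g
    unfolding M_def
  proof (rule cond_I_mem_Tbar[of \<Omega> N])
    show "\<rho> g = \<one>\<^bsub>ext_U \<omega>\<^esub>" if "\<omega> \<in> \<Omega>" "\<rho> \<in> cont_hom G \<tau> (ext_U \<omega>) (ext_UT \<omega>)"
      "\<forall>n\<in>N. \<rho> n = \<one>\<^bsub>ext_U \<omega>\<^esub>" for \<omega> \<rho>
      using that by (rule \<open>\<And>\<omega> \<rho>. \<omega> \<in> \<Omega> \<Longrightarrow> \<rho> \<in> cont_hom G \<tau> (ext_U \<omega>) (ext_UT \<omega>) \<Longrightarrow>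
        \<forall>n\<in>N. \<rho> n = \<one>\<^bsub>ext_U \<omega>\<^esub> \<Longrightarrow> \<rho> g = \<one>\<^bsub>ext_U \<omega>\<^esub>\<close>)
  qed (use ext(2) one assms(7) \<open>g \<in> carrier G\<close> in simp_all)
  have mem_T: "t \<in> Tgrp \<Omega> G \<tau> \<longleftrightarrow> t \<in> M \<and> (\<forall>c\<in>P. [T.character c t = 0] (mod p))" for t
  proof
    assume t: "t \<in> Tgrp \<Omega> G \<tau>"
    then have "t \<in> M"
      by (intro TbarI) (auto simp: mem_Tgrp_iff)
    moreover have "[T.character c t = 0] (mod p)" if "c \<in> P" for c
      using P_hom[OF that] t \<open>t \<in> M\<close> unfolding mem_Tgrp_iff by metis
    ultimately show "t \<in> M \<and> (\<forall>c\<in>P. [T.character c t = 0] (mod p))"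
      by blast
  next
    assume t: "t \<in> M \<and> (\<forall>c\<in>P. [T.character c t = 0] (mod p))"
    then show "t \<in> Tgrp \<Omega> G \<tau>"
      unfolding mem_Tgrp_iff using P_class T.mem_carrier by metis
  qed
  \<comment> \<open>A member of \<open>P\<close> annihilates N exactly when the corresponding
    \<open>\<rho>\<close> is trivial on N, and such \<open>\<rho>\<close> are the ones that come
    from G/N.\<close>
  have mem_TN: "N #>\<^bsub>G\<^esub> g \<in> Tgrp \<Omega> (G Mod N) (quot_top G \<tau> N) \<longleftrightarrow>
      g \<in> M \<and> (\<forall>c\<in>P \<inter> T.annihilator N. [T.character c g = 0] (mod p))" if g: "g \<in> carrier G" for g
  proof (rule trans[OF coset_mem_Tgrp_quotient_iff[OF G assms(5) top grp(1) g]], assumption, rule iffI)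
    assume L: "\<forall>\<omega>\<in>\<Omega>. \<forall>\<rho>\<in>cont_hom G \<tau> (ext_U \<omega>) (ext_UT \<omega>).
      (\<forall>n\<in>N. \<rho> n = \<one>\<^bsub>ext_U \<omega>\<^esub>) \<longrightarrow> \<rho> g = \<one>\<^bsub>ext_U \<omega>\<^esub>"
    then have gM: "g \<in> M"
      by (intro TbarI[OF g]) blast
    have "[T.character c g = 0] (mod p)" if c: "c \<in> P \<inter> T.annihilator N" for c
    proof -
      obtain \<omega> \<rho> where *: "\<omega> \<in> \<Omega>" "\<rho> \<in> cont_hom G \<tau> (ext_U \<omega>) (ext_UT \<omega>)"
        "\<And>t. t \<in> M \<Longrightarrow> [T.character c t = 0] (mod p) \<longleftrightarrow> \<rho> t = \<one>\<^bsub>ext_U \<omega>\<^esub>"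
        using P_hom[of c] c by blast
      have "\<forall>n\<in>N. \<rho> n = \<one>\<^bsub>ext_U \<omega>\<^esub>"
        using c *(3) NM by (auto simp: T.annihilator_def)
      then show ?thesis
        using L *(1,2) *(3)[OF gM] by blast
    qed
    with gM show "g \<in> M \<and> (\<forall>c\<in>P \<inter> T.annihilator N. [T.character c g = 0] (mod p))"
      by blast
  next
    assume R: "g \<in> M \<and> (\<forall>c\<in>P \<inter> T.annihilator N. [T.character c g = 0] (mod p))"
    show "\<forall>\<omega>\<in>\<Omega>. \<forall>\<rho>\<in>cont_hom G \<tau> (ext_U \<omega>) (ext_UT \<omega>).
      (\<forall>n\<in>N. \<rho> n = \<one>\<^bsub>ext_U \<omega>\<^esub>) \<longrightarrow> \<rho> g = \<one>\<^bsub>ext_U \<omega>\<^esub>"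
    proof (intro ballI impI)
      fix \<omega> \<rho> assume *: "\<omega> \<in> \<Omega>" "\<rho> \<in> cont_hom G \<tau> (ext_U \<omega>) (ext_UT \<omega>)" "\<forall>n\<in>N. \<rho> n = \<one>\<^bsub>ext_U \<omega>\<^esub>"
      obtain c where c: "c \<in> P" "\<And>t. t \<in> M \<Longrightarrow> [T.character c t = 0] (mod p) \<longleftrightarrow> \<rho> t = \<one>\<^bsub>ext_U \<omega>\<^esub>"
        using P_class[OF *(1,2)] by blast
      have "c \<in> T.annihilator N"
        using c P_inf *(3) NM by (auto simp: T.annihilator_def)
      then show "\<rho> g = \<one>\<^bsub>ext_U \<omega>\<^esub>"
        using R c by blast
    qed
  qed
  have char_mult: "[T.character c (s \<otimes>\<^bsub>G\<^esub> t) = T.character c s + T.character c t] (mod p)"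
    if "c \<in> P" "s \<in> M" "t \<in> M" for c s t
    using T.hom_mod_character[of c] P_inf that by (auto intro: hom_modD)
  \<comment> \<open>The right-hand side puts the preimage of T(G/N) inside N T(G): an
    \<open>n\<close> in N has the same characters from \<open>P\<close> as \<open>t\<close>
    precisely when the inverse of \<open>n\<close> times \<open>t\<close> lies in T(G).\<close>
  have "(\<lambda>g. N #>\<^bsub>G\<^esub> g) ` Tgrp \<Omega> G \<tau> = Tgrp \<Omega> (G Mod N) (quot_top G \<tau> N) \<longleftrightarrow>
    (\<forall>t\<in>M. (\<forall>c\<in>P \<inter> T.annihilator N. [T.character c t = 0] (mod p)) \<longrightarrow>
      (\<exists>n\<in>N. \<forall>c\<in>P. [T.character c n = T.character c t] (mod p)))" (is "?L \<longleftrightarrow> ?R")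
  proof
    assume L: ?L
    show ?R
    proof (intro ballI impI)
      fix t assume t: "t \<in> M" "\<forall>c\<in>P \<inter> T.annihilator N. [T.character c t = 0] (mod p)"
      then have "N #>\<^bsub>G\<^esub> t \<in> (\<lambda>g. N #>\<^bsub>G\<^esub> g) ` Tgrp \<Omega> G \<tau>"
        using L mem_TN[of t] T.mem_carrier[of t] by blast
      then obtain u where u: "u \<in> Tgrp \<Omega> G \<tau>" "N #>\<^bsub>G\<^esub> t = N #>\<^bsub>G\<^esub> u"
        by blast
      then have "t \<in> N #>\<^bsub>G\<^esub> u"
        using T.rcos_self[OF T.mem_carrier[OF t(1)] N_sub] by simp
      then obtain n where n: "n \<in> N" "t = n \<otimes>\<^bsub>G\<^esub> u"
        by (auto simp: r_coset_def)
      have "[T.character c n = T.character c t] (mod p)" if c: "c \<in> P" for c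
      proof -
        have "[T.character c t = T.character c n + T.character c u] (mod p)"
          unfolding n(2) using char_mult[OF c] n(1) NM u(1) mem_T by blast
        also have "[T.character c n + T.character c u = T.character c n + 0] (mod p)"
          using u(1) c mem_T by (intro cong_add[OF cong_refl]) blast
        finally show ?thesis
          by (simp add: cong_sym)
      qed
      then show "\<exists>n\<in>N. \<forall>c\<in>P. [T.character c n = T.character c t] (mod p)"
        using n(1) by blast
    qed
  next
    assume R: ?R
    show ?L
    proof (intro equalityI subsetI)
      fix C assume "C \<in> (\<lambda>g. N #>\<^bsub>G\<^esub> g) ` Tgrp \<Omega> G \<tau>"
      then obtain t where t: "C = N #>\<^bsub>G\<^esub> t" "t \<in> M" "\<forall>c\<in>P. [T.character c t = 0] (mod p)"
        using mem_T by blast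
      then show "C \<in> Tgrp \<Omega> (G Mod N) (quot_top G \<tau> N)"
        using mem_TN[OF T.mem_carrier[OF t(2)]] by blast
    next
      fix C assume C: "C \<in> Tgrp \<Omega> (G Mod N) (quot_top G \<tau> N)"
      then obtain g where g: "g \<in> carrier G" "C = N #>\<^bsub>G\<^esub> g"
        by (auto simp: mem_Tgrp_iff carrier_FactGroup)
      then have gM: "g \<in> M" "\<forall>c\<in>P \<inter> T.annihilator N. [T.character c g = 0] (mod p)"
        using mem_TN C by blast+
      then obtain n where n: "n \<in> N" "\<And>c. c \<in> P \<Longrightarrow> [T.character c n = T.character c g] (mod p)"
        using R by blast
      have nM: "n \<in> M" and nG: "n \<in> carrier G"
        using n(1) NM T.mem_carrier by auto
      define u where "u = inv\<^bsub>G\<^esub> n \<otimes>\<^bsub>G\<^esub> g"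
      have uM: "u \<in> M"
        unfolding u_def using nM gM(1) by simp
      have nu: "n \<otimes>\<^bsub>G\<^esub> u = g"
        using nG g(1) by (simp add: u_def T.m_assoc[symmetric])
      have "[T.character c u = 0] (mod p)" if c: "c \<in> P" for c
      proof -
        have "[T.character c g - T.character c n = 0] (mod p)"
          using cong_diff[OF cong_sym[OF n(2)[OF c]] cong_refl[of "T.character c n"]] by simp
        moreover have "[T.character c g - T.character c n = T.character c u] (mod p)"
          using cong_diff[OF char_mult[OF c nM uM] cong_refl[of "T.character c n"]] nu by simp
        ultimately show ?thesis
          using cong_trans[OF cong_sym] by blast
      qed
      then have "u \<in> Tgrp \<Omega> G \<tau>"
        using uM mem_T by blast
      moreover have "N #>\<^bsub>G\<^esub> u = C"
      proof -
        have "g \<in> N #>\<^bsub>G\<^esub> u"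
          using n(1) nu by (auto simp: r_coset_def)
        then show ?thesis
          using T.repr_independence[OF _ _ N_sub] T.mem_carrier[OF uM] g(2) by simp
      qed
      ultimately show "C \<in> (\<lambda>g. N #>\<^bsub>G\<^esub> g) ` Tgrp \<Omega> G \<tau>"
        by blast
    qed
  qed
  also have "\<dots> \<longleftrightarrow> generate T.H (P \<inter> T.annihilator N) = generate T.H P \<inter> T.annihilator N"
    by (rule T.generate_Int_annihilator_iff[OF comp M_closed N_sub NM assms(6) P_inf, symmetric])
  finally show ?thesis
    unfolding Let_def M_def[symmetric] P_def[symmetric] kerinf .
qed

end
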